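(* Let $p\in(1,\infty)$ and $q,m\in(0,\infty)$. Let $u,w,v$ be weights such that the pair $(u,w)$ is admissible with respect to $(m,q)$, and let $\{t_k\}_{k\in\mathbb K}$ be a corresponding discretizing sequence. Let $$C=\sup_{h\in\mathfrak M_+}\frac{\left(\int_0^{\infty}\left(\int_t^\infty \left(\int_s^{\infty}h(y)\,dy\right)^m u(s)\,ds\right)^{\frac{q}{m}}w(t)\,dt\right)^{\frac{1}{q}}}{\left(\int_0^{\infty}h(t)^pv(t)\,dt\right)^{\frac{1}{p}}}.$$ (a) Let $1<p\le m<\infty$ and $p\le q<\infty$. Then $C\approx D_1$, where $$D_1=\sup_{k\in\mathbb K}\ \sup_{t\in\Delta_{k-1}}\varphi(t)\left(\int_t^{t_k}v(s)^{1-p'}ds\right)^{\frac1{p'}}.$$ (b) Let $1<p\le m<\infty$ and $0<q<p$. Define $r=\frac{pq}{p-q}$. Then $C\approx D_2$, where $$D_2=\left(\sum_{k\in\mathbb K}\ \sup_{t\in\Delta_{k-1}}\varphi(t)^r\left(\int_t^{t_k}v(s)^{1-p'}ds\right)^{\frac r{p'}}\right)^{\frac1r}.$$ (c) Let $0<m<p<\infty$ and $1<p\le q$. Then $C\approx D_1+D_3$, where $D_1$ is given by the formula in (a) and $$D_3=\sup_{k\in\mathbb K}\left(\int_{\Delta_{k-1}}\varphi(t)^{\frac{mp}{p-m}}\left(\int_t^{t_k}v(s)^{1-p'}ds\right)^{\frac{p(m-1)}{p-m}}v(t)^{1-p'}dt\right)^{\frac{p-m}{mp}}.$$ If, moreover,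 $m\ge1$ or $\int_t^{\infty}v(s)^{1-p'}ds<\infty$ for every $t\in(0,\infty)$, then $D_1\lesssim D_3$ and thus $C\approx D_3$. (d) Let $0<m<p<\infty$, $1<p$ and $0<q<p<\infty$. Define $r=\frac{pq}{p-q}$. Then $C\approx D_1+D_4$, where $D_1$ is given by the formula in (a) and $$D_4=\left(\sum_{k\in\mathbb K}\left(\int_{\Delta_{k-1}}\varphi(t)^{\frac{mp}{p-m}}\left(\int_t^{t_k}v(s)^{1-p'}ds\right)^{\frac{p(m-1)}{p-m}}v(t)^{1-p'}dt\right)^{\frac{q(p-m)}{m(p-q)}}\right)^{\frac1r}.$$ If, moreover, $m\ge1$ or $\int_t^{\infty}v(s)^{1-p'}ds<\infty$ for every $t\in(0,\infty)$, then $D_1\lesssim D_4$ and thus $C\approx D_4$.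
   Context: $\mathfrak M_+$ is the cone of all non-negative measurable functions on $(0,\infty)$. A weight is a measurable non-negative function on $(0,\infty)$. $p'=\frac{p}{p-1}$. For $t\in[0,\infty]$ put $$\varphi(t)=\left(\int_0^{t}\left(\int_s^t u(y)\,dy\right)^{\frac{q}{m}}w(s)\,ds\right)^{\frac1q}.$$ The pair of weights $(u,w)$ is admissible with respect to $(m,q)$ if $0<\varphi(t)<\infty$ for every $t\in(0,\infty)$. Discretizing sequence. Let $(u,w)$ be admissible with respect to $(m,q)$. Define $K=0$ if $\varphi(\infty)<\infty$ and $K=\infty$ if $\varphi(\infty)=\infty$, and $\mathbb K=\{k\in\mathbb Z\cup\{\infty\}:k\le K\}$. A sequence $\{t_k\}_{k\in\mathbb K}$ is called a discretizing sequence (for $(u,w)$ and $(m,q)$) if, with $\Delta_k=[t_k,t_{k+1}]$ for $k\in\mathbb K\setminus\{K\}$, there are disjoint sets $\mathbb K_1,\mathbb K_2$ with $\mathbb K=\mathbb K_1\cup\mathbb K_2$ such that - $0<t_{k-1}\le t_k<\infty$ for every $k\in\mathbb K\setminus\{K\}$, and $t_K=\infty$; - $\frac{2^{\frac qm+1}}{2^{\frac qm+1}-1}\int_{\Delta_{k-1}}w(t)\,dt\ \ge\ \int_0^{t_k}w(t)\,dt\ \ge\ 2^{\frac qm+1}\int_0^{t_{k-1}}w(t)\,dt$ for all $k\in\mathbb K$; - $\varphi(t_k)^q\ge2^{\frac qm+1}\varphi(t_{k-1})^q$ for all $k\in\mathbb K$; - $\int_0^{t_k}w(t)\,dt=2^{\frac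 qm+1}\int_0^{t_{k-1}}w(t)\,dt$ for all $k\in\mathbb K_1$; - $\varphi(t_k)^q=2^{\frac qm+1}\varphi(t_{k-1})^q$ for all $k\in\mathbb K_2$; - for all $k\in\mathbb K$ and $t\in\Delta_{k-1}$, $$\varphi(t)^q\lesssim\int_{\Delta_{k-3}}w(s)\,ds\left(\int_{\Delta_{k-2}}u(y)\,dy\right)^{\frac qm}+\int_{\Delta_{k-2}}w(s)\left(\int_s^{t_{k-1}}u(y)\,dy\right)^{\frac qm}ds+\int_{\Delta_{k-2}}w(s)\,ds\left(\int_{t_{k-1}}^t u(y)\,dy\right)^{\frac qm}.$$ If $K=\infty$, the index $k=\infty$ only serves to set $t_\infty=\infty$: the conditions above involving $\Delta_{k-1}$ or $t_{k-1}$ are understood for finite $k$, and in sums and suprema over $k\in\mathbb K$ of expressions involving $\Delta_{k-1}$ the index $k=\infty$ contributes nothing. $A\lesssim B$ means $A\le cB$ with a constant $c\in(0,\infty)$ that may depend only on the exponents $m,p,q$ (not on the weights, $k$, $t$ or the sequence); $A\approx B$ means $A\lesssim B$ and $B\lesssim A$. All quantities take values in $[0,\infty]$. Conventions: $0\cdot\infty=0$, $\frac00=0$, $a^0=1$ for all $a\in[0,\infty]$ (and, as usual, $0$ to a negative power is $\infty$, $\infty$ to a negative power is $0$). The number $C\in[0,\infty]$ is the optimal (least) constant in the inequality "numerator $\le C\cdot$ denominator" required for all $h\in\mathfrak M_+$. *)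

theory Defs
  imports "HOL-Analysis.Analysis"
begin

text \<open>
  All quantities are \<^typ>\<open>ennreal\<close>-valued, where \<open>0 * \<infinity> = 0\<close> and \<open>0 / 0 = 0\<close> hold already
  (moreover \<open>a / 0 = \<infinity>\<close> for \<open>a \<noteq> 0\<close>, and \<open>a / \<infinity> = 0\<close>). Weights and test functions are
  functions on the reals of which only the restriction to \<open>(0, \<infinity>)\<close> is ever used.
\<close>

definition epowr :: "ennreal \<Rightarrow> real \<Rightarrow> ennreal"  (infixr "epowr" 80)
  where "x epowr a =
    (if a = 0 then 1
     else if x = 0 then (if a > 0 then 0 else \<infinity>)
     else if x = \<infinity> then (if a > 0 then \<infinity> else 0)
     else ennreal (enn2real x powr a))"

definition Mplus :: "(real \<Rightarrow> ennreal) set"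
  where "Mplus = borel_measurable (lebesgue_on {0<..})"

abbreviation weight :: "(real \<Rightarrow> ennreal) \<Rightarrow> bool"
  where "weight w \<equiv> w \<in> Mplus"

text \<open>\<open>\<integral>\<^sub>a\<^sup>b f\<close>, with extended endpoints; \<^term>\<open>einterval a b\<close> is the open interval.\<close>

definition ivl_int :: "ereal \<Rightarrow> ereal \<Rightarrow> (real \<Rightarrow> ennreal) \<Rightarrow> ennreal"
  where "ivl_int a b f = (\<integral>\<^sup>+x\<in>einterval a b. f x \<partial>lebesgue)"

definition conj_exp :: "real \<Rightarrow> real"
  where "conj_exp p = p / (p - 1)"

definition phi :: "real \<Rightarrow> real \<Rightarrow> (real \<Rightarrow> ennreal) \<Rightarrow> (real \<Rightarrow> ennreal) \<Rightarrow> ereal \<Rightarrow> ennreal"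
  where "phi m q u w t =
    (ivl_int 0 t (\<lambda>s. (ivl_int (ereal s) t u) epowr (q / m) * w s)) epowr (1 / q)"

definition admissible :: "real \<Rightarrow> real \<Rightarrow> (real \<Rightarrow> ennreal) \<Rightarrow> (real \<Rightarrow> ennreal) \<Rightarrow> bool"
  where "admissible m q u w \<longleftrightarrow>
    (\<forall>t::real. 0 < t \<longrightarrow> 0 < phi m q u w (ereal t) \<and> phi m q u w (ereal t) < \<infinity>)"

text \<open>
  The finite elements of the index set \<open>\<bbbK>\<close>, and those of \<open>\<bbbK> - {K}\<close>. If \<open>\<phi>(\<infinity>) = \<infinity>\<close>, so that
  \<open>K = \<infinity>\<close>, the index \<open>k = \<infinity>\<close> carries no information beyond the convention \<open>t\<^sub>\<infinity> = \<infinity>\<close> and is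
  left out; sequences are therefore indexed by \<^typ>\<open>int\<close>. If \<open>K = 0\<close>, the values of a sequence
  at positive indices are irrelevant.
\<close>

definition index_set :: "real \<Rightarrow> real \<Rightarrow> (real \<Rightarrow> ennreal) \<Rightarrow> (real \<Rightarrow> ennreal) \<Rightarrow> int set"
  where "index_set m q u w = (if phi m q u w \<infinity> < \<infinity> then {..0} else UNIV)"

definition index_set_below :: "real \<Rightarrow> real \<Rightarrow> (real \<Rightarrow> ennreal) \<Rightarrow> (real \<Rightarrow> ennreal) \<Rightarrow> int set"
  where "index_set_below m q u w = (if phi m q u w \<infinity> < \<infinity> then {..<0} else UNIV)"

definition Delta :: "(int \<Rightarrow> ereal) \<Rightarrow> int \<Rightarrow> ereal set"
  where "Delta t k = {t k..t (k + 1)}"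

definition Delta_int :: "(int \<Rightarrow> ereal) \<Rightarrow> int \<Rightarrow> (real \<Rightarrow> ennreal) \<Rightarrow> ennreal"
  where "Delta_int t k f = ivl_int (t k) (t (k + 1)) f"

text \<open>
  The parameter \<open>c\<close> is the constant hidden in the relation \<open>\<lesssim>\<close> of the last condition. The index
  sets \<open>K1\<close>, \<open>K2\<close> play the role of \<open>\<bbbK>\<^sub>1\<close>, \<open>\<bbbK>\<^sub>2\<close>.
\<close>

definition discretizing ::
    "real \<Rightarrow> real \<Rightarrow> real \<Rightarrow> (real \<Rightarrow> ennreal) \<Rightarrow> (real \<Rightarrow> ennreal) \<Rightarrow> (int \<Rightarrow> ereal) \<Rightarrow> bool"
  where "discretizing c m q u w t \<longleftrightarrow>
    (let \<phi> = phi m q u w;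
         KK = index_set m q u w;
         \<theta> = 2 powr (q / m + 1)
     in (\<forall>k\<in>index_set_below m q u w. 0 < t (k - 1) \<and> t (k - 1) \<le> t k \<and> t k < \<infinity>) \<and>
        (\<phi> \<infinity> < \<infinity> \<longrightarrow> t 0 = \<infinity>) \<and>
        (\<forall>k\<in>KK. ennreal (\<theta> / (\<theta> - 1)) * Delta_int t (k - 1) w \<ge> ivl_int 0 (t k) w \<and>
                 ivl_int 0 (t k) w \<ge> ennreal \<theta> * ivl_int 0 (t (k - 1)) w) \<and>
        (\<forall>k\<in>KK. \<phi> (t k) epowr q \<ge> ennreal \<theta> * \<phi> (t (k - 1)) epowr q) \<and>
        (\<exists>K1 K2. K1 \<inter> K2 = {} \<and> KK = K1 \<union> K2 \<and>
          (\<forall>k\<in>K1. ivl_int 0 (t k) w = ennreal \<theta> * ivl_int 0 (t (k - 1)) w) \<and>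
          (\<forall>k\<in>K2. \<phi> (t k) epowr q = ennreal \<theta> * \<phi> (t (k - 1)) epowr q)) \<and>
        (\<forall>k\<in>KK. \<forall>x\<in>Delta t (k - 1).
          \<phi> x epowr q \<le> ennreal c *
            (Delta_int t (k - 3) w * (Delta_int t (k - 2) u) epowr (q / m)
             + Delta_int t (k - 2) (\<lambda>s. w s * (ivl_int (ereal s) (t (k - 1)) u) epowr (q / m))
             + Delta_int t (k - 2) w * (ivl_int (t (k - 1)) x u) epowr (q / m))))"

definition numerator ::
    "real \<Rightarrow> real \<Rightarrow> (real \<Rightarrow> ennreal) \<Rightarrow> (real \<Rightarrow> ennreal) \<Rightarrow> (real \<Rightarrow> ennreal) \<Rightarrow> ennreal"
  where "numerator m q u w h =
    (ivl_int 0 \<infinity> (\<lambda>t.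
       (ivl_int (ereal t) \<infinity> (\<lambda>s. (ivl_int (ereal s) \<infinity> h) epowr m * u s)) epowr (q / m) * w t))
      epowr (1 / q)"

definition denominator :: "real \<Rightarrow> (real \<Rightarrow> ennreal) \<Rightarrow> (real \<Rightarrow> ennreal) \<Rightarrow> ennreal"
  where "denominator p v h = (ivl_int 0 \<infinity> (\<lambda>t. h t epowr p * v t)) epowr (1 / p)"

definition best_const ::
    "real \<Rightarrow> real \<Rightarrow> real \<Rightarrow> (real \<Rightarrow> ennreal) \<Rightarrow> (real \<Rightarrow> ennreal) \<Rightarrow> (real \<Rightarrow> ennreal) \<Rightarrow> ennreal"
  where "best_const p q m u w v = (SUP h\<in>Mplus. numerator m q u w h / denominator p v h)"

text \<open>
  With the division of \<^typ>\<open>ennreal\<close>, the supremum of the quotients is the optimal constant in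
  the inequality, also when denominators vanish or are infinite.
\<close>

lemma best_const_eq_Inf:
  "best_const p q m u w v =
     Inf {C. \<forall>h\<in>Mplus. numerator m q u w h \<le> C * denominator p v h}"
proof (rule antisym)
  have quot: "a / b \<le> C" if "a \<le> C * b" for a b C :: ennreal
  proof (cases "b = 0 \<or> b = \<infinity>")
    case True
    then show ?thesis using that by (auto simp: ennreal_divide_top)
  next
    case False
    then show ?thesis using that
      by (metis divide_right_mono_ennreal infinity_ennreal_def mult_divide_eq_ennreal)
  qed
  show "best_const p q m u w v
      \<le> Inf {C. \<forall>h\<in>Mplus. numerator m q u w h \<le> C * denominator p v h}"
    unfolding best_const_def by (auto intro!: SUP_least Inf_greatest quot)
next
  have mult: "a \<le> C * b" if "a / b \<le> B" "B < C" for a b B C :: ennreal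
  proof (cases "b = 0 \<or> b = \<infinity>")
    case True
    have "C \<noteq> 0" using that by auto
    moreover have "b = 0 \<Longrightarrow> a = 0"
      using that by (metis ennreal_divide_zero top.extremum_uniqueI not_less_iff_gr_or_eq
          ennreal_zero_less_top infinity_ennreal_def less_top top.extremum_strict)
    ultimately show ?thesis using True by (auto simp: ennreal_mult_top)
  next
    case False
    then have "a = a / b * b"
      by (metis ennreal_divide_times ennreal_times_divide infinity_ennreal_def
          mult.commute mult_divide_eq_ennreal)
    also have "\<dots> \<le> C * b" using that by (intro mult_right_mono) auto
    finally show ?thesis .
  qed
  show "Inf {C. \<forall>h\<in>Mplus. numerator m q u w h \<le> C * denominator p v h}
      \<le> best_const p q m u w v"
  proof (rule dense_ge)
    fix C assume "best_const p q m u w v < C"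
    then have "\<forall>h\<in>Mplus. numerator m q u w h \<le> C * denominator p v h"
      by (intro ballI mult[where B = "best_const p q m u w v"])
        (auto simp: best_const_def intro!: SUP_upper)
    then show "Inf {C. \<forall>h\<in>Mplus. numerator m q u w h \<le> C * denominator p v h} \<le> C"
      by (intro Inf_lower) auto
  qed
qed

definition D1 ::
    "real \<Rightarrow> real \<Rightarrow> real \<Rightarrow> (real \<Rightarrow> ennreal) \<Rightarrow> (real \<Rightarrow> ennreal) \<Rightarrow> (real \<Rightarrow> ennreal)
      \<Rightarrow> (int \<Rightarrow> ereal) \<Rightarrow> ennreal"
  where "D1 p q m u w v t =
    (SUP k\<in>index_set m q u w. SUP x\<in>Delta t (k - 1).
       phi m q u w x
       * (ivl_int x (t k) (\<lambda>s. v s epowr (1 - conj_exp p))) epowr (1 / conj_exp p))"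

definition D2 ::
    "real \<Rightarrow> real \<Rightarrow> real \<Rightarrow> (real \<Rightarrow> ennreal) \<Rightarrow> (real \<Rightarrow> ennreal) \<Rightarrow> (real \<Rightarrow> ennreal)
      \<Rightarrow> (int \<Rightarrow> ereal) \<Rightarrow> ennreal"
  where "D2 p q m u w v t =
    (let r = p * q / (p - q) in
     (\<Sum>\<^sub>\<infinity>k\<in>index_set m q u w. SUP x\<in>Delta t (k - 1).
        phi m q u w x epowr r
        * (ivl_int x (t k) (\<lambda>s. v s epowr (1 - conj_exp p))) epowr (r / conj_exp p))
       epowr (1 / r))"

definition D3 ::
    "real \<Rightarrow> real \<Rightarrow> real \<Rightarrow> (real \<Rightarrow> ennreal) \<Rightarrow> (real \<Rightarrow> ennreal) \<Rightarrow> (real \<Rightarrow> ennreal)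
      \<Rightarrow> (int \<Rightarrow> ereal) \<Rightarrow> ennreal"
  where "D3 p q m u w v t =
    (SUP k\<in>index_set m q u w.
       (Delta_int t (k - 1) (\<lambda>x.
          phi m q u w (ereal x) epowr (m * p / (p - m))
          * (ivl_int (ereal x) (t k) (\<lambda>s. v s epowr (1 - conj_exp p)))
              epowr (p * (m - 1) / (p - m))
          * v x epowr (1 - conj_exp p)))
         epowr ((p - m) / (m * p)))"

definition D4 ::
    "real \<Rightarrow> real \<Rightarrow> real \<Rightarrow> (real \<Rightarrow> ennreal) \<Rightarrow> (real \<Rightarrow> ennreal) \<Rightarrow> (real \<Rightarrow> ennreal)
      \<Rightarrow> (int \<Rightarrow> ereal) \<Rightarrow> ennreal"
  where "D4 p q m u w v t =
    (let r = p * q / (p - q) in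
     (\<Sum>\<^sub>\<infinity>k\<in>index_set m q u w.
        (Delta_int t (k - 1) (\<lambda>x.
           phi m q u w (ereal x) epowr (m * p / (p - m))
           * (ivl_int (ereal x) (t k) (\<lambda>s. v s epowr (1 - conj_exp p)))
               epowr (p * (m - 1) / (p - m))
           * v x epowr (1 - conj_exp p)))
          epowr (q * (p - m) / (m * (p - q))))
       epowr (1 / r))"

text \<open>
  \<open>A \<lesssim> B\<close> and \<open>A \<approx> B\<close> on a class \<open>S\<close> of data, with one constant for the whole class.
\<close>

definition lesssim_on :: "'a set \<Rightarrow> ('a \<Rightarrow> ennreal) \<Rightarrow> ('a \<Rightarrow> ennreal) \<Rightarrow> bool"
  where "lesssim_on S A B \<longleftrightarrow> (\<exists>c::real. 0 < c \<and> (\<forall>x\<in>S. A x \<le> ennreal c * B x))"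

definition approx_on :: "'a set \<Rightarrow> ('a \<Rightarrow> ennreal) \<Rightarrow> ('a \<Rightarrow> ennreal) \<Rightarrow> bool"
  where "approx_on S A B \<longleftrightarrow> lesssim_on S A B \<and> lesssim_on S B A"

text \<open>
  All \<open>(u, w, v, t)\<close> that are possible for given \<open>m\<close>, \<open>q\<close>; \<open>c\<close> is the constant of
  \<^const>\<open>discretizing\<close>.
\<close>

definition setting ::
    "real \<Rightarrow> real \<Rightarrow> real
      \<Rightarrow> ((real \<Rightarrow> ennreal) \<times> (real \<Rightarrow> ennreal) \<times> (real \<Rightarrow> ennreal) \<times> (int \<Rightarrow> ereal)) set"
  where "setting c m q =
    {(u, w, v, t). weight u \<and> weight w \<and> weight v \<and> admissible m q u w \<and> discretizing c m q u w t}"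

end

(* Write W(x) for the integral of w over (0,x), sigma = v^(1-p') and alpha = q/m. Because W(t_k) and phi(t_k)^q grow
   geometrically, a discrete Hardy inequality shows that the q-th power of the numerator is comparable to the sum of
     phi(t_(k-1))^q (int_(Delta_(k-1)) h)^q
       + W(t_(k-1)) (int_(Delta_(k-1)) (int_s^(t_k) h)^m u(s) ds)^alpha,
   a functional in which h enters on Delta_(k-1) only. Each term is the alpha-th power of int H^m dPsi, where
   H(s) = int_s^(t_k) h and Psi(x) = phi(t_(k-1))^m + W(t_(k-1))^(1/alpha) int_(t_(k-1))^x u is comparable to phi(x)^m
   on Delta_(k-1). So the problem splits into one weighted Hardy inequality on each Delta_(k-1), and the local best
   constants are combined by the embedding of l^p into l^q.

   The local inequalities are discretized again, at the points where Psi is multiplied by 3. With the discrete Hardy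
   inequality and Hoelder's inequality this gives the upper bounds. Extremal are the functions h = sigma if p <= m, and
   h = sigma V^((m-1)/(p-m)) Psi^(1/(p-m)) with V(x) = int_x^(t_k) sigma if m < p. If sigma is not integrable over
   some Delta_(k-1), then D1 and C are infinite. *)

theory Submission
  imports Defs
begin

section \<open>Real powers of extended nonnegative reals\<close>

text \<open>Three obstacles shape the proof. First, the integral over an interval involves W and
  \<open>\<phi>\<close>^q at its right end, whereas the local terms carry them at the left end. Only
  one of the two is known to grow by exactly \<theta> there (the sets \<open>K1\<close>,
  \<open>K2\<close>), and either alternative is estimated through that one. Secondly, since 0 * top
  = 0, Hoelder's inequality may fail when one of its integrals is infinite, and since a negative
  power of top is 0, the integrals in D3 and D4 need not see a divergent integral of sigma when m <
  1. Hence D1 in (c) and (d), and hence the local upper bounds assume sigma integrable over the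
  interval. Thirdly, one constant must serve a whole class of data, so every constant is an explicit
  term in c, the exponents and constants that are fixed before the weights.

  The discrete Hardy inequality acts on both scales. It needs weights that grow by a factor above 2:
  globally \<theta> = 2^(\<alpha>+1) provides it, locally it is the reason for the factor 3.\<close>

lemma epowr_0_left [simp]: "0 < a \<Longrightarrow> 0 epowr a = 0"
  and epowr_top_left [simp]: "0 < a \<Longrightarrow> top epowr a = top"
  and epowr_0_right [simp]: "x epowr 0 = 1"
  by (auto simp: epowr_def)

lemma epowr_ennreal: "0 < x \<Longrightarrow> ennreal x epowr a = ennreal (x powr a)"
  by (auto simp: epowr_def)

lemma ennreal_cases3:
  obtains "x = 0" | r where "0 < r" "x = ennreal r" | "x = top"
  by (cases x) (auto simp: less_le)

lemma epowr_1_left [simp]: "1 epowr a = 1"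
  using epowr_ennreal[of 1 a] by simp

lemma epowr_1_right [simp]: "x epowr 1 = x"
  by (cases x rule: ennreal_cases3) (auto simp: epowr_ennreal)

lemma epowr_eq_0_iff [simp]: "0 < a \<Longrightarrow> x epowr a = 0 \<longleftrightarrow> x = 0"
  by (cases x rule: ennreal_cases3) (auto simp: epowr_ennreal)

lemma epowr_pos_iff [simp]: "0 < a \<Longrightarrow> 0 < x epowr a \<longleftrightarrow> 0 < x"
  by (simp add: zero_less_iff_neq_zero)

lemma epowr_eq_top_iff [simp]: "0 < a \<Longrightarrow> x epowr a = top \<longleftrightarrow> x = top"
  by (cases x rule: ennreal_cases3) (auto simp: epowr_ennreal)

lemma epowr_less_top_iff [simp]: "0 < a \<Longrightarrow> x epowr a < top \<longleftrightarrow> x < top"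
  by (simp add: less_top[symmetric])

lemma epowr_mono: "0 \<le> a \<Longrightarrow> x \<le> y \<Longrightarrow> x epowr a \<le> y epowr a"
proof (cases "a = 0")
  case False
  assume "0 \<le> a" "x \<le> y"
  with False show ?thesis
    by (cases x rule: ennreal_cases3; cases y rule: ennreal_cases3)
      (auto simp: epowr_ennreal top_unique intro!: ennreal_leI powr_mono2)
qed auto

text \<open>A negative exponent exchanges 0 and top, in accordance with the rule of signs for a * b,
  so the identity survives at both extreme values.\<close>

lemma epowr_epowr: "(x epowr a) epowr b = x epowr (a * b)"
proof (cases x rule: ennreal_cases3)
  case (2 r)
  then show ?thesis by (simp add: epowr_ennreal powr_powr)
qed (auto simp: epowr_def zero_less_mult_iff)

lemma epowr_inverse [simp]: "a \<noteq> 0 \<Longrightarrow> (x epowr a) epowr (1 / a) = x"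
  "a \<noteq> 0 \<Longrightarrow> (x epowr (1 / a)) epowr a = x"
  by (simp_all add: epowr_epowr)

text \<open>A negative exponent is excluded: for x = 0 and y = top the left side would be top and
  the right side top * 0 = 0.\<close>

lemma epowr_mult: "0 \<le> a \<Longrightarrow> (x * y) epowr a = x epowr a * y epowr a"
proof (cases "a = 0")
  case False
  assume "0 \<le> a"
  with False show ?thesis
    by (cases x rule: ennreal_cases3; cases y rule: ennreal_cases3)
      (auto simp: epowr_ennreal powr_mult ennreal_mult[symmetric] ennreal_mult_top ennreal_top_mult)
qed auto

lemma epowr_add: "0 < a \<Longrightarrow> 0 < b \<Longrightarrow> x epowr (a + b) = x epowr a * x epowr b"
  by (cases x rule: ennreal_cases3) (auto simp: epowr_ennreal powr_add ennreal_mult)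

text \<open>For exponents of opposite sign, as they occur in normalizing factors; at 0 and top the
  right side would become 0 * top.\<close>

lemma epowr_add_finite: "0 < x \<Longrightarrow> x < top \<Longrightarrow> x epowr (a + b) = x epowr a * x epowr b"
  by (cases x rule: ennreal_cases3) (auto simp: epowr_ennreal powr_add ennreal_mult)

lemma epowr_le_iff [simp]: "0 < a \<Longrightarrow> x epowr a \<le> y epowr a \<longleftrightarrow> x \<le> y"
  using epowr_mono[of a x y] epowr_mono[of "1 / a" "x epowr a" "y epowr a"] by auto

lemma epowr_le_swap: "0 < a \<Longrightarrow> x epowr a \<le> y \<longleftrightarrow> x \<le> y epowr (1 / a)"
  using epowr_le_iff[of a x "y epowr (1 / a)"] by simp

lemma epowr_SUP: "0 < a \<Longrightarrow> (SUP i\<in>I. f i) epowr a = (SUP i\<in>I. f i epowr a)"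
proof (intro antisym)
  assume a: "0 < a"
  show "(SUP i\<in>I. f i) epowr a \<le> (SUP i\<in>I. f i epowr a)"
    unfolding epowr_le_swap[OF a] by (rule SUP_least) (auto simp: epowr_le_swap[OF a, symmetric] intro: SUP_upper)
  show "(SUP i\<in>I. f i epowr a) \<le> (SUP i\<in>I. f i) epowr a"
    using a by (intro SUP_least epowr_mono) (auto intro: SUP_upper)
qed

lemma measurable_epowr [measurable]:
  assumes [measurable]: "f \<in> borel_measurable M"
  shows "(\<lambda>x. f x epowr a) \<in> borel_measurable M"
  unfolding epowr_def by measurable

section \<open>Inequalities of Young and Hoelder, superadditivity of powers\<close>

lemma epowr_mult_epowr_le_add:
  assumes "0 < a" "0 < b" "a + b = 1"
  shows "x epowr a * y epowr b \<le> x + y"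
proof -
  \<comment> \<open>Replacing x and y by their maximum leaves a single base, whose exponents add up
    to 1.\<close>
  have "x epowr a * y epowr b \<le> max x y epowr a * max x y epowr b"
    using assms by (intro mult_mono epowr_mono) auto
  also have "\<dots> = max x y"
    using assms epowr_add[of a b "max x y"] by simp
  also have "\<dots> \<le> x + y"
    by (simp add: max_def)
  finally show ?thesis .
qed

lemma add_epowr_le:
  assumes "0 < s"
  shows "(x + y) epowr s \<le> 2 epowr s * (x epowr s + y epowr s)"
proof -
  have "(x + y) epowr s \<le> (2 * max x y) epowr s"
    using assms by (intro epowr_mono) (auto simp: mult_2 intro!: add_mono)
  also have "\<dots> = 2 epowr s * max x y epowr s"
    using assms by (simp add: epowr_mult)
  also have "\<dots> \<le> 2 epowr s * (x epowr s + y epowr s)"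
    by (intro mult_left_mono) (auto simp: max_def)
  finally show ?thesis .
qed

text \<open>One factor is split off: z^s = z * z^(s - 1), and the second factor increases with z
  because s >= 1.\<close>

lemma epowr_add_le_add_epowr:
  assumes "1 \<le> s"
  shows "x epowr s + y epowr s \<le> (x + y) epowr s"
proof (cases "s = 1")
  case False
  have *: "z epowr s = z * z epowr (s - 1)" for z
    using epowr_add[of 1 "s - 1" z] assms False by simp
  have "x epowr s + y epowr s \<le> x * (x + y) epowr (s - 1) + y * (x + y) epowr (s - 1)"
    unfolding *[of x] *[of y] using assms
    by (intro add_mono mult_left_mono epowr_mono) auto
  also have "\<dots> = (x + y) epowr s"
    unfolding *[of "x + y"] by (simp add: distrib_right)
  finally show ?thesis .
qed auto

text \<open>The embedding of l^1 into l^s. It takes the place of Hoelder's inequality for sums when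
  p <= m or p <= q.\<close>

lemma sum_epowr_le:
  assumes "1 \<le> s" "finite F"
  shows "(\<Sum>k\<in>F. f k epowr s) \<le> (\<Sum>k\<in>F. f k) epowr s"
  using assms(2)
proof induction
  case (insert k F)
  have "(\<Sum>k\<in>insert k F. f k epowr s) \<le> f k epowr s + (\<Sum>k\<in>F. f k) epowr s"
    using insert by (auto intro!: add_mono)
  also have "\<dots> \<le> (f k + (\<Sum>k\<in>F. f k)) epowr s"
    by (rule epowr_add_le_add_epowr[OF assms(1)])
  finally show ?case using insert by simp
qed auto

text \<open>The crude Young inequality \<open>x\<^sup>a y\<^sup>b \<le> x + y\<close> in place of the sharp one costs the factor 2.\<close>

lemma sum_Hoelder:
  assumes ab: "0 < a" "0 < b" "a + b = 1" and F: "finite F"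
  shows "(\<Sum>k\<in>F. x k epowr a * y k epowr b)
      \<le> 2 * ((\<Sum>k\<in>F. x k) epowr a * (\<Sum>k\<in>F. y k) epowr b)"
proof -
  define X Y where "X = (\<Sum>k\<in>F. x k)" and "Y = (\<Sum>k\<in>F. y k)"
  consider "X = 0 \<or> Y = 0" | "X \<noteq> 0" "Y \<noteq> 0" "X = top \<or> Y = top" | "X \<noteq> 0" "Y \<noteq> 0" "X \<noteq> top" "Y \<noteq> top"
    by blast
  then have "(\<Sum>k\<in>F. x k epowr a * y k epowr b) \<le> 2 * (X epowr a * Y epowr b)"
  proof cases
    case 1
    then have "\<forall>k\<in>F. x k epowr a * y k epowr b = 0"
      using F ab by (auto simp: X_def Y_def)
    then have "(\<Sum>k\<in>F. x k epowr a * y k epowr b) = 0"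
      by (intro sum.neutral)
    then show ?thesis by simp
  next
    case 2
    then show ?thesis
      using ab by (auto simp: ennreal_mult_top ennreal_top_mult ennreal_mult_eq_top_iff)
  next
    case 3
    have inv: "Z * inverse Z = 1" if "Z \<noteq> 0" "Z \<noteq> top" for Z :: ennreal
      using that by (metis divide_ennreal_def ennreal_divide_self less_top)
    have cancel: "z = Z * (z * inverse Z)" if "Z \<noteq> 0" "Z \<noteq> top" for z Z :: ennreal
    proof -
      have "Z * (z * inverse Z) = z * (Z * inverse Z)" by (rule mult.left_commute)
      then show ?thesis by (simp only: inv[OF that] mult_1_right)
    qed
    have "x k epowr a * y k epowr b
        \<le> (X epowr a * Y epowr b) * (x k * inverse X + y k * inverse Y)" if "k \<in> F" for k
    proof -
      have "x k epowr a = X epowr a * (x k * inverse X) epowr a"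
        by (subst cancel[of X "x k"]) (use ab 3 in \<open>auto simp: epowr_mult\<close>)
      moreover have "y k epowr b = Y epowr b * (y k * inverse Y) epowr b"
        by (subst cancel[of Y "y k"]) (use ab 3 in \<open>auto simp: epowr_mult\<close>)
      ultimately have "x k epowr a * y k epowr b
          = (X epowr a * Y epowr b) * ((x k * inverse X) epowr a * (y k * inverse Y) epowr b)"
        by (simp only: mult_ac)
      also have "\<dots> \<le> (X epowr a * Y epowr b) * (x k * inverse X + y k * inverse Y)"
        using ab by (intro mult_left_mono epowr_mult_epowr_le_add) auto
      finally show ?thesis .
    qed
    then have "(\<Sum>k\<in>F. x k epowr a * y k epowr b)
        \<le> (\<Sum>k\<in>F. (X epowr a * Y epowr b) * (x k * inverse X + y k * inverse Y))"
      by (rule sum_mono)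
    also have "\<dots> = (X epowr a * Y epowr b) * (X * inverse X + Y * inverse Y)"
      by (simp add: sum_distrib_left[symmetric] sum.distrib sum_distrib_right[symmetric] X_def Y_def)
    also have "\<dots> = 2 * (X epowr a * Y epowr b)"
      using inv[of X] inv[of Y] 3 by (simp add: mult.commute)
    finally show ?thesis .
  qed
  then show ?thesis by (simp add: X_def Y_def)
qed

section \<open>The discrete Hardy inequality\<close>

lemma add_epowr_le_eps:
  assumes "0 < s"
  obtains C :: ennreal where "C < top" "\<And>x y. (x + y) epowr s \<le> C * x epowr s + 2 * y epowr s"
proof -
  \<comment> \<open>\<delta> satisfies (1 + \<delta>)^s = 2. If x <= \<delta> y, the sum is at most
    (1 + \<delta>) y, which costs the factor 2 on y^s; otherwise y <= x / \<delta> and x^s carries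
    everything. The factor 2 matters: it has to stay below the growth rate \<theta> in the discrete
    Hardy inequality, which the factor 2^s of \<open>add_epowr_le\<close> need not do.\<close>
  define \<delta> where "\<delta> = 2 powr (1 / s) - 1"
  have \<delta>: "0 < \<delta>"
    using assms powr_less_mono[of 0 "1 / s" 2] by (simp add: \<delta>_def)
  have two: "(ennreal (1 + \<delta>)) epowr s = 2"
    using assms by (simp add: \<delta>_def epowr_ennreal powr_powr)
  define C where "C = (ennreal (1 + 1 / \<delta>)) epowr s"
  have le: "(x + y) epowr s \<le> C * x epowr s + 2 * y epowr s" for x y
  proof (cases "x \<le> ennreal \<delta> * y")
    case True
    have "x + y \<le> ennreal \<delta> * y + y"
      using True by (intro add_mono) auto
    also have "\<dots> = ennreal (1 + \<delta>) * y"
      using \<delta> by (simp add: distrib_right ennreal_plus add.commute)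
    finally have "(x + y) epowr s \<le> (ennreal (1 + \<delta>) * y) epowr s"
      using assms by (intro epowr_mono) auto
    also have "\<dots> = 2 * y epowr s"
      using assms by (simp add: epowr_mult two)
    finally show ?thesis by (simp add: add_increasing)
  next
    case False
    have "y = ennreal (1 / \<delta>) * (ennreal \<delta> * y)"
      using \<delta> by (simp add: mult.assoc[symmetric] ennreal_mult[symmetric])
    also have "\<dots> \<le> ennreal (1 / \<delta>) * x"
      using False by (intro mult_left_mono) auto
    finally have "x + y \<le> x + ennreal (1 / \<delta>) * x"
      by (intro add_mono) auto
    also have "\<dots> = ennreal (1 + 1 / \<delta>) * x"
      using \<delta> by (simp add: distrib_right ennreal_plus)
    finally have "(x + y) epowr s \<le> (ennreal (1 + 1 / \<delta>) * x) epowr s"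
      using assms by (intro epowr_mono) auto
    also have "\<dots> = C * x epowr s"
      using assms by (simp add: epowr_mult C_def)
    finally show ?thesis by (simp add: add_increasing2)
  qed
  have "C < top"
    using assms by (simp add: C_def)
  from that[OF this le] show ?thesis .
qed

text \<open>With equality in the recursion X j is the tail sum of the a i, so this is the discrete
  Hardy inequality for tails; the recursive form applies directly to integrals over successive
  intervals. A predicate on C fixes the constant before n, the weights and the sequences.\<close>

definition Hardy_constant :: "real \<Rightarrow> real \<Rightarrow> ennreal \<Rightarrow> bool"
  where "Hardy_constant \<theta> s C \<longleftrightarrow> C < top \<and> (\<forall>(W :: nat \<Rightarrow> ennreal) X a n.
    (\<forall>j<n. X j \<le> a j + X (Suc j)) \<and> X n = 0 \<and> (\<forall>j. Suc j < n \<longrightarrow> ennreal \<theta> * W j \<le> W (Suc j))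
      \<longrightarrow> (\<Sum>j<n. W j * X j epowr s) \<le> C * (\<Sum>j<n. W j * a j epowr s))"

lemma Hardy_constantD:
  assumes "Hardy_constant \<theta> s C" "\<And>j. j < n \<Longrightarrow> X j \<le> a j + X (Suc j)" "X n = 0"
    "\<And>j. Suc j < n \<Longrightarrow> ennreal \<theta> * W j \<le> W (Suc j)"
  shows "(\<Sum>j<n. W j * X j epowr s) \<le> C * (\<Sum>j<n. W j * a j epowr s)"
  using assms unfolding Hardy_constant_def by blast

text \<open>In the induction, the additional summand on the left absorbs the term that the recursion
  \<open>X\<^sub>j \<le> a\<^sub>j + X\<^sub>j\<^sub>+\<^sub>1\<close> produces in the step of the backward induction.\<close>

lemma discrete_Hardy:
  fixes \<theta> s :: real
  assumes "2 < \<theta>" "0 < s"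
  obtains C where "Hardy_constant \<theta> s C"
proof -
  obtain c :: ennreal where c: "c < top"
    "\<And>x y. (x + y) epowr s \<le> c * x epowr s + 2 * y epowr s"
    by (rule add_epowr_le_eps[OF assms(2)]) (rule that)
  \<comment> \<open>\<kappa> solves (1 + \<kappa>) * 2 = \<kappa> * \<theta>, possible because
    \<theta> > 2. Then the part 2 X(l+1)^s of the bound for X(l)^s, taken 1 + \<kappa> times with
    weight W(l), is at most the surplus \<kappa> W(l+1) X(l+1)^s of the induction
    hypothesis.\<close>
  define \<kappa> where "\<kappa> = 2 / (\<theta> - 2)"
  have \<kappa>: "0 < \<kappa>" "(1 + \<kappa>) * 2 = \<kappa> * \<theta>"
    using assms by (auto simp: \<kappa>_def field_simps)
  define C where "C = ennreal (1 + \<kappa>) * c"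
  have C: "C < top"
    using c by (simp add: C_def ennreal_mult_less_top)
  have "(\<Sum>j<n. W j * X j epowr s) \<le> C * (\<Sum>j<n. W j * a j epowr s)"
    if X: "\<And>j. j < n \<Longrightarrow> X j \<le> a j + X (Suc j)" "X n = 0"
      and W: "\<And>j. Suc j < n \<Longrightarrow> ennreal \<theta> * W j \<le> W (Suc j)" for W X a :: "nat \<Rightarrow> ennreal" and n
  proof -
    have "(\<Sum>j=l..<n. W j * X j epowr s) + ennreal \<kappa> * (W l * X l epowr s)
        \<le> C * (\<Sum>j=l..<n. W j * a j epowr s)" if "l \<le> n" for l
      using that
    proof (induction rule: inc_induct)
      case base
      then show ?case using X(2) assms by simp
    next
      case (step l)
      have last: "ennreal (1 + \<kappa>) * (W l * (2 * X (Suc l) epowr s))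
          \<le> ennreal \<kappa> * (W (Suc l) * X (Suc l) epowr s)"
      proof (cases "Suc l < n")
        case True
        have "ennreal (1 + \<kappa>) * (W l * (2 * X (Suc l) epowr s))
            = ennreal (1 + \<kappa>) * ennreal 2 * (W l * X (Suc l) epowr s)"
          by (simp add: mult_ac)
        also have "ennreal (1 + \<kappa>) * ennreal 2 = ennreal \<kappa> * ennreal \<theta>"
          using \<kappa> assms by (simp add: ennreal_mult[symmetric] del: ennreal_numeral ennreal_plus)
        also have "ennreal \<kappa> * ennreal \<theta> * (W l * X (Suc l) epowr s)
            = ennreal \<kappa> * ((ennreal \<theta> * W l) * X (Suc l) epowr s)"
          by (simp add: mult_ac)
        also have "\<dots> \<le> ennreal \<kappa> * (W (Suc l) * X (Suc l) epowr s)"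
          using W[OF True] by (intro mult_left_mono mult_right_mono) auto
        finally show ?thesis .
      next
        case False
        then have "Suc l = n" using step by simp
        then show ?thesis using X(2) assms by simp
      qed
      have "X l epowr s \<le> c * a l epowr s + 2 * X (Suc l) epowr s"
        using assms by (intro order_trans[OF epowr_mono[OF _ X(1)[OF step(2)]] c(2)]) auto
      then have "ennreal (1 + \<kappa>) * (W l * X l epowr s)
          \<le> ennreal (1 + \<kappa>) * (W l * (c * a l epowr s + 2 * X (Suc l) epowr s))"
        by (intro mult_left_mono) auto
      also have "\<dots> = C * (W l * a l epowr s) + ennreal (1 + \<kappa>) * (W l * (2 * X (Suc l) epowr s))"
        by (simp only: distrib_left C_def mult_ac)
      also have "\<dots> \<le> C * (W l * a l epowr s) + ennreal \<kappa> * (W (Suc l) * X (Suc l) epowr s)"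
        using last by (intro add_left_mono)
      finally have A: "ennreal (1 + \<kappa>) * (W l * X l epowr s)
        \<le> C * (W l * a l epowr s) + ennreal \<kappa> * (W (Suc l) * X (Suc l) epowr s)" .
      have "(\<Sum>j=l..<n. W j * X j epowr s) + ennreal \<kappa> * (W l * X l epowr s)
          = (\<Sum>j=Suc l..<n. W j * X j epowr s) + ennreal (1 + \<kappa>) * (W l * X l epowr s)"
        using step \<kappa> by (simp add: sum.atLeast_Suc_lessThan ennreal_plus distrib_right add_ac)
      also have "\<dots> \<le> (\<Sum>j=Suc l..<n. W j * X j epowr s)
          + (C * (W l * a l epowr s) + ennreal \<kappa> * (W (Suc l) * X (Suc l) epowr s))"
        using A by (intro add_left_mono)
      also have "\<dots> \<le> C * (W l * a l epowr s) + C * (\<Sum>j=Suc l..<n. W j * a j epowr s)"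
        using add_left_mono[OF step.IH, of "C * (W l * a l epowr s)"] by (simp only: add_ac)
      also have "\<dots> = C * (\<Sum>j=l..<n. W j * a j epowr s)"
        using step by (simp add: sum.atLeast_Suc_lessThan distrib_left)
      finally show ?case .
    qed
    from order_trans[OF _ this[of 0]] show ?thesis
      by (simp add: atLeast0LessThan)
  qed
  with C have "Hardy_constant \<theta> s C" unfolding Hardy_constant_def by blast
  then show ?thesis by (rule that)
qed

section \<open>Integrals over subintervals of the half-line\<close>

lemma Mplus_iff: "f \<in> Mplus \<longleftrightarrow> (\<lambda>x. f x * indicator {0<..} x) \<in> borel_measurable lebesgue"
  unfolding Mplus_def by (rule borel_measurable_restrict_space_iff_ennreal) auto

lemma Mplus_mult: "f \<in> Mplus \<Longrightarrow> g \<in> Mplus \<Longrightarrow> (\<lambda>x. f x * g x) \<in> Mplus"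
  and Mplus_add: "f \<in> Mplus \<Longrightarrow> g \<in> Mplus \<Longrightarrow> (\<lambda>x. f x + g x) \<in> Mplus"
  and Mplus_epowr: "f \<in> Mplus \<Longrightarrow> (\<lambda>x. f x epowr a) \<in> Mplus"
  and Mplus_const: "(\<lambda>x. c) \<in> Mplus"
  by (simp_all add: Mplus_def)

lemma Mplus_sum: "(\<And>i. i \<in> I \<Longrightarrow> f i \<in> Mplus) \<Longrightarrow> (\<lambda>x. \<Sum>i\<in>I. f i x) \<in> Mplus"
  unfolding Mplus_def by measurable

lemma einterval_sets_lebesgue [measurable]: "einterval a b \<in> sets lebesgue"
  by (auto intro!: sets_completionI_sets borel_open)

lemma Mplus_borel:
  assumes "f \<in> borel_measurable lebesgue" shows "f \<in> Mplus"
  using assms unfolding Mplus_def by (rule measurable_restrict_space1)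

lemma Mplus_indicator_einterval: "(\<lambda>x. indicator (einterval a b) x) \<in> Mplus"
  by (rule Mplus_borel) measurable

lemma Mplus_min: "f \<in> Mplus \<Longrightarrow> g \<in> Mplus \<Longrightarrow> (\<lambda>x. min (f x) (g x)) \<in> Mplus"
  unfolding Mplus_def by measurable

text \<open>\<open>0 \<le> a\<close> keeps the interval inside the positive half-line, the only
  place where an element of \<open>Mplus\<close> is known to be measurable. Hence such a hypothesis
  in the lemmas on linearity and convergence below.\<close>

lemma ivl_measurable:
  assumes "f \<in> Mplus" "0 \<le> a"
  shows "(\<lambda>x. f x * indicator (einterval a b) x) \<in> borel_measurable lebesgue"
proof -
  have "(\<lambda>x. f x * indicator (einterval a b) x)
      = (\<lambda>x. (f x * indicator {0<..} x) * indicator (einterval a b) x)"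
    using assms(2) by (auto simp: fun_eq_iff einterval_iff split: split_indicator)
      (metis ereal_less(2) order_le_less_trans)
  then show ?thesis
    using assms(1) unfolding Mplus_iff by simp
qed

lemmas Mplus_intros = Mplus_mult Mplus_add Mplus_epowr Mplus_const Mplus_indicator_einterval
  Mplus_sum Mplus_min

lemma ivl_int_mono:
  "(\<And>x. a < ereal x \<Longrightarrow> ereal x < b \<Longrightarrow> f x \<le> g x) \<Longrightarrow> ivl_int a b f \<le> ivl_int a b g"
  unfolding ivl_int_def by (rule nn_integral_mono) (auto simp: einterval_iff split: split_indicator)

lemma ivl_int_cong:
  "(\<And>x. a < ereal x \<Longrightarrow> ereal x < b \<Longrightarrow> f x = g x) \<Longrightarrow> ivl_int a b f = ivl_int a b g"
  by (intro antisym ivl_int_mono) auto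

lemma ivl_int_subset: "a' \<le> a \<Longrightarrow> b \<le> b' \<Longrightarrow> ivl_int a b f \<le> ivl_int a' b' f"
  unfolding ivl_int_def
  by (rule nn_set_integral_set_mono) (auto simp: einterval_iff)

lemma ivl_int_empty: "b \<le> a \<Longrightarrow> ivl_int a b f = 0"
proof -
  assume "b \<le> a"
  then have "einterval a b = {}" by (auto simp: einterval_iff)
  then show ?thesis by (simp add: ivl_int_def)
qed

lemma ivl_int_same [simp]: "ivl_int a a f = 0"
  by (simp add: ivl_int_empty)

lemma ivl_int_add:
  assumes "f \<in> Mplus" "g \<in> Mplus" "0 \<le> a"
  shows "ivl_int a b (\<lambda>x. f x + g x) = ivl_int a b f + ivl_int a b g"
  using assms unfolding ivl_int_def distrib_right
  by (intro nn_integral_add ivl_measurable)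

lemma ivl_int_cmult:
  assumes "f \<in> Mplus" "0 \<le> a"
  shows "ivl_int a b (\<lambda>x. c * f x) = c * ivl_int a b f"
  using assms unfolding ivl_int_def mult.assoc
  by (intro nn_integral_cmult ivl_measurable)

lemma ivl_int_sum:
  assumes "finite I" "\<And>i. i \<in> I \<Longrightarrow> f i \<in> Mplus" "0 \<le> a"
  shows "ivl_int a b (\<lambda>x. \<Sum>i\<in>I. f i x) = (\<Sum>i\<in>I. ivl_int a b (f i))"
  using assms unfolding ivl_int_def sum_distrib_right
  by (intro nn_integral_sum ivl_measurable)

lemma ivl_int_0 [simp]: "ivl_int a b (\<lambda>x. 0) = 0"
  by (simp add: ivl_int_def)

lemma ivl_int_split:
  assumes f: "f \<in> Mplus" and "0 \<le> a" "a \<le> b" "b \<le> c"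
  shows "ivl_int a c f = ivl_int a b f + ivl_int b c f"
proof (cases b)
  case (real r)
  have "ivl_int a c f = (\<integral>\<^sup>+x. f x * indicator (einterval a b) x + f x * indicator (einterval b c) x \<partial>lebesgue)"
    unfolding ivl_int_def
  proof (rule nn_integral_cong_AE)
    \<comment> \<open>The open intervals (a, b) and (b, c) miss the point b, which is a null
      set.\<close>
    have "AE x in lebesgue. x \<noteq> r"
      by (rule AE_completion) (rule AE_lborel_singleton)
    then show "AE x in lebesgue. f x * indicator (einterval a c) x
        = f x * indicator (einterval a b) x + f x * indicator (einterval b c) x"
    proof eventually_elim
      case (elim x)
      have "ereal x \<noteq> b" using elim real by simp
      then show ?case
        using assms(3,4) by (cases "ereal x < b") (auto simp: einterval_iff split: split_indicator)
    qed
  qed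
  also have "\<dots> = ivl_int a b f + ivl_int b c f"
    unfolding ivl_int_def using assms
    by (intro nn_integral_add ivl_measurable) auto
  finally show ?thesis .
next
  case PInf
  then show ?thesis using assms by (simp add: top.extremum_unique)
next
  case MInf
  then show ?thesis using assms by auto
qed

lemma ivl_int_indicator:
  "a \<le> a' \<Longrightarrow> b' \<le> b \<Longrightarrow> ivl_int a b (\<lambda>x. f x * indicator (einterval a' b') x) = ivl_int a' b' f"
  unfolding ivl_int_def
  by (rule nn_integral_cong) (auto simp: einterval_iff split: split_indicator)

lemma ivl_int_SUP_right:
  fixes y :: "nat \<Rightarrow> ereal"
  assumes f: "f \<in> Mplus" and "0 \<le> a" "incseq y"
  shows "ivl_int a (SUP i. y i) f = (SUP i. ivl_int a (y i) f)"
proof -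
  have "f x * indicator (einterval a (SUP i. y i)) x = (SUP i. f x * indicator (einterval a (y i)) x)" for x
  proof (cases "x \<in> einterval a (SUP i. y i)")
    case True
    then obtain i where "x \<in> einterval a (y i)"
      by (auto simp: einterval_iff less_SUP_iff)
    then have "f x \<le> (SUP i. f x * indicator (einterval a (y i)) x)"
      by (intro SUP_upper2[of i]) auto
    then show ?thesis using True
      by (intro antisym SUP_least) (auto split: split_indicator)
  next
    case False
    then have "x \<notin> einterval a (y i)" for i
      by (auto simp: einterval_iff less_SUP_iff)
    then show ?thesis using False by simp
  qed
  moreover have "incseq (\<lambda>i x. f x * indicator (einterval a (y i)) x)"
    using assms(3) by (auto simp: incseq_def le_fun_def einterval_iff split: split_indicator intro: less_le_trans)
  ultimately show ?thesis
    unfolding ivl_int_def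
    using assms by (simp add: nn_integral_monotone_convergence_SUP ivl_measurable)
qed

lemma ivl_int_INF_left:
  fixes y :: "nat \<Rightarrow> ereal"
  assumes f: "f \<in> Mplus" and "\<And>i. 0 \<le> y i" "decseq y"
  shows "ivl_int (INF i. y i) b f = (SUP i. ivl_int (y i) b f)"
proof -
  have "f x * indicator (einterval (INF i. y i) b) x = (SUP i. f x * indicator (einterval (y i) b) x)" for x
  proof (cases "x \<in> einterval (INF i. y i) b")
    case True
    then obtain i where "x \<in> einterval (y i) b"
      by (auto simp: einterval_iff INF_less_iff)
    then have "f x \<le> (SUP i. f x * indicator (einterval (y i) b) x)"
      by (intro SUP_upper2[of i]) auto
    then show ?thesis using True
      by (intro antisym SUP_least) (auto split: split_indicator)
  next
    case False
    then have "x \<notin> einterval (y i) b" for i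
      by (auto simp: einterval_iff INF_less_iff)
    then show ?thesis using False by simp
  qed
  moreover have "incseq (\<lambda>i x. f x * indicator (einterval (y i) b) x)"
    using assms(3) by (auto simp: incseq_def decseq_def le_fun_def einterval_iff split: split_indicator intro: le_less_trans)
  ultimately show ?thesis
    unfolding ivl_int_def
    using assms by (simp add: nn_integral_monotone_convergence_SUP ivl_measurable)
qed

lemma ivl_int_SUP:
  fixes f :: "nat \<Rightarrow> real \<Rightarrow> ennreal"
  assumes f: "\<And>i. f i \<in> Mplus" and "0 \<le> a" and inc: "\<And>x. a < ereal x \<Longrightarrow> incseq (\<lambda>i. f i x)"
  shows "ivl_int a b (\<lambda>x. SUP i. f i x) = (SUP i. ivl_int a b (f i))"
proof -
  have "(SUP i. f i x) * indicator (einterval a b) x = (SUP i. f i x * indicator (einterval a b) x)" for x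
    by (auto split: split_indicator)
  moreover have "incseq (\<lambda>i x. f i x * indicator (einterval a b) x)"
    using inc by (auto simp: incseq_def le_fun_def einterval_iff split: split_indicator)
  ultimately show ?thesis
    unfolding ivl_int_def
    using assms by (simp add: nn_integral_monotone_convergence_SUP ivl_measurable)
qed

section \<open>Intermediate values of integrals\<close>

lemma ivl_int_IVT:
  assumes f: "f \<in> Mplus" and ab: "0 \<le> a" "a \<le> b" and fin: "ivl_int a b f < top"
    and \<tau>: "\<tau> \<le> ivl_int a b f"
  obtains x where "a \<le> x" "x \<le> b" "ivl_int a x f = \<tau>"
proof -
  \<comment> \<open>The supremum z of \<open>S\<close> is the point sought. Monotone convergence
    along points increasing to z gives \<open>le\<close>; along points decreasing to z, where the
    integral exceeds \<tau>, it gives \<open>ge\<close>. The finite total integral permits the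
    subtractions.\<close>
  define S where "S = {x. a \<le> x \<and> x \<le> b \<and> ivl_int a x f \<le> \<tau>}"
  define z where "z = Sup S"
  have "a \<in> S" using ab by (simp add: S_def)
  have az: "a \<le> z" and zb: "z \<le> b"
    unfolding z_def using \<open>a \<in> S\<close> by (auto intro: Sup_upper Sup_least simp: S_def)
  have le: "ivl_int a z f \<le> \<tau>"
  proof (cases "a = z")
    case False
    then have "a < z" using az by simp
    from ereal_incseq_approx[OF this] obtain X :: "nat \<Rightarrow> real"
      where X: "incseq X" "\<And>i. ereal (X i) < z" "(\<lambda>i. ereal (X i)) \<longlonglongrightarrow> z"
      by metis
    have inc: "incseq (\<lambda>i. ereal (X i))" using X(1) by (simp add: incseq_def)
    have "z = (SUP i. ereal (X i))"
      using LIMSEQ_unique[OF X(3) LIMSEQ_SUP[OF inc]] .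
    then have "ivl_int a z f = (SUP i. ivl_int a (ereal (X i)) f)"
      using ivl_int_SUP_right[OF f ab(1) inc] by simp
    also have "\<dots> \<le> \<tau>"
    proof (rule SUP_least)
      fix i
      obtain s where "s \<in> S" "ereal (X i) < s"
        using X(2)[of i] unfolding z_def less_Sup_iff by blast
      then show "ivl_int a (ereal (X i)) f \<le> \<tau>"
        using order_trans[OF ivl_int_subset[of a a "ereal (X i)" s f]] by (simp add: S_def)
    qed
    finally show ?thesis .
  qed simp
  have ge: "\<tau> \<le> ivl_int a z f"
  proof (cases "z = b")
    case False
    then have "z < b" using zb by simp
    from ereal_decseq_approx[OF this] obtain X :: "nat \<Rightarrow> real"
      where X: "decseq X" "\<And>i. z < ereal (X i)" "\<And>i. ereal (X i) < b" "(\<lambda>i. ereal (X i)) \<longlonglongrightarrow> z"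
      by metis
    have dec: "decseq (\<lambda>i. ereal (X i))" using X(1) by (simp add: decseq_def)
    have "z = (INF i. ereal (X i))"
      using LIMSEQ_unique[OF X(4) LIMSEQ_INF[OF dec]] .
    then have zb_eq: "ivl_int z b f = (SUP i. ivl_int (ereal (X i)) b f)"
      using ivl_int_INF_left[OF f _ dec, of b] ab az X(2) by (simp, meson less_imp_le order_trans)
    have "ivl_int z b f \<le> ivl_int a b f - \<tau>"
      unfolding zb_eq
    proof (rule SUP_least)
      fix i
      have "ereal (X i) \<notin> S"
        using X(2)[of i] Sup_upper[of "ereal (X i)" S] by (auto simp: z_def not_less[symmetric])
      then have "\<tau> < ivl_int a (ereal (X i)) f"
        using X(2)[of i] X(3)[of i] az by (auto simp: S_def)
      moreover have "ivl_int a b f = ivl_int a (ereal (X i)) f + ivl_int (ereal (X i)) b f"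
        using X(2)[of i] X(3)[of i] az ab by (intro ivl_int_split f) auto
      ultimately have "ivl_int (ereal (X i)) b f + \<tau> \<le> ivl_int a b f"
        by (simp add: add.commute add_right_mono)
      then show "ivl_int (ereal (X i)) b f \<le> ivl_int a b f - \<tau>"
        using fin \<tau> ennreal_minus_mono[of "ivl_int (ereal (X i)) b f + \<tau>" "ivl_int a b f" \<tau> \<tau>]
        by (auto simp: ennreal_add_diff_cancel_right top_unique)
    qed
    then have "\<tau> + ivl_int z b f \<le> ivl_int a b f"
      using add_left_mono[of "ivl_int z b f" "ivl_int a b f - \<tau>" \<tau>] diff_add_cancel_ennreal[OF \<tau>]
      by (metis add.commute)
    also have "\<dots> = ivl_int a z f + ivl_int z b f"
      using ab az zb by (intro ivl_int_split f) auto
    finally show ?thesis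
      using fin ivl_int_subset[of a z b b f] az
      by (auto simp: ennreal_add_left_cancel_le add.commute less_top[symmetric] top_unique)
  qed (use \<tau> in simp)
  show ?thesis
    using that[OF az zb] le ge by auto
qed

lemma ivl_int_IVT_left:
  assumes f: "f \<in> Mplus" and ab: "0 \<le> a" "a \<le> b" and fin: "ivl_int a b f < top"
    and \<tau>: "\<tau> \<le> ivl_int a b f"
  obtains x where "a \<le> x" "x \<le> b" "ivl_int x b f = \<tau>"
proof -
  obtain x where x: "a \<le> x" "x \<le> b" "ivl_int a x f = ivl_int a b f - \<tau>"
    using ivl_int_IVT[OF f ab fin, of "ivl_int a b f - \<tau>"] by (metis diff_le_self_ennreal)
  have "ivl_int a b f = (ivl_int a b f - \<tau>) + ivl_int x b f"
    using ivl_int_split[OF f ab(1) x(1,2)] x(3) by simp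
  moreover have "ivl_int a b f = (ivl_int a b f - \<tau>) + \<tau>"
    using \<tau> by (simp add: diff_add_cancel_ennreal)
  ultimately have "(ivl_int a b f - \<tau>) + ivl_int x b f = (ivl_int a b f - \<tau>) + \<tau>" by simp
  moreover have "ivl_int a b f - \<tau> \<noteq> top"
    using fin by (simp add: less_top[symmetric])
  ultimately have "ivl_int x b f = \<tau>"
    by (simp add: ennreal_add_left_cancel)
  then show ?thesis using that x by blast
qed

section \<open>Monotone functions, comparison and truncation\<close>

lemma Mplus_interval_levels:
  assumes "\<And>y. is_interval {x \<in> {0<..}. y < f x}"
  shows "f \<in> Mplus"
  unfolding Mplus_def
proof (rule borel_measurableI_greater)
  fix y
  have "{x \<in> {0<..}. y < f x} \<in> sets lebesgue"
    using real_interval_borel_measurable[OF assms] by (auto intro: sets_completionI_sets)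
  then show "{x \<in> space (lebesgue_on {0<..}). y < f x} \<in> sets (lebesgue_on {0<..})"
    by (subst sets_restrict_space_iff) auto
qed

lemma Mplus_mono:
  assumes "\<And>x y. 0 < x \<Longrightarrow> x \<le> y \<Longrightarrow> f x \<le> f y" shows "f \<in> Mplus"
  by (rule Mplus_interval_levels)
    (use assms in \<open>auto simp: is_interval_1 intro: less_le_trans\<close>)

lemma Mplus_antimono:
  assumes "\<And>x y. 0 < x \<Longrightarrow> x \<le> y \<Longrightarrow> f y \<le> f x" shows "f \<in> Mplus"
  by (rule Mplus_interval_levels)
    (use assms in \<open>auto simp: is_interval_1 intro: less_le_trans\<close>)

lemma Mplus_tail: "(\<lambda>s. ivl_int (ereal s) b f) \<in> Mplus"
  by (rule Mplus_antimono) (auto intro!: ivl_int_subset)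

lemma ivl_int_le_const:
  assumes "0 \<le> a" "f \<in> Mplus" "\<And>x. a < ereal x \<Longrightarrow> ereal x < b \<Longrightarrow> g x \<le> c * f x"
  shows "ivl_int a b g \<le> c * ivl_int a b f"
  using ivl_int_mono[of a b g "\<lambda>x. c * f x"] assms by (simp add: ivl_int_cmult)

lemma ivl_int_ge_const:
  assumes "0 \<le> a" "f \<in> Mplus" "\<And>x. a < ereal x \<Longrightarrow> ereal x < b \<Longrightarrow> c * f x \<le> g x"
  shows "c * ivl_int a b f \<le> ivl_int a b g"
  using ivl_int_mono[of a b "\<lambda>x. c * f x" g] assms by (simp add: ivl_int_cmult)

text \<open>Cutting off height and support at n makes the integrals finite. This serves where an
  integral has to be halved or divided by but may be infinite.\<close>

lemma ivl_int_truncate: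
  assumes f: "f \<in> Mplus" and a: "0 \<le> a"
  obtains g :: "nat \<Rightarrow> real \<Rightarrow> ennreal" where "\<And>n. g n \<in> Mplus" "\<And>n x. g n x \<le> f x"
    "\<And>n. ivl_int a b (g n) < top" "ivl_int a b f = (SUP n. ivl_int a b (g n))"
proof -
  define g where "g n x = min (f x) (of_nat n) * indicator (einterval 0 (ereal (real n))) x" for n x
  have g: "g n \<in> Mplus" for n
    unfolding g_def by (intro Mplus_intros f)
  have fin: "ivl_int a b (g n) < top" for n
  proof -
    have "ivl_int a b (g n) \<le> (\<integral>\<^sup>+x. of_nat n * indicator {0..real n} x \<partial>lebesgue)"
      unfolding ivl_int_def g_def zero_ereal_def einterval_eq
      by (intro nn_integral_mono) (auto split: split_indicator)
    also have "\<dots> < top"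
      by (subst nn_integral_cmult_indicator) (auto simp: ennreal_mult_less_top of_nat_less_top)
    finally show ?thesis .
  qed
  have inc: "incseq (\<lambda>n. g n x)" for x
    unfolding g_def zero_ereal_def einterval_eq
    by (auto simp: incseq_def intro: min.coboundedI2 min.coboundedI1 split: split_indicator)
  have sup: "(SUP n. g n x) = f x" if "a < ereal x" for x
  proof (rule antisym)
    show "(SUP n. g n x) \<le> f x"
      by (rule SUP_least) (auto simp: g_def split: split_indicator)
    have "0 < x" using that a by (metis ereal_less(2) order_le_less_trans)
    show "f x \<le> (SUP n. g n x)"
    proof (rule dense_le)
      fix y assume y: "y < f x"
      then obtain m where m: "y < of_nat m"
        using ennreal_Ex_less_of_nat[OF less_le_trans[OF y top_greatest]] by blast
      obtain l :: nat where l: "x < real l" using reals_Archimedean2 by blast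
      have "y \<le> g (max m l) x"
        unfolding g_def zero_ereal_def einterval_eq using y m l \<open>0 < x\<close>
        by (auto simp: max_def less_imp_le intro: order_trans[OF less_imp_le] split: split_indicator)
      then show "y \<le> (SUP n. g n x)" by (rule SUP_upper2[OF UNIV_I])
    qed
  qed
  have "ivl_int a b f = ivl_int a b (\<lambda>x. SUP n. g n x)"
    by (rule ivl_int_cong) (simp add: sup)
  also have "\<dots> = (SUP n. ivl_int a b (g n))"
    using g a inc by (rule ivl_int_SUP)
  finally have "ivl_int a b f = (SUP n. ivl_int a b (g n))" .
  then show ?thesis
    using that[of g] g fin by (auto simp: g_def split: split_indicator)
qed

section \<open>The dual weight\<close>

abbreviation dual_weight :: "real \<Rightarrow> (real \<Rightarrow> ennreal) \<Rightarrow> real \<Rightarrow> ennreal"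
  where "dual_weight p v \<equiv> (\<lambda>s. v s epowr (1 - conj_exp p))"

abbreviation dual_int :: "real \<Rightarrow> (real \<Rightarrow> ennreal) \<Rightarrow> ereal \<Rightarrow> ereal \<Rightarrow> ennreal"
  where "dual_int p v a b \<equiv> ivl_int a b (dual_weight p v)"

abbreviation (input) energy :: "real \<Rightarrow> (real \<Rightarrow> ennreal) \<Rightarrow> (real \<Rightarrow> ennreal) \<Rightarrow> ereal \<Rightarrow> ereal \<Rightarrow> ennreal"
  where "energy p v h a b \<equiv> ivl_int a b (\<lambda>x. h x epowr p * v x)"

lemma epowr_neg_eq_iff:
  "a < 0 \<Longrightarrow> x epowr a = 0 \<longleftrightarrow> x = top" "a < 0 \<Longrightarrow> x epowr a = top \<longleftrightarrow> x = 0"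
  by (cases x rule: ennreal_cases3; auto simp: epowr_ennreal epowr_def[of 0] epowr_def[of top])+

lemma conj_exp_props:
  assumes "1 < p"
  shows "1 < conj_exp p" "1 / p + 1 / conj_exp p = 1" "(1 - conj_exp p) / conj_exp p = - 1 / p"
    "(1 - conj_exp p) * (p - 1) = - 1"
  using assms by (auto simp: conj_exp_def divide_simps)

text \<open>For s = sigma(x) and 0 < v(x) < top this is the identity sigma^p v = sigma. The form
  with s below sigma(x) admits truncations of sigma and remains true where v is 0 or top.\<close>

lemma dual_weight_test:
  assumes p: "1 < p" and s: "s \<le> dual_weight p v x"
  shows "s epowr p * v x \<le> s"
proof (cases "v x" rule: ennreal_cases3)
  case 3
  then show ?thesis
    using s conj_exp_props[OF p] p by (simp add: epowr_def[of top])
next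
  case (2 r)
  show ?thesis
  proof (cases s rule: ennreal_cases3)
    case (2 a)
    have "a \<le> r powr (1 - conj_exp p)"
      using s \<open>v x = ennreal r\<close> 2 \<open>0 < r\<close> by (simp add: epowr_ennreal)
    then have "a powr (p - 1) \<le> (r powr (1 - conj_exp p)) powr (p - 1)"
      using 2 p by (intro powr_mono2) auto
    also have "\<dots> = 1 / r"
      using \<open>0 < r\<close> conj_exp_props(4)[OF p] by (simp add: powr_powr powr_minus_divide)
    finally have "a * (a powr (p - 1) * r) \<le> a * (1 / r * r)"
      using 2 \<open>0 < r\<close> by (intro mult_left_mono mult_right_mono) auto
    moreover have "a powr p = a * a powr (p - 1)"
      using 2 powr_add[of a 1 "p - 1"] by simp
    ultimately show ?thesis
      using 2 \<open>0 < r\<close> \<open>v x = ennreal r\<close> by (simp add: epowr_ennreal ennreal_mult[symmetric] mult.assoc)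
  qed (use s \<open>v x = ennreal r\<close> \<open>0 < r\<close> p in \<open>auto simp: epowr_ennreal top_unique\<close>)
qed simp

text \<open>Young's inequality for the two factors of h = (h^p v)^(1/p) sigma^(1/p'), normalized by
  E and V, which will be the integrals of h^p v and sigma. Where v is 0 or top and h is positive,
  one of the two summands on the right is infinite.\<close>

lemma Young_dual_weight:
  assumes p: "1 < p" and E: "0 < E" "E < top" and V: "0 < V" "V < top"
  shows "h \<le> (E epowr (1 / p) * V epowr (1 / conj_exp p))
    * (inverse E * (h epowr p * v x) + inverse V * dual_weight p v x)"
proof -
  note c = conj_exp_props[OF p]
  have pos: "E epowr (1 / p) * V epowr (1 / conj_exp p) > 0"
    using E V p c by (auto simp: zero_less_iff_neq_zero)
  have inv: "Z * (inverse Z * z) = z" if "0 < Z" "Z < top" for Z z :: ennreal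
    using that by (cases Z rule: ennreal_cases3)
      (auto simp: inverse_ennreal mult.assoc[symmetric] ennreal_mult[symmetric])
  consider "v x = 0" | "h = 0" | "v x = top" "h \<noteq> 0" | "0 < v x" "v x < top"
    by (auto simp: less_top[symmetric] zero_less_iff_neq_zero)
  then show ?thesis
  proof cases
    case 1
    then show ?thesis
      using E V pos c p by (simp add: epowr_def[of 0] ennreal_mult_top less_top[symmetric] zero_less_iff_neq_zero)
  next
    case 3
    then show ?thesis
      using E V pos p c by (simp add: ennreal_mult_top ennreal_inverse_eq_0_iff less_top[symmetric] zero_less_iff_neq_zero)
  next
    case 4
    have "dual_weight p v x epowr (1 / conj_exp p) = v x epowr (- (1 / p))"
      using c by (simp add: epowr_epowr)
    then have "(h epowr p * v x) epowr (1 / p) * dual_weight p v x epowr (1 / conj_exp p)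
        = h * (v x epowr (1 / p) * v x epowr (- (1 / p)))"
      using p by (simp add: epowr_mult epowr_epowr mult.assoc)
    also have "\<dots> = h"
      using epowr_add_finite[OF 4, of "1 / p" "- (1 / p)"] by simp
    finally have "h = (h epowr p * v x) epowr (1 / p) * dual_weight p v x epowr (1 / conj_exp p)" ..
    also have "\<dots> = (E * (inverse E * (h epowr p * v x))) epowr (1 / p)
        * (V * (inverse V * dual_weight p v x)) epowr (1 / conj_exp p)"
      using inv E V by simp
    also have "\<dots> = (E epowr (1 / p) * V epowr (1 / conj_exp p)) * ((inverse E * (h epowr p * v x)) epowr (1 / p)
        * (inverse V * dual_weight p v x) epowr (1 / conj_exp p))"
      using p c by (simp add: epowr_mult mult_ac)
    also have "\<dots> \<le> (E epowr (1 / p) * V epowr (1 / conj_exp p))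
        * (inverse E * (h epowr p * v x) + inverse V * dual_weight p v x)"
      using p c by (intro mult_left_mono epowr_mult_epowr_le_add) auto
    finally show ?thesis .
  qed simp
qed

lemma ivl_int_AE_finite:
  assumes "f \<in> Mplus" "0 \<le> a" "ivl_int a b f < top"
  shows "AE x in lebesgue. x \<in> einterval a b \<longrightarrow> f x \<noteq> top"
proof -
  have "AE x in lebesgue. f x * indicator (einterval a b) x \<noteq> \<infinity>"
    using assms by (intro nn_integral_noteq_infinite ivl_measurable) (auto simp: ivl_int_def)
  then show ?thesis by eventually_elim auto
qed

lemma ivl_int_eq_0_iff:
  assumes "f \<in> Mplus" "0 \<le> a"
  shows "ivl_int a b f = 0 \<longleftrightarrow> (AE x in lebesgue. x \<in> einterval a b \<longrightarrow> f x = 0)"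
  unfolding ivl_int_def using assms
  by (subst nn_integral_0_iff_AE[OF ivl_measurable])
    (auto split: split_indicator_asm elim!: eventually_mono)

text \<open>Both integrals have to be finite because 0 * top = 0: for v = 0 the right side would
  vanish whatever h is. If the energy is 0, a finite integral of sigma excludes v = 0 and so h = 0;
  if the integral of sigma is 0, then v = top and a finite energy forces h = 0, each time almost
  everywhere.\<close>

lemma Hoelder_dual_weight:
  assumes p: "1 < p" and h: "h \<in> Mplus" and v: "v \<in> Mplus" and a: "0 \<le> a"
    and E: "energy p v h a b < top" and V: "dual_int p v a b < top"
  shows "ivl_int a b h \<le> 2 * (energy p v h a b epowr (1 / p)
    * dual_int p v a b epowr (1 / conj_exp p))"
    (is "_ \<le> 2 * (?E epowr _ * ?V epowr _)")
proof -
  note c = conj_exp_props[OF p]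
  have m1: "(\<lambda>x. h x epowr p * v x) \<in> Mplus" and m2: "dual_weight p v \<in> Mplus"
    using h v by (intro Mplus_intros; simp)+
  consider "?E = 0" | "?V = 0" | "0 < ?E" "0 < ?V" by (auto simp: zero_less_iff_neq_zero)
  then show ?thesis
  proof cases
    case 1
    have "AE x in lebesgue. x \<in> einterval a b \<longrightarrow> h x = 0"
      using ivl_int_AE_finite[OF m2 a V] 1[unfolded ivl_int_eq_0_iff[OF m1 a]]
      by eventually_elim (use p c in \<open>auto simp: epowr_neg_eq_iff\<close>)
    then have "ivl_int a b h = 0" by (rule iffD2[OF ivl_int_eq_0_iff[OF h a]])
    then show ?thesis by simp
  next
    case 2
    have "AE x in lebesgue. x \<in> einterval a b \<longrightarrow> h x = 0"
      using ivl_int_AE_finite[OF m1 a E] 2[unfolded ivl_int_eq_0_iff[OF m2 a]]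
      by eventually_elim (use p c in \<open>auto simp: epowr_neg_eq_iff ennreal_mult_top split: if_splits\<close>)
    then have "ivl_int a b h = 0" by (rule iffD2[OF ivl_int_eq_0_iff[OF h a]])
    then show ?thesis by simp
  next
    case 3
    define Q where "Q = ?E epowr (1 / p) * ?V epowr (1 / conj_exp p)"
    have inv: "inverse Z * Z = 1" if "0 < Z" "Z < top" for Z :: ennreal
      using that by (cases Z rule: ennreal_cases3) (auto simp: inverse_ennreal ennreal_mult[symmetric])
    have "ivl_int a b h \<le> ivl_int a b (\<lambda>x. Q * (inverse ?E * (h x epowr p * v x) + inverse ?V * dual_weight p v x))"
      unfolding Q_def by (intro ivl_int_mono Young_dual_weight p 3 E V)
    also have "\<dots> = Q * (inverse ?E * ?E + inverse ?V * ?V)"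
      using m1 m2 a by (simp add: ivl_int_cmult ivl_int_add Mplus_intros)
    also have "\<dots> = 2 * Q"
      using inv[OF 3(1) E] inv[OF 3(2) V] by (simp add: mult.commute)
    finally show ?thesis unfolding Q_def .
  qed
qed

section \<open>Integrals of powers of a tail\<close>

lemma powr_half_bounds:
  fixes r z :: real
  assumes "0 < r" "r / 2 \<le> z" "z \<le> r"
  shows "2 powr (- \<bar>e\<bar>) * r powr e \<le> z powr e" "z powr e \<le> 2 powr \<bar>e\<bar> * r powr e"
proof -
  have one: "1 * r powr e \<le> 2 powr \<bar>e\<bar> * r powr e" "2 powr (- \<bar>e\<bar>) * r powr e \<le> 1 * r powr e"
    using powr_mono[of 0 "\<bar>e\<bar>" 2] powr_mono[of "- \<bar>e\<bar>" 0 2] by (intro mult_right_mono; simp)+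
  have half: "(r / 2) powr e = 2 powr (- e) * r powr e"
    using assms by (simp add: powr_divide powr_minus_divide)
  have "2 powr (- \<bar>e\<bar>) * r powr e \<le> z powr e \<and> z powr e \<le> 2 powr \<bar>e\<bar> * r powr e"
  proof (cases "0 \<le> e")
    case True
    then have "(r / 2) powr e \<le> z powr e" "z powr e \<le> r powr e" "\<bar>e\<bar> = e"
      using assms by (auto intro: powr_mono2)
    then show ?thesis using one half by (intro conjI; simp only: mult_1; linarith)
  next
    case False
    then have "z powr e \<le> (r / 2) powr e" "r powr e \<le> z powr e" "- e = \<bar>e\<bar>"
      using assms by (auto intro: powr_mono2')
    then show ?thesis using one half by (intro conjI; simp only: mult_1; linarith)
  qed
  then show "2 powr (- \<bar>e\<bar>) * r powr e \<le> z powr e" "z powr e \<le> 2 powr \<bar>e\<bar> * r powr e" by auto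
qed

definition tail_lower_constant :: "real \<Rightarrow> ennreal \<Rightarrow> bool"
  where "tail_lower_constant \<gamma> C \<longleftrightarrow> C < top \<and> (\<forall>f a b.
    f \<in> Mplus \<and> 0 \<le> a \<and> a \<le> b \<and> (1 \<le> \<gamma> \<or> ivl_int a b f < top) \<longrightarrow>
    ivl_int a b f epowr \<gamma> \<le> C * ivl_int a b (\<lambda>s. ivl_int (ereal s) b f epowr (\<gamma> - 1) * f s))"

definition tail_upper_constant :: "real \<Rightarrow> ennreal \<Rightarrow> bool"
  where "tail_upper_constant \<gamma> C \<longleftrightarrow> C < top \<and> (\<forall>f a b.
    f \<in> Mplus \<and> 0 \<le> a \<and> a \<le> b \<and> ivl_int a b f < top \<longrightarrow>
    ivl_int a b (\<lambda>s. ivl_int (ereal s) b f epowr (\<gamma> - 1) * f s) \<le> C * ivl_int a b f epowr \<gamma>)"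

text \<open>On the part of [a, b] that carries the first half of the integral r, the tail lies
  between r/2 and r, so its power is comparable to r^(\<gamma>-1) whatever the sign of the exponent.
  The halving costs the factor 2, the power 2^|\<gamma>-1|. An infinite integral is reached by
  truncation.\<close>

lemma tail_lower_constant_exists:
  assumes \<gamma>: "0 < \<gamma>"
  obtains C where "tail_lower_constant \<gamma> C"
proof -
  define C where "C = ennreal (2 powr (1 + \<bar>\<gamma> - 1\<bar>))"
  have fin: "ivl_int a b f epowr \<gamma> \<le> C * ivl_int a b (\<lambda>s. ivl_int (ereal s) b f epowr (\<gamma> - 1) * f s)"
    if f: "f \<in> Mplus" and ab: "0 \<le> a" "a \<le> b" and V: "ivl_int a b f < top" for f a b
  proof (cases "ivl_int a b f" rule: ennreal_cases3)
    case (2 r)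
    then obtain y where y: "a \<le> y" "y \<le> b" "ivl_int y b f = ennreal (r / 2)"
      using ivl_int_IVT_left[OF f ab V, of "ennreal (r / 2)"] by auto
    have "ennreal (r / 2) + ennreal (r / 2) = ivl_int a y f + ennreal (r / 2)"
      using ivl_int_split[OF f ab(1) y(1,2)] 2 y(3) by (simp add: ennreal_plus[symmetric] del: ennreal_plus)
    then have ay: "ivl_int a y f = ennreal (r / 2)"
      by (metis add.commute ennreal_add_left_cancel ennreal_neq_top infinity_ennreal_def)
    have "ennreal (2 powr (- \<bar>\<gamma> - 1\<bar>) * r powr (\<gamma> - 1)) * f s \<le> ivl_int (ereal s) b f epowr (\<gamma> - 1) * f s"
      if "a < ereal s" "ereal s < y" for s
    proof (rule mult_right_mono)
      have "ivl_int (ereal s) b f \<le> ennreal r"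
        using ivl_int_subset[of a "ereal s" b b f] that 2 by simp
      moreover have "ennreal (r / 2) \<le> ivl_int (ereal s) b f"
        using ivl_int_subset[of "ereal s" y b b f] that y by simp
      ultimately obtain z where z: "ivl_int (ereal s) b f = ennreal z" "z \<le> r" "r / 2 \<le> z" "0 < z"
        using 2 by (cases "ivl_int (ereal s) b f" rule: ennreal_cases3) (auto simp: top_unique)
      have "2 powr (- \<bar>\<gamma> - 1\<bar>) * r powr (\<gamma> - 1) \<le> z powr (\<gamma> - 1)"
        using 2 z by (intro powr_half_bounds) auto
      then show "ennreal (2 powr (- \<bar>\<gamma> - 1\<bar>) * r powr (\<gamma> - 1)) \<le> ivl_int (ereal s) b f epowr (\<gamma> - 1)"
        using z by (simp add: epowr_ennreal)
    qed simp
    then have "ennreal (2 powr (- \<bar>\<gamma> - 1\<bar>) * r powr (\<gamma> - 1)) * ivl_int a y f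
        \<le> ivl_int a y (\<lambda>s. ivl_int (ereal s) b f epowr (\<gamma> - 1) * f s)"
      by (intro ivl_int_ge_const f ab)
    also have "\<dots> \<le> ivl_int a b (\<lambda>s. ivl_int (ereal s) b f epowr (\<gamma> - 1) * f s)"
      using y by (intro ivl_int_subset) auto
    finally have "C * (ennreal (2 powr (- \<bar>\<gamma> - 1\<bar>) * r powr (\<gamma> - 1)) * ennreal (r / 2))
        \<le> C * ivl_int a b (\<lambda>s. ivl_int (ereal s) b f epowr (\<gamma> - 1) * f s)"
      unfolding ay by (intro mult_left_mono) auto
    moreover have "2 powr (1 + \<bar>\<gamma> - 1\<bar>) * (2 powr (- \<bar>\<gamma> - 1\<bar>) * r powr (\<gamma> - 1) * (r / 2)) = r powr \<gamma>"
    proof -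
      have "2 powr (1 + \<bar>\<gamma> - 1\<bar>) * 2 powr (- \<bar>\<gamma> - 1\<bar>) = (2::real)"
        by (simp add: powr_add[symmetric])
      moreover have "r powr (\<gamma> - 1) * r = r powr \<gamma>"
        using powr_add[of r "\<gamma> - 1" 1] 2 by simp
      ultimately show ?thesis by (simp add: field_simps)
    qed
    ultimately show ?thesis
      using 2 by (simp add: epowr_ennreal C_def ennreal_mult[symmetric])
  qed (use \<gamma> V in auto)
  have "ivl_int a b f epowr \<gamma> \<le> C * ivl_int a b (\<lambda>s. ivl_int (ereal s) b f epowr (\<gamma> - 1) * f s)"
    if f: "f \<in> Mplus" and ab: "0 \<le> a" "a \<le> b" and V: "1 \<le> \<gamma> \<or> ivl_int a b f < top" for f a b
  proof (cases "ivl_int a b f < top")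
    case False
    then have "1 \<le> \<gamma>" using V by simp
    obtain g :: "nat \<Rightarrow> real \<Rightarrow> ennreal" where g: "\<And>n. g n \<in> Mplus" "\<And>n x. g n x \<le> f x"
      "\<And>n. ivl_int a b (g n) < top" "ivl_int a b f = (SUP n. ivl_int a b (g n))"
      using ivl_int_truncate[OF f ab(1), of b] by metis
    have "ivl_int a b (g n) epowr \<gamma> \<le> C * ivl_int a b (\<lambda>s. ivl_int (ereal s) b f epowr (\<gamma> - 1) * f s)" for n
    proof -
      \<comment> \<open>Truncating f lowers the power of the tail as well, because \<gamma> - 1 >=
        0.\<close>
      have "ivl_int a b (\<lambda>s. ivl_int (ereal s) b (g n) epowr (\<gamma> - 1) * g n s)
          \<le> ivl_int a b (\<lambda>s. ivl_int (ereal s) b f epowr (\<gamma> - 1) * f s)"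
        using \<open>1 \<le> \<gamma>\<close> g(2) by (intro ivl_int_mono mult_mono epowr_mono) auto
      then show ?thesis
        using fin[OF g(1) ab g(3)] by (meson mult_left_mono order_trans zero_le)
    qed
    then show ?thesis
      unfolding g(4) using \<gamma> by (subst epowr_SUP) (auto intro!: SUP_least)
  qed (use fin that in blast)
  moreover have "C < top" by (simp add: C_def)
  ultimately have "tail_lower_constant \<gamma> C" unfolding tail_lower_constant_def by blast
  then show ?thesis by (rule that)
qed

text \<open>The tail is halved again and again: between the points with tails r / 2^i and r /
  2^(i+1) the integral is at most a multiple of (r / 2^i)^\<gamma>, and these bounds form a
  geometric series with ratio 2^(-\<gamma>). Beyond the limit of the points f has no mass.\<close>

lemma tail_upper_constant_exists:
  assumes \<gamma>: "0 < \<gamma>"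
  obtains C where "tail_upper_constant \<gamma> C"
proof -
  define D where "D = (\<Sum>i. (2 powr (- \<gamma>)) ^ i)"
  define C where "C = ennreal (2 powr \<bar>\<gamma> - 1\<bar> * D)"
  have less1: "2 powr (- \<gamma>) < 1"
    using \<gamma> powr_less_mono[of "- \<gamma>" 0 2] by simp
  have D: "(\<Sum>i<n. (2 powr (- \<gamma>)) ^ i) \<le> D" for n
    unfolding D_def using less1 by (intro sum_le_suminf summable_geometric) auto
  have main: "ivl_int a b (\<lambda>s. ivl_int (ereal s) b f epowr (\<gamma> - 1) * f s) \<le> C * ivl_int a b f epowr \<gamma>"
    if f: "f \<in> Mplus" and ab: "0 \<le> a" "a \<le> b" and V: "ivl_int a b f < top" for f a b
  proof -
    define F where "F s = ivl_int (ereal s) b f epowr (\<gamma> - 1) * f s" for s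
    have F: "F \<in> Mplus" unfolding F_def by (intro Mplus_intros Mplus_tail f)
    \<comment> \<open>For \<gamma> < 1 the power of a vanishing tail is top; the bound top * 0 = 0
      still disposes of such a stretch.\<close>
    have null: "ivl_int z b F = 0" if "0 \<le> z" "ivl_int z b f = 0" for z
    proof -
      have "ivl_int z b F \<le> top * ivl_int z b f"
        using that(1) unfolding F_def by (intro ivl_int_le_const f mult_right_mono) auto
      then show ?thesis using that by simp
    qed
    have "ivl_int a b F \<le> C * ivl_int a b f epowr \<gamma>"
    proof (cases "ivl_int a b f" rule: ennreal_cases3)
      case 1
      then show ?thesis using null[OF ab(1)] by simp
    next
      case (2 r)
      have "\<exists>x. a \<le> x \<and> x \<le> b \<and> ivl_int x b f = ennreal (r / 2 ^ i)" for i :: nat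
      proof -
        have "r / 2 ^ i \<le> r / 1" using 2 by (intro divide_left_mono) auto
        then have "ennreal (r / 2 ^ i) \<le> ivl_int a b f" using 2 by (simp add: ennreal_leI)
        from ivl_int_IVT_left[OF f ab V this] show ?thesis by blast
      qed
      then obtain y' where y': "\<And>i. a \<le> y' i \<and> y' i \<le> b \<and> ivl_int (y' i) b f = ennreal (r / 2 ^ i)"
        by metis
      \<comment> \<open>The point with tail r supplied by the intermediate value property may lie to
        the right of a, but the blocks have to start at a.\<close>
      define y where "y i = (if i = 0 then a else y' i)" for i
      have y: "a \<le> y i" "y i \<le> b" "ivl_int (y i) b f = ennreal (r / 2 ^ i)" and y0: "y 0 = a" for i
        using y'[of i] ab 2 by (auto simp: y_def)
      have inc: "incseq y"
      proof (rule incseq_SucI, rule ccontr)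
        fix i assume "\<not> y i \<le> y (Suc i)"
        then have "ivl_int (y i) b f \<le> ivl_int (y (Suc i)) b f"
          by (intro ivl_int_subset) auto
        then show False using 2 by (simp add: y(3) divide_simps split: if_splits)
      qed
      have block: "ivl_int (y i) (y (Suc i)) F \<le> ennreal (2 powr \<bar>\<gamma> - 1\<bar> * r powr \<gamma> * (2 powr (- \<gamma>)) ^ i)" for i
      proof -
        define \<rho> where "\<rho> = r / 2 ^ i"
        have \<rho>: "0 < \<rho>" using 2 by (simp add: \<rho>_def)
        have y0: "0 \<le> y i" using y(1)[of i] ab by simp
        have "ivl_int (y i) (y (Suc i)) F \<le> ennreal (2 powr \<bar>\<gamma> - 1\<bar> * \<rho> powr (\<gamma> - 1)) * ivl_int (y i) (y (Suc i)) f"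
        proof (rule ivl_int_le_const[OF y0 f])
          fix s assume s: "y i < ereal s" "ereal s < y (Suc i)"
          then have "ivl_int (ereal s) b f \<le> ennreal \<rho>" "ennreal (\<rho> / 2) \<le> ivl_int (ereal s) b f"
            using ivl_int_subset[of "y i" "ereal s" b b f] ivl_int_subset[of "ereal s" "y (Suc i)" b b f]
            by (simp_all add: y(3) \<rho>_def mult.commute)
          then obtain z where z: "ivl_int (ereal s) b f = ennreal z" "z \<le> \<rho>" "\<rho> / 2 \<le> z" "0 < z"
            using \<rho> by (cases "ivl_int (ereal s) b f" rule: ennreal_cases3) (auto simp: top_unique)
          then show "F s \<le> ennreal (2 powr \<bar>\<gamma> - 1\<bar> * \<rho> powr (\<gamma> - 1)) * f s"
            unfolding F_def using powr_half_bounds(2)[OF \<rho> z(3,2), of "\<gamma> - 1"]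
            by (intro mult_right_mono) (auto simp: epowr_ennreal)
        qed
        also have "\<dots> \<le> ennreal (2 powr \<bar>\<gamma> - 1\<bar> * \<rho> powr (\<gamma> - 1)) * ennreal \<rho>"
          using y ivl_int_subset[of "y i" "y i" "y (Suc i)" b f] by (intro mult_left_mono) (auto simp: \<rho>_def)
        also have "\<dots> = ennreal (2 powr \<bar>\<gamma> - 1\<bar> * \<rho> powr \<gamma>)"
          using \<rho> powr_add[of \<rho> "\<gamma> - 1" 1] by (simp add: ennreal_mult[symmetric] mult.assoc)
        also have "\<rho> powr \<gamma> = r powr \<gamma> * (2 powr (- \<gamma>)) ^ i"
        proof -
          have "\<rho> powr \<gamma> = r powr \<gamma> / (2 powr real i) powr \<gamma>"
            using 2 by (simp add: \<rho>_def powr_divide powr_realpow)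
          also have "(2 powr real i) powr \<gamma> = 1 / 2 powr (- (\<gamma> * real i))"
            by (simp add: powr_powr powr_minus_divide mult.commute)
          also have "2 powr (- (\<gamma> * real i)) = (2 powr (- \<gamma>)) ^ i"
            by (simp add: powr_powr powr_realpow[symmetric])
          finally show ?thesis by simp
        qed
        finally show ?thesis by (simp only: mult.assoc)
      qed
      have part: "ivl_int (y 0) (y n) F \<le> ennreal (2 powr \<bar>\<gamma> - 1\<bar> * r powr \<gamma> * (\<Sum>i<n. (2 powr (- \<gamma>)) ^ i))" for n
      proof (induction n)
        case (Suc n)
        have "ivl_int (y 0) (y (Suc n)) F = ivl_int (y 0) (y n) F + ivl_int (y n) (y (Suc n)) F"
          using y(1)[of 0] ab inc by (intro ivl_int_split F) (auto simp: incseq_def)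
        also have "\<dots> \<le> ennreal (2 powr \<bar>\<gamma> - 1\<bar> * r powr \<gamma> * (\<Sum>i<n. (2 powr (- \<gamma>)) ^ i))
            + ennreal (2 powr \<bar>\<gamma> - 1\<bar> * r powr \<gamma> * (2 powr (- \<gamma>)) ^ n)"
          by (intro add_mono Suc block)
        also have "\<dots> = ennreal (2 powr \<bar>\<gamma> - 1\<bar> * r powr \<gamma> * (\<Sum>i<Suc n. (2 powr (- \<gamma>)) ^ i))"
          by (subst ennreal_plus[symmetric]) (auto simp: distrib_left intro!: mult_nonneg_nonneg sum_nonneg)
        finally show ?case .
      qed simp
      define z where "z = (SUP i. y i)"
      have yz: "y i \<le> z" for i unfolding z_def by (rule SUP_upper) simp
      have az: "a \<le> z" and zb: "z \<le> b"
        using y(1)[of 0] yz[of 0] y(2) by (auto simp: z_def intro: SUP_least)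
      have "ivl_int a z F \<le> ennreal (2 powr \<bar>\<gamma> - 1\<bar> * r powr \<gamma> * D)"
        unfolding z_def ivl_int_SUP_right[OF F ab(1) inc] using part
        by (auto simp: y0 intro!: SUP_least order_trans[OF part[unfolded y0]] ennreal_leI mult_left_mono D)
      moreover have "ivl_int z b F = 0"
      proof (rule null)
        show "0 \<le> z" using az ab by simp
        have "ivl_int z b f \<le> ennreal (r / 2 ^ i)" for i
          using ivl_int_subset[OF yz[of i] order_refl, of b f] by (simp add: y(3))
        moreover have "(\<lambda>i. ennreal (r / 2 ^ i)) \<longlonglongrightarrow> ennreal 0"
          by (intro tendsto_ennrealI LIMSEQ_divide_realpow_zero) simp
        ultimately have "ivl_int z b f \<le> ennreal 0"
          by (intro LIMSEQ_le_const) auto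
        then show "ivl_int z b f = 0" by simp
      qed
      ultimately have "ivl_int a b F \<le> ennreal (2 powr \<bar>\<gamma> - 1\<bar> * r powr \<gamma> * D)"
        using ivl_int_split[OF F ab(1) az zb] by simp
      also have "\<dots> = C * ivl_int a b f epowr \<gamma>"
        using 2 D[of 0] by (simp add: C_def epowr_ennreal ennreal_mult[symmetric] mult_ac)
      finally show ?thesis .
    qed (use V in simp)
    then show ?thesis unfolding F_def .
  qed
  moreover have "C < top" by (simp add: C_def)
  ultimately have "tail_upper_constant \<gamma> C" unfolding tail_upper_constant_def by blast
  then show ?thesis by (rule that)
qed

section \<open>Hardy inequalities on an interval\<close>

text \<open>Sharpness of Hoelder's inequality: sigma / r^(1/p), where r is the integral of sigma,
  has energy at most 1 and integral r^(1/p'). As r may be infinite, sigma is truncated first, and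
  only values \<beta> strictly below the bound are reached.\<close>

lemma dual_weight_extremal:
  assumes p: "1 < p" and v: "v \<in> Mplus" and a: "0 \<le> a"
    and \<beta>: "\<beta> < dual_int p v a b epowr (1 / conj_exp p)"
  obtains h where "h \<in> Mplus" "\<And>x. x \<notin> einterval a b \<Longrightarrow> h x = 0"
    "energy p v h a b \<le> 1" "\<beta> \<le> ivl_int a b h"
proof -
  note c = conj_exp_props[OF p]
  have m: "dual_weight p v \<in> Mplus" using v by (rule Mplus_epowr)
  obtain g :: "nat \<Rightarrow> real \<Rightarrow> ennreal" where g: "\<And>n. g n \<in> Mplus" "\<And>n x. g n x \<le> dual_weight p v x"
    "\<And>n. ivl_int a b (g n) < top" "dual_int p v a b = (SUP n. ivl_int a b (g n))"
    using ivl_int_truncate[OF m a, of b] by metis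
  have "\<beta> < (SUP n. ivl_int a b (g n) epowr (1 / conj_exp p))"
    using \<beta> c unfolding g(4) by (subst (asm) epowr_SUP) auto
  then obtain n where n: "\<beta> < ivl_int a b (g n) epowr (1 / conj_exp p)"
    by (auto simp: less_SUP_iff)
  then have "0 < ivl_int a b (g n)"
    using c by (auto simp: zero_less_iff_neq_zero)
  then obtain r where r: "0 < r" "ivl_int a b (g n) = ennreal r"
    using g(3)[of n] by (cases "ivl_int a b (g n)" rule: ennreal_cases3) auto
  define d where "d = ennreal (r powr (- (1 / p)))"
  define h where "h x = d * (g n x * indicator (einterval a b) x)" for x
  have hM: "h \<in> Mplus" unfolding h_def by (intro Mplus_intros g)
  have hx: "h x = d * g n x" if "a < ereal x" "ereal x < b" for x
    using that by (simp add: h_def einterval_iff)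
  have dp: "d epowr p = ennreal (1 / r)"
    using r p by (simp add: d_def epowr_ennreal powr_powr powr_minus_divide[of r 1])
  have "energy p v h a b \<le> ennreal (1 / r) * ivl_int a b (g n)"
  proof (rule ivl_int_le_const[OF a g(1)])
    fix x assume "a < ereal x" "ereal x < b"
    then have "h x epowr p * v x = ennreal (1 / r) * (g n x epowr p * v x)"
      using p by (simp add: hx epowr_mult dp mult.assoc)
    also have "\<dots> \<le> ennreal (1 / r) * g n x"
      by (intro mult_left_mono dual_weight_test p g) simp
    finally show "h x epowr p * v x \<le> ennreal (1 / r) * g n x" .
  qed
  also have "\<dots> = 1" using r by (simp add: ennreal_mult[symmetric])
  finally have E: "energy p v h a b \<le> 1" .
  have "ivl_int a b h = d * ivl_int a b (g n)"
    using ivl_int_cong[of a b h "\<lambda>x. d * g n x"] hx ivl_int_cmult[OF g(1) a] by simp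
  also have "\<dots> = ennreal (r powr (1 / conj_exp p))"
  proof -
    have "1 / conj_exp p = - (1 / p) + 1" using c by simp
    then show ?thesis using r powr_add[of r "- (1 / p)" 1] by (simp add: d_def ennreal_mult[symmetric])
  qed
  finally have "\<beta> \<le> ivl_int a b h"
    using n r by (simp add: epowr_ennreal)
  then show ?thesis
    using that[OF hM _ E] unfolding h_def by simp
qed

section \<open>Discretization of a Hardy form at tripling points\<close>

lemma ivl_int_blocks:
  fixes x :: "nat \<Rightarrow> ereal"
  assumes f: "f \<in> Mplus" and "0 \<le> x k" "k \<le> n" and mono: "\<And>i. k \<le> i \<Longrightarrow> i < n \<Longrightarrow> x i \<le> x (Suc i)"
  shows "ivl_int (x k) (x n) f = (\<Sum>i=k..<n. ivl_int (x i) (x (Suc i)) f)" "x k \<le> x n"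
proof -
  have "ivl_int (x k) (x n) f = (\<Sum>i=k..<n. ivl_int (x i) (x (Suc i)) f) \<and> x k \<le> x n"
    using \<open>k \<le> n\<close> mono
  proof (induction n rule: dec_induct)
    case (step n)
    have IH: "ivl_int (x k) (x n) f = (\<Sum>i=k..<n. ivl_int (x i) (x (Suc i)) f)" "x k \<le> x n"
      using step.IH step.prems by auto
    have le: "x n \<le> x (Suc n)" using step.prems step.hyps by auto
    have "ivl_int (x k) (x (Suc n)) f = ivl_int (x k) (x n) f + ivl_int (x n) (x (Suc n)) f"
      using IH(2) le by (intro ivl_int_split f assms(1,2))
    then show ?case using step.hyps IH le by auto
  qed simp
  then show "ivl_int (x k) (x n) f = (\<Sum>i=k..<n. ivl_int (x i) (x (Suc i)) f)" "x k \<le> x n" by auto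
qed

text \<open>The last step, up to \<open>x n = b\<close>, may multiply \<open>A + \<integral>\<^sub>a\<^sup>x g\<close> by less than 3.\<close>

definition tripling :: "ereal \<Rightarrow> ereal \<Rightarrow> ennreal \<Rightarrow> (real \<Rightarrow> ennreal) \<Rightarrow> nat \<Rightarrow> (nat \<Rightarrow> ereal) \<Rightarrow> bool"
  where "tripling a b A g n x \<longleftrightarrow> 0 < n \<and> x 0 = a \<and> x n = b \<and> (\<forall>i<n. x i \<le> x (Suc i))
    \<and> (\<forall>i<n. A + ivl_int a (x i) g = 3 ^ i * A) \<and> (\<forall>i\<le>n. A + ivl_int a (x i) g \<le> 3 ^ i * A)"

text \<open>n exists because A > 0 and the integral is finite. Its minimality keeps the levels 3^i A
  with i < n below A plus the whole integral, so they are attained by continuity.\<close>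

lemma tripling_exists:
  assumes g: "g \<in> Mplus" and ab: "0 \<le> a" "a \<le> b" and fin: "ivl_int a b g < top"
    and A: "0 < A" "A < top"
  obtains n x where "tripling a b A g n x"
proof -
  obtain \<alpha> where \<alpha>: "0 < \<alpha>" "A = ennreal \<alpha>"
    using A by (cases A rule: ennreal_cases3) auto
  obtain I where I: "0 \<le> I" "ivl_int a b g = ennreal I"
    using fin by (cases "ivl_int a b g") auto
  have pow: "3 ^ i * A = ennreal (3 ^ i * \<alpha>)" for i :: nat
    using \<alpha> by (simp add: ennreal_mult ennreal_power[symmetric])
  \<comment> \<open>0 < n forces at least one block, even if g has no mass at all.\<close>
  define P where "P n \<longleftrightarrow> 0 < n \<and> \<alpha> + I \<le> 3 ^ n * \<alpha>" for n :: nat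
  obtain n0 :: nat where "(\<alpha> + I) / \<alpha> < 3 ^ n0"
    using real_arch_pow[of 3 "(\<alpha> + I) / \<alpha>"] by auto
  moreover have "(3::real) ^ n0 \<le> 3 ^ Suc n0" by simp
  ultimately have "(\<alpha> + I) / \<alpha> \<le> 3 ^ Suc n0" by linarith
  then have "P (Suc n0)" unfolding P_def using \<alpha> by (simp add: pos_divide_le_eq)
  define n where "n = (LEAST n. P n)"
  have Pn: "P n" unfolding n_def by (rule LeastI[of P, OF \<open>P (Suc n0)\<close>])
  have low: "3 ^ i * \<alpha> \<le> \<alpha> + I" if "i < n" for i
  proof (cases "i = 0")
    case False
    then show ?thesis using not_less_Least[of i P] that unfolding n_def[symmetric] by (auto simp: P_def)
  qed (use I in simp)
  have "\<exists>y. a \<le> y \<and> y \<le> b \<and> A + ivl_int a y g = 3 ^ i * A" if i: "0 < i" "i < n" for i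
  proof -
    have one: "\<alpha> \<le> 3 ^ i * \<alpha>" using \<alpha> by simp
    have "ennreal (3 ^ i * \<alpha> - \<alpha>) \<le> ivl_int a b g"
      unfolding I(2) using low[OF i(2)] by (intro ennreal_leI) auto
    from ivl_int_IVT[OF g ab fin this] obtain y
      where y: "a \<le> y" "y \<le> b" "ivl_int a y g = ennreal (3 ^ i * \<alpha> - \<alpha>)" by auto
    then have "A + ivl_int a y g = 3 ^ i * A"
      unfolding pow unfolding \<alpha>(2) using \<alpha> one by (subst y(3), subst ennreal_plus[symmetric]) auto
    then show ?thesis using y by blast
  qed
  then obtain y where y: "\<And>i. 0 < i \<Longrightarrow> i < n \<Longrightarrow> a \<le> y i \<and> y i \<le> b \<and> A + ivl_int a (y i) g = 3 ^ i * A"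
    by metis
  define x where "x i = (if i = 0 then a else if i < n then y i else b)" for i
  have n: "0 < n" using Pn by (simp add: P_def)
  have xab: "a \<le> x i" "x i \<le> b" for i using y[of i] ab by (auto simp: x_def)
  have eq: "A + ivl_int a (x i) g = 3 ^ i * A" if "i < n" for i
    using y[of i] that by (auto simp: x_def)
  have le: "A + ivl_int a (x i) g \<le> 3 ^ i * A" if "i \<le> n" for i
  proof (cases "i < n")
    case False
    then have "i = n" "x i = b" using that n by (auto simp: x_def)
    then show ?thesis
      using Pn \<alpha> I unfolding pow by (simp add: P_def ennreal_plus[symmetric] del: ennreal_plus)
  qed (simp add: eq)
  have mono: "x i \<le> x (Suc i)" if "i < n" for i
  proof (cases "Suc i < n")
    case True
    show ?thesis
    proof (rule ccontr)
      assume "\<not> x i \<le> x (Suc i)"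
      then have "A + ivl_int a (x (Suc i)) g \<le> A + ivl_int a (x i) g"
        by (intro add_left_mono ivl_int_subset) auto
      then have "ennreal (3 ^ Suc i * \<alpha>) \<le> ennreal (3 ^ i * \<alpha>)"
        using eq[OF True] eq[OF that] by (simp only: pow)
      then show False using \<alpha> by simp
    qed
  next
    case False
    then have "x (Suc i) = b" using that by (simp add: x_def)
    then show ?thesis using xab by simp
  qed
  have "tripling a b A g n x"
    unfolding tripling_def using n eq le mono by (auto simp: x_def)
  then show ?thesis by (rule that)
qed

text \<open>The Stieltjes integral of the m-th power of the tail of h against the measure with
  density g and a point mass A at the left end a.\<close>

definition Hardy_form :: "ereal \<Rightarrow> ereal \<Rightarrow> ennreal \<Rightarrow> (real \<Rightarrow> ennreal) \<Rightarrow> real \<Rightarrow> (real \<Rightarrow> ennreal) \<Rightarrow> ennreal"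
  where "Hardy_form a b A g m h = A * ivl_int a b h epowr m
    + ivl_int a b (\<lambda>s. ivl_int (ereal s) b h epowr m * g s)"

context
  fixes a b :: ereal and A :: ennreal and g :: "real \<Rightarrow> ennreal" and n :: nat and x :: "nat \<Rightarrow> ereal"
  assumes g: "g \<in> Mplus" and a: "0 \<le> a" and x: "tripling a b A g n x"
begin

lemma tripling_mono: "i \<le> j \<Longrightarrow> j \<le> n \<Longrightarrow> x i \<le> x j"
proof (induction j rule: dec_induct)
  case (step j)
  then have "x j \<le> x (Suc j)" using x by (auto simp: tripling_def)
  then show ?case using step by auto
qed simp

lemma tripling_bounds: "i \<le> n \<Longrightarrow> a \<le> x i" "i \<le> n \<Longrightarrow> x i \<le> b" "i \<le> n \<Longrightarrow> 0 \<le> x i"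
  using tripling_mono[of 0 i] tripling_mono[of i n] x a by (auto simp: tripling_def)

lemma tripling_split:
  assumes f: "f \<in> Mplus" and "i < n"
  shows "ivl_int (x i) b f = ivl_int (x i) (x (Suc i)) f + ivl_int (x (Suc i)) b f"
  using assms tripling_bounds[of i] tripling_bounds[of "Suc i"] tripling_mono[of i "Suc i"]
  by (intro ivl_int_split) auto

lemma tripling_sum:
  assumes f: "f \<in> Mplus"
  shows "ivl_int a b f = (\<Sum>i<n. ivl_int (x i) (x (Suc i)) f)"
  using ivl_int_blocks(1)[OF f, of x 0 n] tripling_mono tripling_bounds(3)[of 0] x
  by (auto simp: tripling_def atLeast0LessThan)

text \<open>The index n is excluded, since \<open>x n\<close> need not reach the level 3^n
  A.\<close>

lemma tripling_weight_lower:
  assumes "i < n" "x i \<le> y" shows "3 ^ i * A \<le> A + ivl_int a y g"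
proof -
  have "3 ^ i * A = A + ivl_int a (x i) g" using x assms by (auto simp: tripling_def)
  also have "\<dots> \<le> A + ivl_int a y g" using assms by (intro add_left_mono ivl_int_subset) auto
  finally show ?thesis .
qed

lemma tripling_weight_upper:
  assumes "i < n" "y \<le> x (Suc i)" shows "A + ivl_int a y g \<le> 3 * (3 ^ i * A)"
proof -
  have "A + ivl_int a y g \<le> A + ivl_int a (x (Suc i)) g"
    using assms by (intro add_left_mono ivl_int_subset) auto
  also have "\<dots> \<le> 3 ^ Suc i * A" using x assms unfolding tripling_def by (meson Suc_leI)
  finally show ?thesis by (simp add: mult.assoc)
qed

text \<open>On a block the tail of h is largest at the left end, and g has mass at most 3^(i+1) A.
  The factor 4 is 1 for the point mass plus 3 for the blocks.\<close>

lemma Hardy_form_le_blocks: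
  assumes h: "h \<in> Mplus" and m: "0 < m"
  shows "Hardy_form a b A g m h \<le> 4 * (\<Sum>i<n. 3 ^ i * A * ivl_int (x i) b h epowr m)"
proof -
  define F where "F = (\<lambda>s. ivl_int (ereal s) b h epowr m * g s)"
  have F: "F \<in> Mplus" unfolding F_def by (intro Mplus_intros Mplus_tail g)
  have block: "ivl_int (x i) (x (Suc i)) F \<le> 3 * (3 ^ i * A * ivl_int (x i) b h epowr m)" if i: "i < n" for i
  proof -
    have "ivl_int (x i) (x (Suc i)) F \<le> ivl_int (x i) b h epowr m * ivl_int (x i) (x (Suc i)) g"
      unfolding F_def using i tripling_bounds[of i] m
      by (intro ivl_int_le_const g mult_right_mono epowr_mono ivl_int_subset) auto
    also have "\<dots> \<le> ivl_int (x i) b h epowr m * (3 * (3 ^ i * A))"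
    proof (rule mult_left_mono)
      have "ivl_int (x i) (x (Suc i)) g \<le> A + ivl_int a (x (Suc i)) g"
        using ivl_int_subset[of a "x i" "x (Suc i)" "x (Suc i)" g] tripling_bounds[of i] i
        by (simp add: add_increasing)
      also have "\<dots> \<le> 3 * (3 ^ i * A)" using tripling_weight_upper[OF i order_refl] .
      finally show "ivl_int (x i) (x (Suc i)) g \<le> 3 * (3 ^ i * A)" .
    qed simp
    finally show ?thesis by (simp add: mult_ac)
  qed
  have "A * ivl_int a b h epowr m \<le> (\<Sum>i<n. 3 ^ i * A * ivl_int (x i) b h epowr m)"
    using member_le_sum[of 0 "{..<n}" "\<lambda>i. 3 ^ i * A * ivl_int (x i) b h epowr m"] x
    by (auto simp: tripling_def)
  moreover have "ivl_int a b F \<le> 3 * (\<Sum>i<n. 3 ^ i * A * ivl_int (x i) b h epowr m)"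
    unfolding tripling_sum[OF F] sum_distrib_left by (intro sum_mono block) simp
  ultimately have "Hardy_form a b A g m h \<le> (\<Sum>i<n. 3 ^ i * A * ivl_int (x i) b h epowr m)
    + 3 * (\<Sum>i<n. 3 ^ i * A * ivl_int (x i) b h epowr m)"
    unfolding Hardy_form_def F_def by (rule add_mono)
  also have "\<dots> = (1 + 3) * (\<Sum>i<n. 3 ^ i * A * ivl_int (x i) b h epowr m)"
    by (simp only: distrib_right mult_1)
  finally show ?thesis by simp
qed

text \<open>The term with index i+1 is paid for by the preceding block, where the tail of h is at
  least its value at the right end and g has mass exactly 2 * 3^i A; the term with index 0 is paid
  for by the point mass.\<close>

lemma Hardy_form_ge_blocks:
  assumes h: "h \<in> Mplus" and m: "0 < m" and A: "0 < A" "A < top"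
  shows "(\<Sum>i<n. 3 ^ i * A * ivl_int (x i) b h epowr m) \<le> 2 * Hardy_form a b A g m h"
proof -
  define F where "F = (\<lambda>s. ivl_int (ereal s) b h epowr m * g s)"
  have F: "F \<in> Mplus" unfolding F_def by (intro Mplus_intros Mplus_tail g)
  have block: "3 ^ Suc i * A * ivl_int (x (Suc i)) b h epowr m \<le> 2 * ivl_int (x i) (x (Suc i)) F" if i: "Suc i < n" for i
  proof -
    have "3 ^ i * A + ivl_int (x i) (x (Suc i)) g = 3 ^ Suc i * A"
    proof -
      have "3 ^ Suc i * A = A + ivl_int a (x (Suc i)) g" using x i by (auto simp: tripling_def)
      also have "ivl_int a (x (Suc i)) g = ivl_int a (x i) g + ivl_int (x i) (x (Suc i)) g"
        using i tripling_bounds[of i] tripling_mono[of i "Suc i"] by (intro ivl_int_split g a) auto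
      also have "A + (ivl_int a (x i) g + ivl_int (x i) (x (Suc i)) g) = 3 ^ i * A + ivl_int (x i) (x (Suc i)) g"
        using x i by (simp add: tripling_def add.assoc[symmetric])
      finally show ?thesis ..
    qed
    also have "\<dots> = (1 + 2) * (3 ^ i * A)" by (simp add: mult.assoc)
    also have "\<dots> = 3 ^ i * A + 2 * (3 ^ i * A)" by (simp only: distrib_right mult_1)
    finally have "ivl_int (x i) (x (Suc i)) g = 2 * (3 ^ i * A)"
      using A by (auto simp: ennreal_add_left_cancel ennreal_mult_eq_top_iff power_eq_top_ennreal)
    \<comment> \<open>3^(i+1) A is at most 4 * 3^i A, which is twice the mass of g on the
      block.\<close>
    then have "3 ^ Suc i * A \<le> 2 * ivl_int (x i) (x (Suc i)) g"
      using mult_right_mono[of 3 4 "3 ^ i * A"] by (simp add: mult.assoc[symmetric])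
    then have "3 ^ Suc i * A * ivl_int (x (Suc i)) b h epowr m
        \<le> 2 * (ivl_int (x (Suc i)) b h epowr m * ivl_int (x i) (x (Suc i)) g)"
      by (metis mult.assoc mult.commute mult_right_mono zero_le)
    also have "\<dots> \<le> 2 * ivl_int (x i) (x (Suc i)) F"
      unfolding F_def using i tripling_bounds[of i] m
      by (intro mult_left_mono ivl_int_ge_const g mult_right_mono epowr_mono ivl_int_subset) auto
    finally show ?thesis .
  qed
  obtain n' where n': "n = Suc n'" using x by (cases n) (auto simp: tripling_def)
  have "(\<Sum>i<n. 3 ^ i * A * ivl_int (x i) b h epowr m)
      = A * ivl_int a b h epowr m + (\<Sum>i<n'. 3 ^ Suc i * A * ivl_int (x (Suc i)) b h epowr m)"
    unfolding n' sum.lessThan_Suc_shift using x by (simp add: tripling_def)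
  also have "\<dots> \<le> 2 * (A * ivl_int a b h epowr m) + (\<Sum>i<n'. 2 * ivl_int (x i) (x (Suc i)) F)"
    by (intro add_mono sum_mono block) (auto simp: n' mult_2)
  also have "\<dots> \<le> 2 * (A * ivl_int a b h epowr m) + 2 * ivl_int a b F"
    unfolding tripling_sum[OF F] sum_distrib_left[symmetric] n' by (intro add_left_mono mult_left_mono) auto
  finally show ?thesis by (simp add: Hardy_form_def F_def distrib_left)
qed

end

section \<open>Hardy inequalities on one interval: upper and lower bounds\<close>

lemma tripling_weights_grow:
  assumes "1 \<le> \<kappa>"
  shows "ennreal 3 * (3 ^ j * A) epowr \<kappa> \<le> (3 ^ Suc j * A) epowr \<kappa>"
proof -
  have "ennreal (3 powr 1) \<le> ennreal (3 powr \<kappa>)"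
    using assms by (intro ennreal_leI powr_mono) auto
  then have "ennreal 3 \<le> ennreal 3 epowr \<kappa>"
    by (simp only: epowr_ennreal[OF zero_less_numeral] powr_one zero_le_numeral)
  then have "ennreal 3 * (3 ^ j * A) epowr \<kappa> \<le> ennreal 3 epowr \<kappa> * (3 ^ j * A) epowr \<kappa>"
    by (intro mult_right_mono) auto
  also have "\<dots> = (ennreal 3 * (3 ^ j * A)) epowr \<kappa>"
    using assms by (intro epowr_mult[symmetric]) auto
  also have "ennreal 3 * (3 ^ j * A) = 3 ^ Suc j * A"
    by (simp add: mult.assoc)
  finally show ?thesis .
qed

text \<open>Common start of both upper bounds: the discrete Hardy inequality replaces the tail of h
  at \<open>x i\<close> by the integral over one block, and Hoelder's inequality on the block
  separates h from sigma. How the products are then summed depends on the order of p and m.\<close>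

lemma Hardy_form_le_products:
  assumes p: "1 < p" and m: "0 < m" and C1: "Hardy_constant 3 m C1"
    and g: "g \<in> Mplus" and v: "v \<in> Mplus" and h: "h \<in> Mplus" and a: "0 \<le> a" and x: "tripling a b A g n x"
    and E: "energy p v h a b < top" and V: "dual_int p v a b < top"
  shows "Hardy_form a b A g m h \<le> 4 * C1 * 2 epowr m * (\<Sum>i<n. 3 ^ i * A *
    (energy p v h (x i) (x (Suc i)) epowr (m / p) * dual_int p v (x i) (x (Suc i)) epowr (m / conj_exp p)))"
proof -
  note bounds = tripling_bounds[OF g a x]
  have "Hardy_form a b A g m h \<le> 4 * (\<Sum>i<n. 3 ^ i * A * ivl_int (x i) b h epowr m)"
    by (rule Hardy_form_le_blocks[OF g a x h m])
  also have "(\<Sum>i<n. 3 ^ i * A * ivl_int (x i) b h epowr m)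
      \<le> C1 * (\<Sum>i<n. 3 ^ i * A * ivl_int (x i) (x (Suc i)) h epowr m)"
  proof (rule Hardy_constantD[OF C1])
    show "ivl_int (x j) b h \<le> ivl_int (x j) (x (Suc j)) h + ivl_int (x (Suc j)) b h" if "j < n" for j
      using tripling_split[OF g a x h that] by simp
    show "ivl_int (x n) b h = 0" using x by (simp add: tripling_def)
  qed (simp add: mult.assoc)
  also have "(\<Sum>i<n. 3 ^ i * A * ivl_int (x i) (x (Suc i)) h epowr m)
      \<le> (\<Sum>i<n. 3 ^ i * A * (2 epowr m *
      (energy p v h (x i) (x (Suc i)) epowr (m / p)
        * dual_int p v (x i) (x (Suc i)) epowr (m / conj_exp p))))"
  proof (intro sum_mono mult_left_mono)
    fix i assume "i \<in> {..<n}"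
    then have i: "i \<le> n" "Suc i \<le> n" by auto
    have "ivl_int (x i) (x (Suc i)) h \<le> 2 * (energy p v h (x i) (x (Suc i)) epowr (1 / p)
        * dual_int p v (x i) (x (Suc i)) epowr (1 / conj_exp p))"
      by (intro Hoelder_dual_weight p h v bounds i le_less_trans[OF ivl_int_subset E] le_less_trans[OF ivl_int_subset V])
    then have "ivl_int (x i) (x (Suc i)) h epowr m \<le> (2 * (energy p v h (x i) (x (Suc i)) epowr (1 / p)
        * dual_int p v (x i) (x (Suc i)) epowr (1 / conj_exp p))) epowr m"
      using m by (intro epowr_mono) auto
    then show "ivl_int (x i) (x (Suc i)) h epowr m \<le> 2 epowr m *
      (energy p v h (x i) (x (Suc i)) epowr (m / p)
        * dual_int p v (x i) (x (Suc i)) epowr (m / conj_exp p))"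
      using m by (simp add: epowr_mult epowr_epowr)
  qed simp
  also have "\<dots> = 2 epowr m * (\<Sum>i<n. 3 ^ i * A *
      (energy p v h (x i) (x (Suc i)) epowr (m / p)
        * dual_int p v (x i) (x (Suc i)) epowr (m / conj_exp p)))"
    by (simp add: sum_distrib_left mult.left_commute)
  finally show ?thesis
    by (simp add: mult.assoc mult_left_mono)
qed

text \<open>As m / p >= 1, the powers of the block energies sum to at most the power of the whole
  energy, and the remaining factors are bounded by B on each block separately.\<close>

lemma Hardy_upper_sup:
  assumes p: "1 < p" and m: "p \<le> m" and C1: "Hardy_constant 3 m C1"
    and g: "g \<in> Mplus" and v: "v \<in> Mplus" and h: "h \<in> Mplus" and ab: "0 \<le> a" "a \<le> b"
    and fin: "ivl_int a b g < top" and A: "0 < A" "A < top"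
    and E: "energy p v h a b < top" and V: "dual_int p v a b < top"
    and B: "\<And>y. a \<le> y \<Longrightarrow> y \<le> b \<Longrightarrow> (A + ivl_int a y g) * dual_int p v y b epowr (m / conj_exp p) \<le> B"
  shows "Hardy_form a b A g m h \<le> 4 * C1 * 2 epowr m * (B * energy p v h a b epowr (m / p))"
proof -
  have m0: "0 < m" using p m by simp
  obtain n x where x: "tripling a b A g n x"
    using tripling_exists[OF g ab fin A] by metis
  note bounds = tripling_bounds[OF g ab(1) x]
  let ?E = "\<lambda>i. energy p v h (x i) (x (Suc i))"
  let ?V = "\<lambda>i. dual_int p v (x i) (x (Suc i))"
  have "(\<Sum>i<n. 3 ^ i * A * (?E i epowr (m / p) * ?V i epowr (m / conj_exp p)))
      \<le> (\<Sum>i<n. B * ?E i epowr (m / p))"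
  proof (rule sum_mono)
    fix i assume "i \<in> {..<n}"
    then have i: "i < n" "i \<le> n" "Suc i \<le> n" by auto
    have "3 ^ i * A * ?V i epowr (m / conj_exp p)
        \<le> (A + ivl_int a (x i) g) * dual_int p v (x i) b epowr (m / conj_exp p)"
      using conj_exp_props(1)[OF p] m0
      by (intro mult_mono epowr_mono ivl_int_subset bounds i tripling_weight_lower[OF g ab(1) x]) auto
    also have "\<dots> \<le> B" by (intro B bounds i)
    finally have "?E i epowr (m / p) * (3 ^ i * A * ?V i epowr (m / conj_exp p)) \<le> ?E i epowr (m / p) * B"
      by (rule mult_left_mono) simp
    then show "3 ^ i * A * (?E i epowr (m / p) * ?V i epowr (m / conj_exp p)) \<le> B * ?E i epowr (m / p)"
      by (simp add: mult_ac)
  qed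
  also have "\<dots> \<le> B * (\<Sum>i<n. ?E i) epowr (m / p)"
    unfolding sum_distrib_left[symmetric] using p m by (intro mult_left_mono sum_epowr_le) auto
  also have "(\<Sum>i<n. ?E i) = energy p v h a b"
    by (intro tripling_sum[OF g ab(1) x, symmetric] Mplus_intros h v)
  finally have *: "(\<Sum>i<n. 3 ^ i * A * (?E i epowr (m / p) * ?V i epowr (m / conj_exp p)))
      \<le> B * energy p v h a b epowr (m / p)" .
  show ?thesis
    by (rule order_trans[OF Hardy_form_le_products[OF p m0 C1 g v h ab(1) x E V] mult_left_mono[OF *]]) simp
qed

text \<open>The exponents \<kappa> = p / (p - m) and \<gamma> = m (p - 1) / (p - m) come from
  Hoelder's inequality for sums with the exponents 1/\<kappa> = (p - m) / p and m / p: it turns the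
  factors Psi V^(m/p') of the blocks into Psi^\<kappa> V^\<gamma>.\<close>

lemma Hardy_exponents:
  assumes "1 < p" "0 < m" "m < p"
  shows "1 \<le> p / (p - m)" "0 < m * (p - 1) / (p - m)" "0 < (p - m) / p"
    "m * (p - 1) / (p - m) - 1 = p * (m - 1) / (p - m)"
    "m * (p - 1) / (p - m) * ((p - m) / p) = m / conj_exp p"
    "p / (p - m) * ((p - m) / p) = 1" "(p - m) / p + m / p = 1"
  using assms by (auto simp: conj_exp_def field_simps)

text \<open>The quantity of Maz'ya and Rozin for a Hardy inequality with m < p: the integral of
  Psi^\<kappa> V^(\<gamma>-1) sigma, where \<gamma> - 1 = p (m - 1) / (p - m).\<close>

definition Hardy_integral :: "ereal \<Rightarrow> ereal \<Rightarrow> ennreal \<Rightarrow> (real \<Rightarrow> ennreal) \<Rightarrow> real \<Rightarrow> real \<Rightarrow> (real \<Rightarrow> ennreal) \<Rightarrow> ennreal"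
  where "Hardy_integral a b A g p m v = ivl_int a b (\<lambda>s. (A + ivl_int a (ereal s) g) epowr (p / (p - m))
    * (dual_int p v (ereal s) b epowr (p * (m - 1) / (p - m)) * dual_weight p v s))"

lemma Hardy_upper_int:
  assumes p: "1 < p" and m: "0 < m" "m < p" and C1: "Hardy_constant 3 m C1"
    and C2: "tail_lower_constant (m * (p - 1) / (p - m)) C2" and C3: "Hardy_constant 3 1 C3"
    and g: "g \<in> Mplus" and v: "v \<in> Mplus" and h: "h \<in> Mplus" and ab: "0 \<le> a" "a \<le> b"
    and fin: "ivl_int a b g < top" and A: "0 < A" "A < top"
    and E: "energy p v h a b < top" and V: "dual_int p v a b < top"
  shows "Hardy_form a b A g m h \<le> 4 * C1 * 2 epowr m * 2 * (C2 * C3) epowr ((p - m) / p)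
    * (Hardy_integral a b A g p m v epowr ((p - m) / p) * energy p v h a b epowr (m / p))"
proof -
  define \<kappa> \<gamma> where "\<kappa> = p / (p - m)" and "\<gamma> = m * (p - 1) / (p - m)"
  note ex = Hardy_exponents[OF p m, folded \<kappa>_def \<gamma>_def]
  obtain n x where x: "tripling a b A g n x"
    using tripling_exists[OF g ab fin A] by metis
  note bounds = tripling_bounds[OF g ab(1) x]
  let ?\<sigma> = "dual_weight p v"
  define F where "F = (\<lambda>s. ivl_int (ereal s) b ?\<sigma> epowr (\<gamma> - 1) * ?\<sigma> s)"
  define J where "J = (\<lambda>s. (A + ivl_int a (ereal s) g) epowr \<kappa> * F s)"
  have \<sigma>: "?\<sigma> \<in> Mplus" by (intro Mplus_intros v)
  have F: "F \<in> Mplus" unfolding F_def by (intro Mplus_mult Mplus_epowr Mplus_tail v)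
  have J: "J \<in> Mplus" unfolding J_def
    by (intro Mplus_mult Mplus_epowr Mplus_add Mplus_const F Mplus_mono ivl_int_subset) auto
  let ?E = "\<lambda>i. energy p v h (x i) (x (Suc i))"
  let ?V = "\<lambda>i. ivl_int (x i) (x (Suc i)) ?\<sigma>"
  let ?G = "\<lambda>i. 3 ^ i * A"
  \<comment> \<open>V^\<gamma> is bounded by the integral of V^(\<gamma>-1) sigma up to b, V being
    the tail up to b, and the discrete Hardy inequality with exponent 1 brings this integral back to
    one block. Tails that end with the block would not do for \<gamma> < 1, where a smaller tail has
    a larger power.\<close>
  have Q: "(\<Sum>i<n. ?G i epowr \<kappa> * ?V i epowr \<gamma>) \<le> C2 * C3 * ivl_int a b J"
  proof -
    have "(\<Sum>i<n. ?G i epowr \<kappa> * ?V i epowr \<gamma>) \<le> (\<Sum>i<n. ?G i epowr \<kappa> * (C2 * ivl_int (x i) b F epowr 1))"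
    proof (intro sum_mono mult_left_mono)
      fix i assume "i \<in> {..<n}"
      then have i: "i < n" "i \<le> n" "Suc i \<le> n" by auto
      have "?V i epowr \<gamma> \<le> ivl_int (x i) b ?\<sigma> epowr \<gamma>"
        using ex by (intro epowr_mono ivl_int_subset bounds i) auto
      also have "\<dots> \<le> C2 * ivl_int (x i) b F"
        unfolding F_def using le_less_trans[OF ivl_int_subset[OF bounds(1) order_refl] V] i bounds[of i]
          \<sigma> C2[folded \<gamma>_def] unfolding tail_lower_constant_def by blast
      finally show "?V i epowr \<gamma> \<le> C2 * ivl_int (x i) b F epowr 1" by simp
    qed simp
    also have "\<dots> = C2 * (\<Sum>i<n. ?G i epowr \<kappa> * ivl_int (x i) b F epowr 1)"
      by (simp add: sum_distrib_left mult.left_commute)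
    also have "(\<Sum>i<n. ?G i epowr \<kappa> * ivl_int (x i) b F epowr 1)
        \<le> C3 * (\<Sum>i<n. ?G i epowr \<kappa> * ivl_int (x i) (x (Suc i)) F epowr 1)"
    proof (rule Hardy_constantD[OF C3])
      show "ivl_int (x j) b F \<le> ivl_int (x j) (x (Suc j)) F + ivl_int (x (Suc j)) b F" if "j < n" for j
        using tripling_split[OF g ab(1) x F that] by simp
      show "ivl_int (x n) b F = 0" using x by (simp add: tripling_def)
    qed (rule tripling_weights_grow[OF ex(1)])
    also have "(\<Sum>i<n. ?G i epowr \<kappa> * ivl_int (x i) (x (Suc i)) F epowr 1)
        \<le> (\<Sum>i<n. ivl_int (x i) (x (Suc i)) J)"
      unfolding J_def epowr_1_right using ex
      by (intro sum_mono ivl_int_ge_const F mult_right_mono epowr_mono tripling_weight_lower[OF g ab(1) x] bounds) auto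
    also have "\<dots> = ivl_int a b J" by (rule tripling_sum[OF g ab(1) x J, symmetric])
    finally show ?thesis by (simp add: mult.assoc mult_left_mono)
  qed
  have "Hardy_form a b A g m h \<le> 4 * C1 * 2 epowr m * (\<Sum>i<n. ?G i * (?E i epowr (m / p) * ?V i epowr (m / conj_exp p)))"
    by (rule Hardy_form_le_products[OF p m(1) C1 g v h ab(1) x E V])
  also have "(\<Sum>i<n. ?G i * (?E i epowr (m / p) * ?V i epowr (m / conj_exp p)))
      = (\<Sum>i<n. (?G i epowr \<kappa> * ?V i epowr \<gamma>) epowr ((p - m) / p) * ?E i epowr (m / p))"
    using ex by (simp add: epowr_mult epowr_epowr mult_ac)
  also have "\<dots> \<le> 2 * ((\<Sum>i<n. ?G i epowr \<kappa> * ?V i epowr \<gamma>) epowr ((p - m) / p) * (\<Sum>i<n. ?E i) epowr (m / p))"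
    using ex p m by (intro sum_Hoelder) auto
  also have "(\<Sum>i<n. ?E i) = energy p v h a b"
    by (intro tripling_sum[OF g ab(1) x, symmetric] Mplus_intros h v)
  also have "(\<Sum>i<n. ?G i epowr \<kappa> * ?V i epowr \<gamma>) epowr ((p - m) / p)
      \<le> (C2 * C3 * ivl_int a b J) epowr ((p - m) / p)"
    using ex by (intro epowr_mono Q) auto
  also have "\<dots> = (C2 * C3) epowr ((p - m) / p) * ivl_int a b J epowr ((p - m) / p)"
    using ex by (simp add: epowr_mult)
  also have "ivl_int a b J = Hardy_integral a b A g p m v"
    by (simp only: Hardy_integral_def J_def F_def \<kappa>_def ex(4))
  finally show ?thesis
    by (simp add: mult_ac mult_left_mono mult_right_mono)
qed

text \<open>On [a, y] the tail of h is at least its value at y. This is what makes the supremum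
  condition necessary.\<close>

lemma Hardy_form_at:
  assumes "g \<in> Mplus" "0 \<le> a" "a \<le> y" "y \<le> b" "0 < m"
  shows "(A + ivl_int a y g) * ivl_int y b h epowr m \<le> Hardy_form a b A g m h"
proof -
  have "(A + ivl_int a y g) * ivl_int y b h epowr m
      = A * ivl_int y b h epowr m + ivl_int y b h epowr m * ivl_int a y g"
    by (simp add: algebra_simps)
  also have "A * ivl_int y b h epowr m \<le> A * ivl_int a b h epowr m"
    using assms by (intro mult_left_mono epowr_mono ivl_int_subset) auto
  also have "ivl_int y b h epowr m * ivl_int a y g \<le> ivl_int a y (\<lambda>s. ivl_int (ereal s) b h epowr m * g s)"
    using assms by (intro ivl_int_ge_const mult_right_mono epowr_mono ivl_int_subset) auto
  also have "\<dots> \<le> ivl_int a b (\<lambda>s. ivl_int (ereal s) b h epowr m * g s)"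
    using assms by (intro ivl_int_subset) auto
  finally show ?thesis by (simp add: Hardy_form_def)
qed

text \<open>The test function is d Psi^(1/(p-m)) V^(\<delta>-1) sigma with \<delta> = (p - 1) / (p -
  m). If I denotes the Hardy integral, its energy is at most d^p I and its form at least a multiple
  of d^m I; the normalization d = I^(-1/p) makes these 1 and I^((p-m)/p).\<close>

lemma Hardy_lower_int:
  assumes p: "1 < p" and m: "0 < m" "m < p" and C2: "tail_upper_constant (m * (p - 1) / (p - m)) C2"
    and C3: "tail_lower_constant ((p - 1) / (p - m)) C3"
    and g: "g \<in> Mplus" and v: "v \<in> Mplus" and ab: "0 \<le> a" "a \<le> b" and fin: "ivl_int a b g < top"
    and A: "0 < A" "A < top" and V: "dual_int p v a b < top"
  shows "\<exists>h\<in>Mplus. (\<forall>s. s \<notin> einterval a b \<longrightarrow> h s = 0) \<and> energy p v h a b \<le> 1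
    \<and> Hardy_integral a b A g p m v epowr ((p - m) / p)
      \<le> 3 epowr (p / (p - m)) * C2 * C3 epowr m * 2 * Hardy_form a b A g m h"
proof -
  define \<kappa> \<gamma> where "\<kappa> = p / (p - m)" and "\<gamma> = m * (p - 1) / (p - m)"
  note ex = Hardy_exponents[OF p m, folded \<kappa>_def \<gamma>_def]
  let ?\<sigma> = "dual_weight p v" and ?e = "1 / (p - m)" and ?\<delta> = "(p - 1) / (p - m)"
  obtain n x where x: "tripling a b A g n x"
    using tripling_exists[OF g ab fin A] by metis
  note bounds = tripling_bounds[OF g ab(1) x]
  define V where "V s = dual_int p v s b" for s
  define \<Psi> where "\<Psi> s = A + ivl_int a s g" for s
  define F where "F = (\<lambda>s. V (ereal s) epowr (\<gamma> - 1) * ?\<sigma> s)"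
  define J where "J = (\<lambda>s. \<Psi> (ereal s) epowr \<kappa> * F s)"
  define I where "I = ivl_int a b J"
  have \<sigma>: "?\<sigma> \<in> Mplus" by (intro Mplus_intros v)
  have MV: "(\<lambda>s. V (ereal s) epowr d) \<in> Mplus" for d unfolding V_def by (intro Mplus_epowr Mplus_tail)
  have M\<Psi>: "(\<lambda>s. \<Psi> (ereal s) epowr d) \<in> Mplus" for d
    unfolding \<Psi>_def by (intro Mplus_epowr Mplus_add Mplus_const Mplus_mono ivl_int_subset) auto
  have F: "F \<in> Mplus" and J: "J \<in> Mplus" unfolding J_def F_def by (intro Mplus_mult MV M\<Psi> \<sigma>)+
  have I_eq: "Hardy_integral a b A g p m v = I"
    by (simp only: Hardy_integral_def I_def J_def F_def V_def \<Psi>_def \<kappa>_def ex(4))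
  define G where "G i = 3 ^ i * A" for i :: nat
  have Vfin: "V (x i) < top" if "i \<le> n" for i
    unfolding V_def by (rule le_less_trans[OF ivl_int_subset[OF bounds(1)[OF that] order_refl] assms(13)])
  \<comment> \<open>Used twice: it shows that I is finite, hence fit for normalization, and it
    reduces the lower bound for the form to the block terms.\<close>
  have IG: "I \<le> (3 epowr \<kappa> * C2) * (\<Sum>i<n. G i epowr \<kappa> * V (x i) epowr \<gamma>)"
    unfolding I_def tripling_sum[OF g ab(1) x J] sum_distrib_left
  proof (rule sum_mono)
    fix i assume "i \<in> {..<n}"
    then have i: "i < n" "i \<le> n" "Suc i \<le> n" by auto
    have "ivl_int (x i) (x (Suc i)) J \<le> (3 * G i) epowr \<kappa> * ivl_int (x i) (x (Suc i)) F"
      unfolding J_def G_def \<Psi>_def using ex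
      by (intro ivl_int_le_const F mult_right_mono epowr_mono tripling_weight_upper[OF g ab(1) x] bounds i) auto
    also have "\<dots> \<le> (3 * G i) epowr \<kappa> * ivl_int (x i) b F"
      by (intro mult_left_mono ivl_int_subset bounds i) auto
    also have "\<dots> \<le> (3 * G i) epowr \<kappa> * (C2 * V (x i) epowr \<gamma>)"
      unfolding F_def V_def using C2[folded \<gamma>_def] \<sigma> bounds[OF i(2)] Vfin[OF i(2), unfolded V_def]
      by (intro mult_left_mono) (auto simp: tail_upper_constant_def)
    finally show "ivl_int (x i) (x (Suc i)) J \<le> (3 epowr \<kappa> * C2) * (G i epowr \<kappa> * V (x i) epowr \<gamma>)"
      using ex by (simp add: epowr_mult mult_ac)
  qed
  have "G i < top" for i
    using A(2) by (simp add: G_def ennreal_mult_less_top power_less_top_ennreal)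
  then have Ifin: "I < top"
    using le_less_trans[OF IG] Vfin C2 ex by (simp add: ennreal_mult_less_top tail_upper_constant_def)
  show ?thesis
  proof (cases "I = 0")
    case True
    then show ?thesis
      using Mplus_const[of 0] ex(3) p by (intro bexI[of _ "\<lambda>_. 0"]) (simp_all add: I_eq)
  next
    case False
    then have I0: "0 < I" by (simp add: zero_less_iff_neq_zero)
    define d where "d = I epowr (- (1 / p))"
    have dp: "d epowr p * I = 1"
      using epowr_add_finite[OF I0 Ifin, of "-1" 1] p by (simp add: d_def epowr_epowr)
    have dm: "d epowr m * I = I epowr ((p - m) / p)"
    proof -
      have "d epowr m * I = I epowr (- (m / p)) * I epowr 1" by (simp add: d_def epowr_epowr)
      also have "\<dots> = I epowr (- (m / p) + 1)" by (rule epowr_add_finite[OF I0 Ifin, symmetric])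
      also have "- (m / p) + 1 = (p - m) / p" using ex(7) by simp
      finally show ?thesis .
    qed
    define f where "f s = d * (\<Psi> (ereal s) epowr ?e * V (ereal s) epowr (?\<delta> - 1))" for s
    define h where "h = (\<lambda>s. (f s * ?\<sigma> s) * indicator (einterval a b) s)"
    have h: "h \<in> Mplus" unfolding h_def f_def by (intro Mplus_mult Mplus_const Mplus_indicator_einterval MV M\<Psi> \<sigma>)
    have hs: "h s = f s * ?\<sigma> s" if "a < ereal s" "ereal s < b" for s
      using that by (simp add: h_def einterval_iff)
    have "energy p v h a b \<le> d epowr p * I"
      unfolding I_def
    proof (rule ivl_int_le_const[OF ab(1) J])
      fix s assume s: "a < ereal s" "ereal s < b"
      have "?e * p = \<kappa>" "(?\<delta> - 1) * p = \<gamma> - 1" using m by (simp_all add: \<kappa>_def \<gamma>_def field_simps)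
      then have fp: "f s epowr p = d epowr p * (\<Psi> (ereal s) epowr \<kappa> * V (ereal s) epowr (\<gamma> - 1))"
        using p by (simp only: f_def epowr_mult epowr_epowr)
      have "h s epowr p * v s = f s epowr p * (?\<sigma> s epowr p * v s)"
        using p by (simp add: hs[OF s] epowr_mult mult.assoc)
      also have "\<dots> \<le> f s epowr p * ?\<sigma> s"
        by (intro mult_left_mono dual_weight_test p) auto
      also have "\<dots> = d epowr p * J s" by (simp only: fp J_def F_def mult.assoc)
      finally show "h s epowr p * v s \<le> d epowr p * J s" .
    qed
    then have E: "energy p v h a b \<le> 1" using dp by simp
    \<comment> \<open>To the right of \<open>x i\<close> the weight is at least G = 3^i A, so the
      tail of h at \<open>x i\<close> is at least a multiple of d G^(1/(p-m)) V^\<delta>. The m-th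
      power of the latter times G is d^m G^\<kappa> V^\<gamma>.\<close>
    have "d epowr m * (\<Sum>i<n. G i epowr \<kappa> * V (x i) epowr \<gamma>) \<le> C3 epowr m * (\<Sum>i<n. 3 ^ i * A * ivl_int (x i) b h epowr m)"
      unfolding sum_distrib_left
    proof (rule sum_mono)
      fix i assume "i \<in> {..<n}"
      then have i: "i < n" "i \<le> n" by auto
      define F' where "F' = (\<lambda>s. V (ereal s) epowr (?\<delta> - 1) * ?\<sigma> s)"
      have F': "F' \<in> Mplus" unfolding F'_def by (intro Mplus_mult MV \<sigma>)
      have "V (x i) epowr ?\<delta> \<le> C3 * ivl_int (x i) b F'"
        unfolding F'_def V_def using C3 \<sigma> bounds[OF i(2)] Vfin[OF i(2), unfolded V_def]
        by (auto simp: tail_lower_constant_def)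
      then have "(d * G i epowr ?e) * V (x i) epowr ?\<delta> \<le> C3 * ((d * G i epowr ?e) * ivl_int (x i) b F')"
        by (subst mult.left_commute) (intro mult_left_mono, auto)
      also have "(d * G i epowr ?e) * ivl_int (x i) b F' \<le> ivl_int (x i) b h"
      proof (rule ivl_int_ge_const[OF bounds(3)[OF i(2)] F'])
        fix s assume s: "x i < ereal s" "ereal s < b"
        have "G i epowr ?e \<le> \<Psi> (ereal s) epowr ?e"
          unfolding G_def \<Psi>_def using m s by (intro epowr_mono tripling_weight_lower[OF g ab(1) x] i) auto
        then show "(d * G i epowr ?e) * F' s \<le> h s"
          using hs[OF le_less_trans[OF bounds(1)[OF i(2)] s(1)] s(2)] unfolding f_def F'_def
          by (simp add: mult.assoc mult_left_mono mult_right_mono)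
      qed
      finally have "((d * G i epowr ?e) * V (x i) epowr ?\<delta>) epowr m \<le> (C3 * ivl_int (x i) b h) epowr m"
        using m by (intro epowr_mono) (auto simp: mult_left_mono)
      then have "G i * ((d * G i epowr ?e) * V (x i) epowr ?\<delta>) epowr m \<le> G i * (C3 epowr m * ivl_int (x i) b h epowr m)"
        using m by (intro mult_left_mono) (auto simp: epowr_mult)
      moreover have "G i * ((d * G i epowr ?e) * V (x i) epowr ?\<delta>) epowr m = d epowr m * (G i epowr \<kappa> * V (x i) epowr \<gamma>)"
      proof -
        have "?e * m + 1 = \<kappa>" "?\<delta> * m = \<gamma>" using m by (simp_all add: \<kappa>_def \<gamma>_def field_simps)
        moreover from this have "G i epowr \<kappa> = G i epowr (?e * m) * G i"
          using epowr_add[of "?e * m" 1 "G i"] m by simp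
        ultimately show ?thesis using m by (simp only: epowr_mult epowr_epowr less_imp_le) (simp add: mult_ac)
      qed
      ultimately show "d epowr m * (G i epowr \<kappa> * V (x i) epowr \<gamma>) \<le> C3 epowr m * (3 ^ i * A * ivl_int (x i) b h epowr m)"
        by (simp add: G_def mult_ac)
    qed
    also have "(\<Sum>i<n. 3 ^ i * A * ivl_int (x i) b h epowr m) \<le> 2 * Hardy_form a b A g m h"
      by (rule Hardy_form_ge_blocks[OF g ab(1) x h m(1) A])
    finally have L: "d epowr m * (\<Sum>i<n. G i epowr \<kappa> * V (x i) epowr \<gamma>) \<le> C3 epowr m * (2 * Hardy_form a b A g m h)"
      by (simp add: mult_left_mono)
    have "I epowr ((p - m) / p) \<le> d epowr m * ((3 epowr \<kappa> * C2) * (\<Sum>i<n. G i epowr \<kappa> * V (x i) epowr \<gamma>))"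
      unfolding dm[symmetric] by (intro mult_left_mono IG) auto
    also have "\<dots> \<le> (3 epowr \<kappa> * C2) * (C3 epowr m * (2 * Hardy_form a b A g m h))"
      by (subst mult.left_commute) (intro mult_left_mono L, auto)
    finally have "I epowr ((p - m) / p) \<le> 3 epowr \<kappa> * C2 * C3 epowr m * 2 * Hardy_form a b A g m h"
      by (simp only: mult.assoc)
    then show ?thesis
      using h E unfolding I_eq \<kappa>_def[symmetric] by (intro bexI[of _ h]) (auto simp: h_def)
  qed
qed

section \<open>Discretizing sequences\<close>

locale discretization =
  fixes c m q :: real and u w :: "real \<Rightarrow> ennreal" and t :: "int \<Rightarrow> ereal"
  assumes c: "0 < c" and m: "0 < m" and q: "0 < q"
    and u: "u \<in> Mplus" and w: "w \<in> Mplus"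
    and adm: "admissible m q u w" and disc: "discretizing c m q u w t"
begin

abbreviation "KK \<equiv> index_set m q u w"
abbreviation "\<phi> \<equiv> phi m q u w"
abbreviation "W \<equiv> \<lambda>x. ivl_int 0 x w"
abbreviation "\<alpha> \<equiv> q / m"
abbreviation "\<theta> \<equiv> 2 powr (q / m + 1) :: real"

lemma \<alpha>: "0 < \<alpha>" and m\<alpha>: "m * \<alpha> = q" and \<alpha>_inv: "q * (1 / \<alpha>) = m"
  using m q by auto

lemma \<theta>: "2 < \<theta>"
  using powr_less_mono[of 1 "\<alpha> + 1" 2] \<alpha> by simp

lemma KK_down: "k \<in> KK \<Longrightarrow> j \<le> k \<Longrightarrow> j \<in> KK"
  by (auto simp: index_set_def split: if_splits)

lemma below: "k \<in> index_set_below m q u w \<Longrightarrow> 0 < t (k - 1) \<and> t (k - 1) \<le> t k \<and> t k < \<infinity>"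
  using disc by (auto simp: discretizing_def Let_def)

text \<open>The index 0 in the case K = 0 lies outside \<open>index_set_below\<close>. There the
  condition for k = -1 supplies \<open>t (- 1)\<close>, and \<open>t 0\<close> is infinite.\<close>

lemma t_pos: "k \<in> KK \<Longrightarrow> 0 < t (k - 1)" and t_fin: "k \<in> KK \<Longrightarrow> t (k - 1) < \<infinity>"
  and t_mono1: "k \<in> KK \<Longrightarrow> t (k - 1) \<le> t k"
proof -
  have "0 < t (k - 1) \<and> t (k - 1) < \<infinity> \<and> t (k - 1) \<le> t k" if "k \<in> KK"
  proof (cases "k \<in> index_set_below m q u w")
    case True
    then show ?thesis using below[of k] by (auto intro: le_less_trans)
  next
    case False
    then have "\<phi> \<infinity> < \<infinity>" "k = 0"
      using that by (auto simp: index_set_def index_set_below_def split: if_splits)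
    then have "t 0 = \<infinity>" "- 1 \<in> index_set_below m q u w"
      using disc by (auto simp: discretizing_def Let_def index_set_below_def)
    then show ?thesis using below[of "-1"] \<open>k = 0\<close> by (auto intro: less_le_trans)
  qed
  then show "k \<in> KK \<Longrightarrow> 0 < t (k - 1)" "k \<in> KK \<Longrightarrow> t (k - 1) < \<infinity>" "k \<in> KK \<Longrightarrow> t (k - 1) \<le> t k" by auto
qed

lemma t_pos': "k \<in> KK \<Longrightarrow> 0 < t k"
  using t_pos[of k] t_mono1[of k] by (auto intro: less_le_trans)

lemma t_mono: "k \<in> KK \<Longrightarrow> j \<le> k \<Longrightarrow> t j \<le> t k"
proof -
  have "t (k - int i) \<le> t k" if "k \<in> KK" for i
  proof (induction i)
    case (Suc i)
    have "t (k - int i - 1) \<le> t (k - int i)"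
      using that by (intro t_mono1 KK_down[OF that]) auto
    then show ?case using Suc by (simp add: algebra_simps)
  qed simp
  from this[of "nat (k - j)"] show "k \<in> KK \<Longrightarrow> j \<le> k \<Longrightarrow> t j \<le> t k" by simp
qed

lemma phi_q: "\<phi> x epowr q = ivl_int 0 x (\<lambda>s. ivl_int (ereal s) x u epowr \<alpha> * w s)"
  using q by (simp add: phi_def)

lemma phi_mono: "x \<le> y \<Longrightarrow> \<phi> x \<le> \<phi> y"
proof -
  assume xy: "x \<le> y"
  have "ivl_int 0 x (\<lambda>s. ivl_int (ereal s) x u epowr \<alpha> * w s) \<le> ivl_int 0 x (\<lambda>s. ivl_int (ereal s) y u epowr \<alpha> * w s)"
    using xy \<alpha> by (intro ivl_int_mono mult_right_mono epowr_mono ivl_int_subset) auto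
  also have "\<dots> \<le> ivl_int 0 y (\<lambda>s. ivl_int (ereal s) y u epowr \<alpha> * w s)"
    using xy by (intro ivl_int_subset) auto
  finally have "\<phi> x epowr q \<le> \<phi> y epowr q" unfolding phi_q .
  then show ?thesis using q by simp
qed

lemma phi_pos: "0 < x \<Longrightarrow> 0 < \<phi> x"
proof -
  assume "0 < x"
  then obtain r where r: "0 < ereal r" "ereal r < x" using ereal_dense2 by blast
  then have "0 < \<phi> (ereal r)" using adm by (simp add: admissible_def)
  also have "\<dots> \<le> \<phi> x" using r by (intro phi_mono) auto
  finally show ?thesis .
qed

lemma phi_fin: "0 < x \<Longrightarrow> x < \<infinity> \<Longrightarrow> \<phi> x < top"
  using adm by (cases x) (auto simp: admissible_def)

lemma phi_fin_t: "k \<in> KK \<Longrightarrow> \<phi> (t k) < top"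
proof (cases "\<phi> \<infinity> < \<infinity>")
  case True
  then show ?thesis using phi_mono[of "t k" \<infinity>] by (auto intro: le_less_trans)
next
  case False
  assume "k \<in> KK"
  then have "k \<in> index_set_below m q u w" using False by (simp add: index_set_below_def)
  then show ?thesis using t_pos'[OF \<open>k \<in> KK\<close>] below by (intro phi_fin) auto
qed

lemma phi_fin_le: "k \<in> KK \<Longrightarrow> x \<le> t k \<Longrightarrow> \<phi> x < top"
  using phi_mono phi_fin_t le_less_trans by blast

lemma W_le: "k \<in> KK \<Longrightarrow> W (t k) \<le> ennreal (\<theta> / (\<theta> - 1)) * ivl_int (t (k - 1)) (t k) w"
  and W_grow: "k \<in> KK \<Longrightarrow> ennreal \<theta> * W (t (k - 1)) \<le> W (t k)"
  and phi_grow: "k \<in> KK \<Longrightarrow> ennreal \<theta> * \<phi> (t (k - 1)) epowr q \<le> \<phi> (t k) epowr q"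
  using disc by (auto simp: discretizing_def Let_def Delta_int_def)

lemma W_or_phi:
  assumes "k \<in> KK"
  shows "W (t k) = ennreal \<theta> * W (t (k - 1)) \<or> \<phi> (t k) epowr q = ennreal \<theta> * \<phi> (t (k - 1)) epowr q"
proof -
  obtain K1 K2 where "KK = K1 \<union> K2"
    "\<forall>k\<in>K1. W (t k) = ennreal \<theta> * W (t (k - 1))"
    "\<forall>k\<in>K2. \<phi> (t k) epowr q = ennreal \<theta> * \<phi> (t (k - 1)) epowr q"
    using disc unfolding discretizing_def Let_def by blast
  then show ?thesis using assms by blast
qed

lemma phi_le:
  assumes "k \<in> KK" "t (k - 1) \<le> x" "x \<le> t k"
  shows "\<phi> x epowr q \<le> ennreal c *
    (ivl_int (t (k - 3)) (t (k - 2)) w * ivl_int (t (k - 2)) (t (k - 1)) u epowr \<alpha>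
     + ivl_int (t (k - 2)) (t (k - 1)) (\<lambda>s. w s * ivl_int (ereal s) (t (k - 1)) u epowr \<alpha>)
     + ivl_int (t (k - 2)) (t (k - 1)) w * ivl_int (t (k - 1)) x u epowr \<alpha>)"
proof -
  have "\<forall>k\<in>KK. \<forall>x\<in>Delta t (k - 1).
          \<phi> x epowr q \<le> ennreal c *
            (Delta_int t (k - 3) w * (Delta_int t (k - 2) u) epowr (q / m)
             + Delta_int t (k - 2) (\<lambda>s. w s * (ivl_int (ereal s) (t (k - 1)) u) epowr (q / m))
             + Delta_int t (k - 2) w * (ivl_int (t (k - 1)) x u) epowr (q / m))"
    using disc unfolding discretizing_def Let_def by blast
  then have "\<phi> x epowr q \<le> ennreal c *
            (Delta_int t (k - 3) w * (Delta_int t (k - 2) u) epowr (q / m)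
             + Delta_int t (k - 2) (\<lambda>s. w s * (ivl_int (ereal s) (t (k - 1)) u) epowr (q / m))
             + Delta_int t (k - 2) w * (ivl_int (t (k - 1)) x u) epowr (q / m))"
    using assms by (simp add: Delta_def)
  moreover have "k - 3 + 1 = k - 2" "k - 2 + 1 = k - 1" by simp_all
  ultimately show ?thesis by (simp only: Delta_int_def)
qed

text \<open>Only the part of the integral in \<open>\<phi>\<close> with s below y is kept, and the
  integral of u is shortened to [y, x].\<close>

lemma W_U_le_phi: "0 \<le> y \<Longrightarrow> y \<le> x \<Longrightarrow> W y * ivl_int y x u epowr \<alpha> \<le> \<phi> x epowr q"
proof -
  assume "0 \<le> y" "y \<le> x"
  have "W y * ivl_int y x u epowr \<alpha> = ivl_int y x u epowr \<alpha> * W y" by (rule mult.commute)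
  also have "\<dots> \<le> ivl_int 0 y (\<lambda>s. ivl_int (ereal s) x u epowr \<alpha> * w s)"
    using \<alpha> \<open>y \<le> x\<close> by (intro ivl_int_ge_const w mult_right_mono epowr_mono ivl_int_subset) auto
  also have "\<dots> \<le> \<phi> x epowr q"
    unfolding phi_q using \<open>y \<le> x\<close> by (intro ivl_int_subset) auto
  finally show ?thesis .
qed

text \<open>The first two terms of the last condition are bounded by an integral over
  [\<open>t (k - 3)\<close>, \<open>t (k - 1)\<close>] that is part of \<open>\<phi>\<close>^q at
  \<open>t (k - 1)\<close>; in the third one the integral of w over one interval is bounded by W.
  This is the source of the function Psi.\<close>

lemma phi_le_local:
  assumes k: "k \<in> KK" "t (k - 1) \<le> x" "x \<le> t k"
  shows "\<phi> x epowr q \<le> ennreal c * (\<phi> (t (k - 1)) epowr q + W (t (k - 1)) * ivl_int (t (k - 1)) x u epowr \<alpha>)"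
proof -
  have k1: "k - 1 \<in> KK" and k2: "k - 2 \<in> KK" using KK_down[OF k(1)] by auto
  have ord: "0 \<le> t (k - 3)" "t (k - 3) \<le> t (k - 2)" "t (k - 2) \<le> t (k - 1)"
    using t_pos[OF k2] t_mono1[OF k1] t_mono1[OF k2] by auto
  define f where "f = (\<lambda>s. ivl_int (ereal s) (t (k - 1)) u epowr \<alpha> * w s)"
  have f: "f \<in> Mplus" unfolding f_def by (intro Mplus_intros Mplus_tail w)
  have 1: "ivl_int (t (k - 3)) (t (k - 2)) w * ivl_int (t (k - 2)) (t (k - 1)) u epowr \<alpha>
      \<le> ivl_int (t (k - 3)) (t (k - 2)) f"
    unfolding f_def mult.commute[of "ivl_int (t (k - 3)) (t (k - 2)) w"]
    using \<alpha> ord by (intro ivl_int_ge_const w mult_right_mono epowr_mono ivl_int_subset) auto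
  have 2: "ivl_int (t (k - 2)) (t (k - 1)) (\<lambda>s. w s * ivl_int (ereal s) (t (k - 1)) u epowr \<alpha>)
      = ivl_int (t (k - 2)) (t (k - 1)) f"
    unfolding f_def by (intro ivl_int_cong mult.commute)
  have 3: "ivl_int (t (k - 3)) (t (k - 2)) f + ivl_int (t (k - 2)) (t (k - 1)) f
      = ivl_int (t (k - 3)) (t (k - 1)) f"
    by (rule ivl_int_split[OF f ord, symmetric])
  have 4: "ivl_int (t (k - 3)) (t (k - 1)) f \<le> \<phi> (t (k - 1)) epowr q"
    unfolding phi_q f_def using ord by (intro ivl_int_subset) auto
  have "ivl_int (t (k - 3)) (t (k - 2)) w * ivl_int (t (k - 2)) (t (k - 1)) u epowr \<alpha>
     + ivl_int (t (k - 2)) (t (k - 1)) (\<lambda>s. w s * ivl_int (ereal s) (t (k - 1)) u epowr \<alpha>) \<le> \<phi> (t (k - 1)) epowr q"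
    unfolding 2 by (rule order_trans[OF add_right_mono[OF 1] 4[folded 3]])
  moreover have "ivl_int (t (k - 2)) (t (k - 1)) w * ivl_int (t (k - 1)) x u epowr \<alpha>
      \<le> W (t (k - 1)) * ivl_int (t (k - 1)) x u epowr \<alpha>"
    using ord by (intro mult_right_mono ivl_int_subset) auto
  ultimately show ?thesis
    by (intro order_trans[OF phi_le[OF k]] mult_left_mono add_mono) auto
qed

lemma W_U_fin: "k \<in> KK \<Longrightarrow> W (t (k - 1)) * ivl_int (t (k - 1)) (t k) u epowr \<alpha> < top"
  using le_less_trans[OF W_U_le_phi[of "t (k - 1)" "t k"], of top] t_pos[of k] t_mono1[of k] phi_fin_t[of k] q
  by (simp add: less_imp_le)

section \<open>The sequence exhausts the half-line\<close>

lemma phi_grow_power: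
  assumes k: "k \<in> KK"
  shows "ennreal \<theta> ^ n * \<phi> (t (k - int n)) epowr q \<le> \<phi> (t k) epowr q"
proof (induction n)
  case (Suc n)
  have "k - int n \<in> KK" using KK_down[OF k] by simp
  then have "ennreal \<theta> * \<phi> (t (k - int (Suc n))) epowr q \<le> \<phi> (t (k - int n)) epowr q"
    using phi_grow[of "k - int n"] by (simp add: algebra_simps)
  then have "ennreal \<theta> ^ n * (ennreal \<theta> * \<phi> (t (k - int (Suc n))) epowr q) \<le> ennreal \<theta> ^ n * \<phi> (t (k - int n)) epowr q"
    by (intro mult_left_mono) auto
  also have "\<dots> \<le> \<phi> (t k) epowr q" by (rule Suc)
  finally show ?case by (simp add: mult_ac)
qed simp

lemma power_\<theta>_unbounded:
  assumes "0 < e" "B < top"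
  obtains n where "B < ennreal \<theta> ^ n * e"
proof (cases e rule: ennreal_cases3)
  case (2 r)
  obtain b where b: "B = ennreal b" "0 \<le> b" using assms(2) by (cases B) auto
  obtain n where "b / r < \<theta> ^ n" using real_arch_pow[of \<theta> "b / r"] \<theta> by auto
  then have "B < ennreal \<theta> ^ n * e"
    using 2 b \<theta> by (simp add: ennreal_power ennreal_mult[symmetric] pos_divide_less_eq ennreal_less_iff)
  then show ?thesis by (rule that)
qed (use assms that[of 0] in auto)

text \<open>The definition does not demand that the points approach 0. It follows since
  \<open>\<phi>\<close>^q decays geometrically along \<open>t (k - int n)\<close> but is positive at
  x.\<close>

lemma t_small:
  assumes k: "k \<in> KK" and x: "0 < x"
  obtains n where "t (k - int n) < x"
proof -
  have "0 < \<phi> x epowr q" using phi_pos[OF x] q by auto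
  then obtain n where n: "\<phi> (t k) epowr q < ennreal \<theta> ^ n * \<phi> x epowr q"
    using power_\<theta>_unbounded phi_fin_t[OF k] q by (metis epowr_less_top_iff)
  have "t (k - int n) < x"
  proof (rule ccontr)
    assume "\<not> t (k - int n) < x"
    then have "\<phi> x epowr q \<le> \<phi> (t (k - int n)) epowr q"
      using q by (intro epowr_mono phi_mono) auto
    then have "ennreal \<theta> ^ n * \<phi> x epowr q \<le> \<phi> (t k) epowr q"
      using phi_grow_power[OF k, of n] by (meson mult_left_mono order_trans zero_le)
    then show False using n by simp
  qed
  then show ?thesis by (rule that)
qed

lemma t_INF: "k \<in> KK \<Longrightarrow> (INF n. t (k - int n)) = 0"
proof (rule antisym)
  assume k: "k \<in> KK"
  show "0 \<le> (INF n. t (k - int n))"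
    using t_pos'[OF KK_down[OF k]] by (intro INF_greatest) (auto intro: less_imp_le)
  show "(INF n. t (k - int n)) \<le> 0"
  proof (rule dense_ge)
    fix x :: ereal assume "0 < x"
    then obtain n where "t (k - int n) < x" using t_small[OF k] by blast
    then show "(INF n. t (k - int n)) \<le> x" by (intro INF_lower2[of n]) auto
  qed
qed

text \<open>Dual to the behaviour at 0: \<open>\<phi>\<close>^q grows geometrically along the
  sequence but is finite at every real point.\<close>

lemma t_SUP: "KK = UNIV \<Longrightarrow> (SUP n. t (int n)) = \<infinity>"
proof -
  assume K: "KK = UNIV"
  have "\<exists>n. ereal x < t (int n)" for x
  proof -
    define y where "y = max x 1"
    have y1: "0 < y" by (simp add: y_def)
    have "0 < \<phi> (t 0) epowr q" using phi_pos[OF t_pos'[of 0]] K q by auto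
    moreover have "\<phi> (ereal y) epowr q < top" using phi_fin[of "ereal y"] y1 q by simp
    ultimately obtain n where n: "\<phi> (ereal y) epowr q < ennreal \<theta> ^ n * \<phi> (t 0) epowr q"
      using power_\<theta>_unbounded by metis
    have "ereal y < t (int n)"
    proof (rule ccontr)
      assume "\<not> ereal y < t (int n)"
      then have "\<phi> (t (int n)) epowr q \<le> \<phi> (ereal y) epowr q"
        using q by (intro epowr_mono phi_mono) auto
      then show False using phi_grow_power[of "int n" n] K n by simp
    qed
    moreover have "ereal x \<le> ereal y" by (simp add: y_def)
    ultimately show ?thesis using le_less_trans by blast
  qed
  then have "ereal x \<le> (SUP n. t (int n))" for x
    by (meson SUP_upper2 UNIV_I less_imp_le)
  then show ?thesis using ereal_top by blast
qed

lemma KK_cases: "KK = UNIV \<or> (KK = {..0} \<and> t 0 = \<infinity>)"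
  using disc by (auto simp: index_set_def discretizing_def Let_def)

end

section \<open>The numerator and the sum of the local terms\<close>

lemma ereal_less_real_pos: "0 \<le> a \<Longrightarrow> a < ereal x \<Longrightarrow> 0 < x"
  by (cases a) auto

lemma ivl_int_truncate_right:
  "0 \<le> s \<Longrightarrow> b \<le> b' \<Longrightarrow> ivl_int s b' (\<lambda>x. h x * indicator (einterval 0 b) x) = ivl_int s b h"
proof -
  assume "0 \<le> s" "b \<le> b'"
  have "ivl_int s b' (\<lambda>x. h x * indicator (einterval 0 b) x) = ivl_int s b' (\<lambda>x. h x * indicator (einterval s b) x)"
    using \<open>0 \<le> s\<close> by (intro ivl_int_cong) (auto simp: einterval_iff dest: ereal_less_real_pos split: split_indicator)
  then show ?thesis using \<open>b \<le> b'\<close> by (simp add: ivl_int_indicator)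
qed

context discretization
begin

definition inner_int :: "(real \<Rightarrow> ennreal) \<Rightarrow> ereal \<Rightarrow> ennreal"
  where "inner_int h x = ivl_int x \<infinity> (\<lambda>s. ivl_int (ereal s) \<infinity> h epowr m * u s)"

definition num_q :: "(real \<Rightarrow> ennreal) \<Rightarrow> ennreal"
  where "num_q h = ivl_int 0 \<infinity> (\<lambda>x. inner_int h (ereal x) epowr \<alpha> * w x)"

definition local_term :: "(real \<Rightarrow> ennreal) \<Rightarrow> int \<Rightarrow> ennreal"
  where "local_term h k = \<phi> (t (k - 1)) epowr q * ivl_int (t (k - 1)) (t k) h epowr q
    + W (t (k - 1)) * ivl_int (t (k - 1)) (t k) (\<lambda>s. ivl_int (ereal s) (t k) h epowr m * u s) epowr \<alpha>"

text \<open>Neither this constant nor the next one mentions u, w or t, so outside the locale they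
  depend on c, m, q and the given Hardy constants alone. The factor 2 counts how often an interval
  is used in \<open>sum_local_term_le\<close>.\<close>

definition lower_const :: ennreal
  where "lower_const = 2 * (ennreal c + ennreal (\<theta> / (\<theta> - 1)))"

definition upper_const :: "ennreal \<Rightarrow> ennreal \<Rightarrow> ennreal"
  where "upper_const CW CP = 2 epowr \<alpha> * ((ennreal \<theta> + 1) * ((1 + CW * (2 epowr m) epowr \<alpha> * 2 epowr \<alpha>) * CP + CW * (2 epowr m) epowr \<alpha> * 2 epowr \<alpha>))"

lemma lower_const: "0 < lower_const" "lower_const < top"
  using c by (auto simp: lower_const_def ennreal_mult_less_top ennreal_zero_less_mult_iff add_pos_nonneg)

lemma upper_const: "Hardy_constant \<theta> \<alpha> CW \<Longrightarrow> Hardy_constant \<theta> q CP \<Longrightarrow> upper_const CW CP < top"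
  using \<alpha> m by (simp add: upper_const_def Hardy_constant_def ennreal_mult_less_top)

lemma numerator_eq: "numerator m q u w h = num_q h epowr (1 / q)"
  by (simp add: numerator_def num_q_def inner_int_def)

lemma Mplus_Hu: "(\<lambda>s. ivl_int (ereal s) b h epowr m * u s) \<in> Mplus"
  by (intro Mplus_mult Mplus_epowr Mplus_tail u)

lemma Mplus_Yw: "(\<lambda>x. inner_int h (ereal x) epowr \<alpha> * w x) \<in> Mplus"
  unfolding inner_int_def by (intro Mplus_mult Mplus_epowr Mplus_tail w)

lemma sum_disjoint_le:
  assumes f: "f \<in> Mplus" and F: "finite F" "\<And>k. k \<in> F \<Longrightarrow> k \<in> KK"
  shows "(\<Sum>k\<in>F. ivl_int (t (k - 1)) (t k) f) \<le> ivl_int 0 \<infinity> f"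
proof -
  have "(\<Sum>k\<in>F. ivl_int (t (k - 1)) (t k) f)
      = (\<Sum>k\<in>F. ivl_int 0 \<infinity> (\<lambda>x. f x * indicator (einterval (t (k - 1)) (t k)) x))"
    using F t_pos by (intro sum.cong refl ivl_int_indicator[symmetric]) (auto intro: less_imp_le)
  also have "\<dots> = ivl_int 0 \<infinity> (\<lambda>x. \<Sum>k\<in>F. f x * indicator (einterval (t (k - 1)) (t k)) x)"
    using F by (intro ivl_int_sum[symmetric] Mplus_intros f) auto
  also have "\<dots> \<le> ivl_int 0 \<infinity> f"
  proof (rule ivl_int_mono)
    fix x :: real
    show "(\<Sum>k\<in>F. f x * indicator (einterval (t (k - 1)) (t k)) x) \<le> f x"
    proof (cases "\<exists>k\<in>F. x \<in> einterval (t (k - 1)) (t k)")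
      case True
      then obtain k where k: "k \<in> F" "x \<in> einterval (t (k - 1)) (t k)" by blast
      have "(\<Sum>j\<in>F. f x * indicator (einterval (t (j - 1)) (t j)) x) = (\<Sum>j\<in>F. if j = k then f x else 0)"
      proof (intro sum.cong refl)
        fix j assume j: "j \<in> F"
        have "x \<notin> einterval (t (j - 1)) (t j)" if "j \<noteq> k"
        proof (cases "j < k")
          case True
          then have "t j \<le> t (k - 1)" using F(2)[OF k(1)] KK_down[of k "k - 1"] by (intro t_mono) auto
          then show ?thesis using k(2) by (auto simp: einterval_iff)
        next
          case False
          then have "t k \<le> t (j - 1)" using F(2)[OF j] KK_down[of j "j - 1"] that by (intro t_mono) auto
          then show ?thesis using k(2) by (auto simp: einterval_iff)
        qed
        then show "f x * indicator (einterval (t (j - 1)) (t j)) x = (if j = k then f x else 0)"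
          using k(2) by auto
      qed
      then show ?thesis using F(1) k(1) by (simp add: sum.delta)
    next
      case False
      then have "(\<Sum>k\<in>F. f x * indicator (einterval (t (k - 1)) (t k)) x) = 0"
        by (intro sum.neutral) auto
      then show ?thesis by simp
    qed
  qed
  finally show ?thesis .
qed

text \<open>For the first summand, the last condition at x = \<open>t (k - 1)\<close>, where its
  third term vanishes, bounds \<open>\<phi>\<close>^q by integrals over the two preceding intervals.
  On these \<open>inner_int\<close> is at least H^m times the integral of u up to
  \<open>t (k - 1)\<close>, where H is the integral of h from \<open>t (k - 1)\<close> on. For the
  second summand, W is bounded by the integral of w over the preceding interval, where
  \<open>inner_int\<close> is at least its value at \<open>t (k - 1)\<close>.\<close>

lemma local_term_le:
  assumes k: "k \<in> KK"
  shows "local_term h k \<le> (ennreal c + ennreal (\<theta> / (\<theta> - 1))) *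
    (ivl_int (t (k - 3)) (t (k - 2)) (\<lambda>x. inner_int h (ereal x) epowr \<alpha> * w x)
     + ivl_int (t (k - 2)) (t (k - 1)) (\<lambda>x. inner_int h (ereal x) epowr \<alpha> * w x))"
    (is "_ \<le> (ennreal c + ?d) * (?N3 + ?N2)")
proof -
  have k1: "k - 1 \<in> KK" and k2: "k - 2 \<in> KK" using KK_down[OF k] by auto
  have ord: "0 \<le> t (k - 3)" "t (k - 3) \<le> t (k - 2)" "t (k - 2) \<le> t (k - 1)" "0 \<le> t (k - 2)" "t (k - 1) \<le> t k"
    using t_pos[OF k2] t_mono1[OF k1] t_mono1[OF k2] t_pos[OF k1] t_mono1[OF k] by auto
  let ?H = "ivl_int (t (k - 1)) \<infinity> h"
  have inner: "?H epowr m * ivl_int y (t (k - 1)) u \<le> inner_int h y" if "0 \<le> y" for y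
  proof -
    have "?H epowr m * ivl_int y (t (k - 1)) u \<le> ivl_int y (t (k - 1)) (\<lambda>s. ivl_int (ereal s) \<infinity> h epowr m * u s)"
      using that m by (intro ivl_int_ge_const u mult_right_mono epowr_mono ivl_int_subset) auto
    also have "\<dots> \<le> inner_int h y"
      unfolding inner_int_def by (intro ivl_int_subset) auto
    finally show ?thesis .
  qed
  have inner_q: "?H epowr q * ivl_int y (t (k - 1)) u epowr \<alpha> \<le> inner_int h y epowr \<alpha>" if "0 \<le> y" for y
    using epowr_mono[OF _ inner[OF that], of \<alpha>] \<alpha> m\<alpha> by (simp add: epowr_mult epowr_epowr)
  have "\<phi> (t (k - 1)) epowr q * ivl_int (t (k - 1)) (t k) h epowr q \<le> \<phi> (t (k - 1)) epowr q * ?H epowr q"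
    using q by (intro mult_left_mono epowr_mono ivl_int_subset) auto
  also have "\<dots> \<le> ennreal c * (ivl_int (t (k - 3)) (t (k - 2)) w * ivl_int (t (k - 2)) (t (k - 1)) u epowr \<alpha>
     + ivl_int (t (k - 2)) (t (k - 1)) (\<lambda>s. w s * ivl_int (ereal s) (t (k - 1)) u epowr \<alpha>)) * ?H epowr q"
    using phi_le[OF k order_refl ord(5)] \<alpha> by (intro mult_right_mono) auto
  also have "\<dots> = ennreal c * (?H epowr q * (ivl_int (t (k - 2)) (t (k - 1)) u epowr \<alpha> * ivl_int (t (k - 3)) (t (k - 2)) w)
     + ?H epowr q * ivl_int (t (k - 2)) (t (k - 1)) (\<lambda>s. w s * ivl_int (ereal s) (t (k - 1)) u epowr \<alpha>))"
    by (simp only: distrib_left distrib_right mult_ac)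
  also have "\<dots> \<le> ennreal c * (?N3 + ?N2)"
  proof (intro mult_left_mono add_mono)
    have "?H epowr q * ivl_int (t (k - 2)) (t (k - 1)) u epowr \<alpha> \<le> inner_int h (ereal x) epowr \<alpha>"
      if "t (k - 3) < ereal x" "ereal x < t (k - 2)" for x
    proof -
      have "?H epowr q * ivl_int (t (k - 2)) (t (k - 1)) u epowr \<alpha> \<le> ?H epowr q * ivl_int (ereal x) (t (k - 1)) u epowr \<alpha>"
        using \<alpha> that by (intro mult_left_mono epowr_mono ivl_int_subset) auto
      also have "\<dots> \<le> inner_int h (ereal x) epowr \<alpha>"
        using ereal_less_real_pos[OF ord(1) that(1)] by (intro inner_q) auto
      finally show ?thesis .
    qed
    then have "(?H epowr q * ivl_int (t (k - 2)) (t (k - 1)) u epowr \<alpha>) * ivl_int (t (k - 3)) (t (k - 2)) w \<le> ?N3"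
      using ord by (intro ivl_int_ge_const w mult_right_mono) auto
    then show "?H epowr q * (ivl_int (t (k - 2)) (t (k - 1)) u epowr \<alpha> * ivl_int (t (k - 3)) (t (k - 2)) w) \<le> ?N3"
      by (simp only: mult.assoc)
    show "?H epowr q * ivl_int (t (k - 2)) (t (k - 1)) (\<lambda>s. w s * ivl_int (ereal s) (t (k - 1)) u epowr \<alpha>) \<le> ?N2"
    proof (rule ivl_int_ge_const)
      show "0 \<le> t (k - 2)" by (rule ord)
      show "(\<lambda>s. w s * ivl_int (ereal s) (t (k - 1)) u epowr \<alpha>) \<in> Mplus"
        by (intro Mplus_mult Mplus_epowr Mplus_tail w)
      fix x assume "t (k - 2) < ereal x" "ereal x < t (k - 1)"
      then have "w x * (?H epowr q * ivl_int (ereal x) (t (k - 1)) u epowr \<alpha>) \<le> w x * inner_int h (ereal x) epowr \<alpha>"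
        using ereal_less_real_pos[OF ord(4)] by (intro mult_left_mono inner_q) (auto intro: less_imp_le)
      then show "?H epowr q * (w x * ivl_int (ereal x) (t (k - 1)) u epowr \<alpha>) \<le> inner_int h (ereal x) epowr \<alpha> * w x"
        by (simp only: mult_ac)
    qed
  qed simp
  finally have 1: "\<phi> (t (k - 1)) epowr q * ivl_int (t (k - 1)) (t k) h epowr q \<le> ennreal c * (?N3 + ?N2)" .
  let ?L = "ivl_int (t (k - 1)) (t k) (\<lambda>s. ivl_int (ereal s) (t k) h epowr m * u s)"
  have L: "?L \<le> inner_int h (t (k - 1))"
  proof -
    have "?L \<le> ivl_int (t (k - 1)) (t k) (\<lambda>s. ivl_int (ereal s) \<infinity> h epowr m * u s)"
      using m by (intro ivl_int_mono mult_right_mono epowr_mono ivl_int_subset) auto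
    also have "\<dots> \<le> inner_int h (t (k - 1))"
      unfolding inner_int_def by (intro ivl_int_subset) auto
    finally show ?thesis .
  qed
  have "W (t (k - 1)) * ?L epowr \<alpha> \<le> ?d * ivl_int (t (k - 2)) (t (k - 1)) w * inner_int h (t (k - 1)) epowr \<alpha>"
    using W_le[OF k1] L \<alpha> by (intro mult_mono epowr_mono) auto
  also have "\<dots> = ?d * (inner_int h (t (k - 1)) epowr \<alpha> * ivl_int (t (k - 2)) (t (k - 1)) w)"
    by (simp only: mult_ac)
  also have "\<dots> \<le> ?d * ?N2"
    unfolding inner_int_def using \<alpha> ord
    by (intro mult_left_mono ivl_int_ge_const w mult_right_mono epowr_mono ivl_int_subset) auto
  also have "\<dots> \<le> ?d * (?N3 + ?N2)" by (intro mult_left_mono) auto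
  finally have 2: "W (t (k - 1)) * ?L epowr \<alpha> \<le> ?d * (?N3 + ?N2)" .
  show ?thesis
    using add_mono[OF 1 2] unfolding local_term_def by (simp only: distrib_right)
qed

lemma sum_local_term_le:
  assumes F: "finite F" "F \<subseteq> KK"
  shows "(\<Sum>k\<in>F. local_term h k) \<le> lower_const * num_q h"
proof -
  let ?f = "\<lambda>x. inner_int h (ereal x) epowr \<alpha> * w x"
  have shift: "(\<Sum>k\<in>F. ivl_int (t (k - i - 1)) (t (k - i)) ?f) \<le> num_q h" if "0 \<le> i" for i
  proof -
    have "(\<Sum>k\<in>F. ivl_int (t (k - i - 1)) (t (k - i)) ?f) = (\<Sum>k\<in>(\<lambda>k. k - i) ` F. ivl_int (t (k - 1)) (t k) ?f)"
      by (subst sum.reindex) (auto simp: inj_on_def)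
    also have "\<dots> \<le> num_q h"
      unfolding num_q_def
    proof (intro sum_disjoint_le Mplus_Yw)
      fix k assume "k \<in> (\<lambda>k. k - i) ` F"
      then obtain k' where "k' \<in> KK" "k = k' - i" using F by auto
      then show "k \<in> KK" using KK_down[of k' k] that by simp
    qed (use F in simp)
    finally show ?thesis .
  qed
  have "(\<Sum>k\<in>F. local_term h k) \<le> (\<Sum>k\<in>F. (ennreal c + ennreal (\<theta> / (\<theta> - 1))) *
    (ivl_int (t (k - 2 - 1)) (t (k - 2)) ?f + ivl_int (t (k - 1 - 1)) (t (k - 1)) ?f))"
    using local_term_le F by (intro sum_mono) auto
  also have "\<dots> = (ennreal c + ennreal (\<theta> / (\<theta> - 1))) *
    ((\<Sum>k\<in>F. ivl_int (t (k - 2 - 1)) (t (k - 2)) ?f) + (\<Sum>k\<in>F. ivl_int (t (k - 1 - 1)) (t (k - 1)) ?f))"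
    by (simp only: sum_distrib_left sum.distrib distrib_left)
  also have "\<dots> \<le> (ennreal c + ennreal (\<theta> / (\<theta> - 1))) * (num_q h + num_q h)"
    by (intro mult_left_mono add_mono shift) auto
  also have "\<dots> = lower_const * num_q h"
    by (simp only: lower_const_def mult_2 mult_2_right distrib_left distrib_right add_ac)
  finally show ?thesis .
qed

text \<open>There are finitely many intervals, and h vanishes beyond the last one. This makes the
  tails X and y vanish at the index n, as the discrete Hardy inequality demands;
  \<open>num_q_le\<close> removes both restrictions.\<close>

lemma window_upper:
  assumes CW: "Hardy_constant \<theta> \<alpha> CW" and CP: "Hardy_constant \<theta> q CP"
    and last: "l + int n \<in> KK" and h: "h \<in> Mplus" and supp: "ivl_int (t (l + int n)) \<infinity> h = 0"
  shows "ivl_int (t l) (t (l + int n)) (\<lambda>x. inner_int h (ereal x) epowr \<alpha> * w x)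
    \<le> upper_const CW CP * (\<Sum>j<n. local_term h (l + int (Suc j)))"
proof (cases n)
  case 0
  then show ?thesis by simp
next
  case (Suc n')
  \<comment> \<open>Block j runs from \<open>\<tau> j\<close> to \<open>\<tau> (Suc j)\<close>. It
    belongs to the local term with index l + Suc j, whose weights sit at the left end
    \<open>\<tau> j\<close>.\<close>
  define \<tau> where "\<tau> j = t (l + int j)" for j
  have inK: "l + int j \<in> KK" if "j \<le> n" for j using KK_down[OF last] that by auto
  have \<tau>_mono: "\<tau> j \<le> \<tau> (Suc j)" if "j < n" for j
    unfolding \<tau>_def using inK[of "Suc j"] that by (intro t_mono) auto
  have \<tau>0: "0 < \<tau> j" if "j \<le> n" for j unfolding \<tau>_def using inK[OF that] by (rule t_pos')
  have \<tau>_end: "\<tau> j \<le> \<tau> n" if "j \<le> n" for j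
    unfolding \<tau>_def using that by (intro t_mono last) auto
  have pred: "l + int (Suc j) - 1 = l + int j" for j by simp
  define X where "X j = ivl_int (\<tau> j) \<infinity> h" for j
  define y where "y j = inner_int h (\<tau> j)" for j
  define H where "H s = ivl_int (ereal s) \<infinity> h epowr m * u s" for s
  have H: "H \<in> Mplus" unfolding H_def by (rule Mplus_Hu)
  have y_eq: "y j = ivl_int (\<tau> j) \<infinity> H" for j unfolding y_def inner_int_def H_def ..
  define P where "P j = \<phi> (\<tau> j) epowr q" for j
  define Wj where "Wj j = W (\<tau> j)" for j
  define hj where "hj j = ivl_int (\<tau> j) (\<tau> (Suc j)) h" for j
  define aj where "aj j = ivl_int (\<tau> j) (\<tau> (Suc j)) H" for j
  define bj where "bj j = ivl_int (\<tau> j) (\<tau> (Suc j)) (\<lambda>s. ivl_int (ereal s) (\<tau> (Suc j)) h epowr m * u s)" for j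
  define Uj where "Uj j = ivl_int (\<tau> j) (\<tau> (Suc j)) u" for j
  have Xn: "X n = 0" using supp by (simp add: X_def \<tau>_def)
  have yn: "y n = 0"
  proof -
    have "y n \<le> ivl_int (\<tau> n) \<infinity> (\<lambda>_. 0)"
      unfolding y_eq
    proof (rule ivl_int_mono)
      fix s assume "\<tau> n < ereal s"
      then have "ivl_int (ereal s) \<infinity> h \<le> ivl_int (\<tau> n) \<infinity> h" by (intro ivl_int_subset) auto
      then have "ivl_int (ereal s) \<infinity> h = 0" using Xn by (simp add: X_def)
      then show "H s \<le> 0" using m by (simp add: H_def)
    qed
    then show ?thesis by simp
  qed
  have X_rec: "X j = hj j + X (Suc j)" if "j < n" for j
    unfolding X_def hj_def using \<tau>0[of j] \<tau>_mono[OF that] that by (intro ivl_int_split h) auto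
  have y_rec: "y j = aj j + y (Suc j)" if "j < n" for j
    unfolding y_eq aj_def using \<tau>0[of j] \<tau>_mono[OF that] that by (intro ivl_int_split H) auto
  have growP: "ennreal \<theta> * P j \<le> P (Suc j)" and growW: "ennreal \<theta> * Wj j \<le> Wj (Suc j)" if "Suc j \<le> n" for j
    using phi_grow[OF inK[OF that]] W_grow[OF inK[OF that]] unfolding pred P_def Wj_def \<tau>_def by auto
  have K12: "Wj (Suc j) = ennreal \<theta> * Wj j \<or> P (Suc j) = ennreal \<theta> * P j" if "Suc j \<le> n" for j
    using W_or_phi[OF inK[OF that]] unfolding pred P_def Wj_def \<tau>_def .
  define SP where "SP = (\<Sum>j<n. P j * X j epowr q)"
  define SW where "SW = (\<Sum>j<n. Wj j * y j epowr \<alpha>)"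
  define Ph where "Ph = (\<Sum>j<n. P j * hj j epowr q)"
  define Wb where "Wb = (\<Sum>j<n. Wj j * bj j epowr \<alpha>)"
  have shift: "(\<Sum>j<n. f (Suc j)) \<le> (\<Sum>j<n. f j)" if "f n = 0" for f :: "nat \<Rightarrow> ennreal"
  proof -
    have "(\<Sum>j<n. f (Suc j)) \<le> (\<Sum>j<Suc n. f j)" by (subst sum.lessThan_Suc_shift) simp
    then show ?thesis using that by simp
  qed
  have block: "ivl_int (\<tau> j) (\<tau> (Suc j)) (\<lambda>x. inner_int h (ereal x) epowr \<alpha> * w x)
      \<le> 2 epowr \<alpha> * (ennreal \<theta> * (P j * X j epowr q + Wj j * y j epowr \<alpha>) + Wj (Suc j) * y (Suc j) epowr \<alpha>)"
    if j: "j < n" for j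
  proof -
    define Z where "Z x = ivl_int (ereal x) (\<tau> (Suc j)) H" for x
    have Zw: "(\<lambda>x. Z x epowr \<alpha> * w x) \<in> Mplus"
      unfolding Z_def by (intro Mplus_mult Mplus_epowr Mplus_tail w)
    have \<tau>j0: "0 \<le> \<tau> j" using \<tau>0[of j] j by auto
    have "ivl_int (\<tau> j) (\<tau> (Suc j)) (\<lambda>x. inner_int h (ereal x) epowr \<alpha> * w x)
      \<le> 2 epowr \<alpha> * ivl_int (\<tau> j) (\<tau> (Suc j)) (\<lambda>x. Z x epowr \<alpha> * w x + y (Suc j) epowr \<alpha> * w x)"
    proof (intro ivl_int_le_const \<tau>j0 Mplus_add Zw Mplus_mult Mplus_const w)
      fix x assume x: "\<tau> j < ereal x" "ereal x < \<tau> (Suc j)"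
      have "inner_int h (ereal x) = Z x + y (Suc j)"
        unfolding y_eq Z_def inner_int_def H_def[symmetric] using x ereal_less_real_pos[OF \<tau>j0 x(1)] by (intro ivl_int_split H) auto
      then have "inner_int h (ereal x) epowr \<alpha> \<le> 2 epowr \<alpha> * (Z x epowr \<alpha> + y (Suc j) epowr \<alpha>)"
        using add_epowr_le[OF \<alpha>] by simp
      from mult_right_mono[OF this, of "w x"]
      show "inner_int h (ereal x) epowr \<alpha> * w x \<le> 2 epowr \<alpha> * (Z x epowr \<alpha> * w x + y (Suc j) epowr \<alpha> * w x)"
        by (simp only: mult.assoc distrib_right zero_le)
    qed
    also have "ivl_int (\<tau> j) (\<tau> (Suc j)) (\<lambda>x. Z x epowr \<alpha> * w x + y (Suc j) epowr \<alpha> * w x)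
        = ivl_int (\<tau> j) (\<tau> (Suc j)) (\<lambda>x. Z x epowr \<alpha> * w x) + y (Suc j) epowr \<alpha> * ivl_int (\<tau> j) (\<tau> (Suc j)) w"
      by (simp only: ivl_int_add[OF Zw Mplus_mult[OF Mplus_const w] \<tau>j0] ivl_int_cmult[OF w \<tau>j0])
    also have "2 epowr \<alpha> * \<dots> \<le> 2 epowr \<alpha> * (ennreal \<theta> * (P j * X j epowr q + Wj j * y j epowr \<alpha>) + Wj (Suc j) * y (Suc j) epowr \<alpha>)"
    proof (intro mult_left_mono add_mono)
      have wW: "ivl_int (\<tau> j) (\<tau> (Suc j)) w \<le> Wj (Suc j)"
        unfolding Wj_def using \<tau>j0 by (intro ivl_int_subset) auto
      then show "y (Suc j) epowr \<alpha> * ivl_int (\<tau> j) (\<tau> (Suc j)) w \<le> Wj (Suc j) * y (Suc j) epowr \<alpha>"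
        unfolding mult.commute[of "Wj (Suc j)"] by (intro mult_left_mono) auto
      show "ivl_int (\<tau> j) (\<tau> (Suc j)) (\<lambda>x. Z x epowr \<alpha> * w x) \<le> ennreal \<theta> * (P j * X j epowr q + Wj j * y j epowr \<alpha>)"
      \<comment> \<open>Either W or \<open>\<phi>\<close>^q grows by exactly \<theta> on the block.
        In the first case Z is estimated by \<open>y j\<close> and the integral of w by W at the
        right end; in the second, Z is estimated by (\<open>X j\<close>)^m times an integral of u,
        and what remains is part of \<open>\<phi>\<close>^q at the right end. Both times the exact
        growth moves the weight to the left end.\<close>
      proof (cases "Wj (Suc j) = ennreal \<theta> * Wj j")
        case True
        have "ivl_int (\<tau> j) (\<tau> (Suc j)) (\<lambda>x. Z x epowr \<alpha> * w x) \<le> y j epowr \<alpha> * ivl_int (\<tau> j) (\<tau> (Suc j)) w"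
          unfolding Z_def y_eq using \<alpha> \<tau>j0
          by (intro ivl_int_le_const w mult_right_mono epowr_mono ivl_int_subset) auto
        also have "\<dots> \<le> y j epowr \<alpha> * (ennreal \<theta> * Wj j)"
          using wW True by (intro mult_left_mono) auto
        also have "\<dots> = ennreal \<theta> * (Wj j * y j epowr \<alpha>)" by (simp only: mult_ac)
        also have "\<dots> \<le> ennreal \<theta> * (P j * X j epowr q + Wj j * y j epowr \<alpha>)"
          by (intro mult_left_mono) auto
        finally show ?thesis .
      next
        case False
        then have PP: "P (Suc j) = ennreal \<theta> * P j" using K12[of j] j by auto
        define f where "f = (\<lambda>x. ivl_int (ereal x) (\<tau> (Suc j)) u epowr \<alpha> * w x)"
        have f: "f \<in> Mplus" unfolding f_def by (intro Mplus_mult Mplus_epowr Mplus_tail w)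
        have "ivl_int (\<tau> j) (\<tau> (Suc j)) (\<lambda>x. Z x epowr \<alpha> * w x) \<le> X j epowr q * ivl_int (\<tau> j) (\<tau> (Suc j)) f"
        proof (rule ivl_int_le_const[OF \<tau>j0 f])
          fix x assume x: "\<tau> j < ereal x" "ereal x < \<tau> (Suc j)"
          have "Z x \<le> X j epowr m * ivl_int (ereal x) (\<tau> (Suc j)) u"
            unfolding Z_def H_def X_def using x m ereal_less_real_pos[OF \<tau>j0 x(1)]
            by (intro ivl_int_le_const u mult_right_mono epowr_mono ivl_int_subset)
              (auto intro: order_trans[OF less_imp_le[OF x(1)]])
          then have "Z x epowr \<alpha> \<le> (X j epowr m * ivl_int (ereal x) (\<tau> (Suc j)) u) epowr \<alpha>"
            using \<alpha> by (intro epowr_mono) auto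
          also have "\<dots> = X j epowr q * ivl_int (ereal x) (\<tau> (Suc j)) u epowr \<alpha>"
            using \<alpha> m\<alpha> by (simp add: epowr_mult epowr_epowr)
          finally show "Z x epowr \<alpha> * w x \<le> X j epowr q * f x"
            unfolding f_def mult.assoc[symmetric] by (intro mult_right_mono) auto
        qed
        also have "\<dots> \<le> X j epowr q * P (Suc j)"
          unfolding P_def phi_q f_def using \<tau>j0 by (intro mult_left_mono ivl_int_subset) auto
        also have "\<dots> = ennreal \<theta> * (P j * X j epowr q)" unfolding PP by (simp only: mult_ac)
        also have "\<dots> \<le> ennreal \<theta> * (P j * X j epowr q + Wj j * y j epowr \<alpha>)"
          by (intro mult_left_mono) auto
        finally show ?thesis .
      qed
    qed auto
    finally show ?thesis .
  qed
  have "ivl_int (\<tau> 0) (\<tau> n) (\<lambda>x. inner_int h (ereal x) epowr \<alpha> * w x)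
      = (\<Sum>j=0..<n. ivl_int (\<tau> j) (\<tau> (Suc j)) (\<lambda>x. inner_int h (ereal x) epowr \<alpha> * w x))"
    using less_imp_le[OF \<tau>0[of 0]] by (intro ivl_int_blocks(1)[of _ \<tau> 0 n, OF Mplus_Yw] \<tau>_mono) simp_all
  also have "\<dots> \<le> (\<Sum>j<n. 2 epowr \<alpha> * (ennreal \<theta> * (P j * X j epowr q + Wj j * y j epowr \<alpha>) + Wj (Suc j) * y (Suc j) epowr \<alpha>))"
    unfolding atLeast0LessThan by (intro sum_mono block) auto
  also have "\<dots> = 2 epowr \<alpha> * (ennreal \<theta> * (SP + SW) + (\<Sum>j<n. Wj (Suc j) * y (Suc j) epowr \<alpha>))"
    by (simp only: SP_def SW_def sum_distrib_left sum.distrib distrib_left)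
  finally have J1: "ivl_int (\<tau> 0) (\<tau> n) (\<lambda>x. inner_int h (ereal x) epowr \<alpha> * w x)
      \<le> 2 epowr \<alpha> * (ennreal \<theta> * (SP + SW) + (\<Sum>j<n. Wj (Suc j) * y (Suc j) epowr \<alpha>))" .
  have "(\<Sum>j<n. Wj (Suc j) * y (Suc j) epowr \<alpha>) \<le> SW"
    unfolding SW_def by (rule shift) (simp only: yn epowr_0_left[OF \<alpha>] mult_zero_right)
  also have "SW \<le> SP + SW" by (rule add_increasing) auto
  finally have "ennreal \<theta> * (SP + SW) + (\<Sum>j<n. Wj (Suc j) * y (Suc j) epowr \<alpha>) \<le> (ennreal \<theta> + 1) * (SP + SW)"
    unfolding distrib_right[of _ 1] mult_1 by (rule add_left_mono)
  then have J: "ivl_int (\<tau> 0) (\<tau> n) (\<lambda>x. inner_int h (ereal x) epowr \<alpha> * w x)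
      \<le> 2 epowr \<alpha> * ((ennreal \<theta> + 1) * (SP + SW))"
    by (intro order_trans[OF J1] mult_left_mono) auto
  have SP: "SP \<le> CP * Ph"
    unfolding SP_def Ph_def using X_rec Xn growP by (intro Hardy_constantD[OF CP]) auto
  \<comment> \<open>After the discrete Hardy inequality \<open>aj j\<close> still contains the tail
    of h beyond the block. Splitting it off leaves the local \<open>bj j\<close> and a power of
    \<open>X (Suc j)\<close> times the integral of u. By \<open>W_U_le_phi\<close> the latter goes
    into the sum \<open>SP\<close>, which has been localized already.\<close>
  have "SW \<le> CW * (\<Sum>j<n. Wj j * aj j epowr \<alpha>)"
    unfolding SW_def using y_rec yn growW by (intro Hardy_constantD[OF CW]) auto
  also have "(\<Sum>j<n. Wj j * aj j epowr \<alpha>) \<le> (\<Sum>j<n. ((2 epowr m) epowr \<alpha> * 2 epowr \<alpha>) * (Wj j * bj j epowr \<alpha> + P (Suc j) * X (Suc j) epowr q))"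
  proof (rule sum_mono)
    fix j assume "j \<in> {..<n}"
    then have j: "j < n" by simp
    have \<tau>j0: "0 \<le> \<tau> j" using \<tau>0[of j] j by auto
    let ?B = "\<lambda>s. ivl_int (ereal s) (\<tau> (Suc j)) h epowr m * u s"
    have "aj j \<le> 2 epowr m * ivl_int (\<tau> j) (\<tau> (Suc j)) (\<lambda>s. ?B s + X (Suc j) epowr m * u s)"
      unfolding aj_def
    proof (intro ivl_int_le_const \<tau>j0 Mplus_add Mplus_Hu Mplus_mult Mplus_const u)
      fix s assume s: "\<tau> j < ereal s" "ereal s < \<tau> (Suc j)"
      have "ivl_int (ereal s) \<infinity> h = ivl_int (ereal s) (\<tau> (Suc j)) h + X (Suc j)"
        unfolding X_def using s ereal_less_real_pos[OF \<tau>j0 s(1)] by (intro ivl_int_split h) auto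
      then have "ivl_int (ereal s) \<infinity> h epowr m \<le> 2 epowr m * (ivl_int (ereal s) (\<tau> (Suc j)) h epowr m + X (Suc j) epowr m)"
        using add_epowr_le[OF m] by simp
      from mult_right_mono[OF this, of "u s"]
      show "H s \<le> 2 epowr m * (?B s + X (Suc j) epowr m * u s)"
        unfolding H_def by (simp only: mult.assoc distrib_right zero_le)
    qed
    also have "ivl_int (\<tau> j) (\<tau> (Suc j)) (\<lambda>s. ?B s + X (Suc j) epowr m * u s) = bj j + X (Suc j) epowr m * Uj j"
      unfolding bj_def Uj_def
      by (simp only: ivl_int_add[OF Mplus_Hu Mplus_mult[OF Mplus_const u] \<tau>j0] ivl_int_cmult[OF u \<tau>j0])
    finally have "aj j epowr \<alpha> \<le> (2 epowr m * (bj j + X (Suc j) epowr m * Uj j)) epowr \<alpha>"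
      using \<alpha> by (intro epowr_mono) auto
    also have "\<dots> = (2 epowr m) epowr \<alpha> * (bj j + X (Suc j) epowr m * Uj j) epowr \<alpha>"
      using \<alpha> by (intro epowr_mult) auto
    also have "\<dots> \<le> (2 epowr m) epowr \<alpha> * (2 epowr \<alpha> * (bj j epowr \<alpha> + (X (Suc j) epowr m * Uj j) epowr \<alpha>))"
      by (intro mult_left_mono add_epowr_le \<alpha>) auto
    also have "(X (Suc j) epowr m * Uj j) epowr \<alpha> = X (Suc j) epowr q * Uj j epowr \<alpha>"
      using \<alpha> m\<alpha> by (simp add: epowr_mult epowr_epowr)
    finally have "Wj j * aj j epowr \<alpha> \<le> Wj j * ((2 epowr m) epowr \<alpha> * (2 epowr \<alpha> * (bj j epowr \<alpha> + X (Suc j) epowr q * Uj j epowr \<alpha>)))"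
      by (intro mult_left_mono) auto
    also have "\<dots> = ((2 epowr m) epowr \<alpha> * 2 epowr \<alpha>) * (Wj j * bj j epowr \<alpha> + (Wj j * Uj j epowr \<alpha>) * X (Suc j) epowr q)"
      by (simp only: distrib_left mult_ac)
    also have "\<dots> \<le> ((2 epowr m) epowr \<alpha> * 2 epowr \<alpha>) * (Wj j * bj j epowr \<alpha> + P (Suc j) * X (Suc j) epowr q)"
      unfolding Wj_def Uj_def P_def using \<tau>j0 \<tau>_mono[OF j]
      by (intro mult_left_mono add_left_mono mult_right_mono W_U_le_phi) auto
    finally show "Wj j * aj j epowr \<alpha> \<le> ((2 epowr m) epowr \<alpha> * 2 epowr \<alpha>) * (Wj j * bj j epowr \<alpha> + P (Suc j) * X (Suc j) epowr q)" .
  qed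
  also have "\<dots> = ((2 epowr m) epowr \<alpha> * 2 epowr \<alpha>) * (Wb + (\<Sum>j<n. P (Suc j) * X (Suc j) epowr q))"
    by (simp only: Wb_def sum_distrib_left sum.distrib distrib_left)
  finally have SW1: "SW \<le> CW * ((2 epowr m) epowr \<alpha> * 2 epowr \<alpha> * (Wb + (\<Sum>j<n. P (Suc j) * X (Suc j) epowr q)))"
    by (simp add: mult_left_mono)
  have "(\<Sum>j<n. P (Suc j) * X (Suc j) epowr q) \<le> SP"
    unfolding SP_def by (rule shift) (simp only: Xn epowr_0_left[OF q] mult_zero_right)
  then have SW: "SW \<le> CW * ((2 epowr m) epowr \<alpha> * 2 epowr \<alpha> * (Wb + SP))"
    by (intro order_trans[OF SW1] mult_left_mono add_left_mono) auto
  define D where "D = CW * (2 epowr m) epowr \<alpha> * 2 epowr \<alpha>"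
  have "SP + SW \<le> SP + D * (Wb + SP)"
    using SW by (intro add_left_mono) (simp add: D_def mult.assoc)
  also have "\<dots> = (1 + D) * SP + D * Wb"
    by (simp only: distrib_left distrib_right mult_1 add_ac)
  also have "\<dots> \<le> (1 + D) * (CP * Ph) + D * Wb"
    by (intro add_right_mono mult_left_mono SP) auto
  also have "\<dots> \<le> ((1 + D) * CP + D) * (Ph + Wb)"
  proof -
    have "(1 + D) * CP * Ph + D * Wb \<le> ((1 + D) * CP + D) * Ph + ((1 + D) * CP + D) * Wb"
      by (intro add_mono mult_right_mono) auto
    then show ?thesis by (simp only: distrib_left mult.assoc)
  qed
  also have "Ph + Wb = (\<Sum>j<n. local_term h (l + int (Suc j)))"
    unfolding Ph_def Wb_def sum.distrib[symmetric] local_term_def P_def Wj_def hj_def bj_def pred \<tau>_def ..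
  finally have "SP + SW \<le> ((1 + D) * CP + D) * (\<Sum>j<n. local_term h (l + int (Suc j)))" .
  then have "2 epowr \<alpha> * ((ennreal \<theta> + 1) * (SP + SW))
      \<le> 2 epowr \<alpha> * ((ennreal \<theta> + 1) * (((1 + D) * CP + D) * (\<Sum>j<n. local_term h (l + int (Suc j)))))"
    by (intro mult_left_mono) auto
  from order_trans[OF J this] show ?thesis
    by (simp only: upper_const_def D_def \<tau>_def mult.assoc int_ops add_0_right)
qed

text \<open>Monotone convergence through the three nested integrals; it removes the support
  condition of \<open>window_upper\<close>.\<close>

lemma num_q_SUP:
  fixes b :: "nat \<Rightarrow> ereal"
  assumes h: "h \<in> Mplus" and b: "incseq b" "(SUP i. b i) = \<infinity>"
  shows "num_q h = (SUP i. num_q (\<lambda>x. h x * indicator (einterval 0 (b i)) x))"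
proof -
  define hh where "hh i = (\<lambda>x. h x * indicator (einterval 0 (b i)) x)" for i
  have hh: "hh i \<in> Mplus" for i unfolding hh_def by (intro Mplus_intros h)
  have inc: "hh i x \<le> hh j x" if "i \<le> j" for i j x
    using incseqD[OF b(1) that] unfolding hh_def
    by (auto simp: einterval_iff split: split_indicator)
  have H: "ivl_int (ereal s) \<infinity> h = (SUP i. ivl_int (ereal s) \<infinity> (hh i))" if "0 < s" for s
    using ivl_int_SUP_right[OF h _ b(1), of "ereal s"] that
    unfolding b(2) hh_def by (simp add: ivl_int_truncate_right)
  have Hinc: "ivl_int (ereal s) \<infinity> (hh i) epowr m * u s \<le> ivl_int (ereal s) \<infinity> (hh j) epowr m * u s" if "i \<le> j" for s i j
    using m inc[OF that] by (intro mult_right_mono epowr_mono ivl_int_mono) auto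
  have inner: "inner_int h (ereal x) = (SUP i. inner_int (hh i) (ereal x))" if "0 < x" for x
  proof -
    have "inner_int h (ereal x) = ivl_int (ereal x) \<infinity> (\<lambda>s. SUP i. ivl_int (ereal s) \<infinity> (hh i) epowr m * u s)"
      unfolding inner_int_def
    proof (rule ivl_int_cong)
      fix s assume "ereal x < ereal s"
      then have "0 < s" using that by simp
      show "ivl_int (ereal s) \<infinity> h epowr m * u s = (SUP i. ivl_int (ereal s) \<infinity> (hh i) epowr m * u s)"
        unfolding H[OF \<open>0 < s\<close>] epowr_SUP[OF m] by (rule SUP_mult_right_ennreal)
    qed
    also have "\<dots> = (SUP i. inner_int (hh i) (ereal x))"
      unfolding inner_int_def using that Hinc
      by (intro ivl_int_SUP Mplus_Hu) (auto simp: incseq_def)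
    finally show ?thesis .
  qed
  have "num_q h = ivl_int 0 \<infinity> (\<lambda>x. SUP i. inner_int (hh i) (ereal x) epowr \<alpha> * w x)"
    unfolding num_q_def
  proof (rule ivl_int_cong)
    fix x assume "0 < ereal x"
    then have "0 < x" by simp
    show "inner_int h (ereal x) epowr \<alpha> * w x = (SUP i. inner_int (hh i) (ereal x) epowr \<alpha> * w x)"
      unfolding inner[OF \<open>0 < x\<close>] epowr_SUP[OF \<alpha>] by (rule SUP_mult_right_ennreal)
  qed
  also have "\<dots> = (SUP i. num_q (hh i))"
    unfolding num_q_def
  proof (rule ivl_int_SUP[OF Mplus_Yw order_refl])
    fix x
    have "inner_int (hh i) (ereal x) \<le> inner_int (hh j) (ereal x)" if "i \<le> j" for i j
      unfolding inner_int_def using Hinc[OF that] by (rule ivl_int_mono)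
    then show "incseq (\<lambda>i. inner_int (hh i) (ereal x) epowr \<alpha> * w x)"
      using \<alpha> by (auto simp: incseq_def intro!: mult_right_mono epowr_mono)
  qed
  finally show ?thesis unfolding hh_def .
qed

lemma local_term_mono:
  assumes "\<And>x. t (k - 1) < ereal x \<Longrightarrow> ereal x < t k \<Longrightarrow> f x \<le> h x"
  shows "local_term f k \<le> local_term h k"
proof -
  have "f y \<le> h y" if "t (k - 1) < ereal x" "x < y" "ereal y < t k" for x y
    using assms[OF less_trans[of _ "ereal x"]] that by simp
  then show ?thesis
    unfolding local_term_def using assms q m \<alpha>
    by (intro add_mono mult_left_mono mult_right_mono epowr_mono ivl_int_mono) auto
qed

text \<open>h is cut off beyond \<open>t k\<close>, so that windows ending at k apply; their left
  ends tend to 0, and then the cut-off is removed. Bounding the finite sums by M avoids infinite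
  ones.\<close>

lemma num_q_le:
  assumes CW: "Hardy_constant \<theta> \<alpha> CW" and CP: "Hardy_constant \<theta> q CP" and h: "h \<in> Mplus"
    and M: "\<And>F. finite F \<Longrightarrow> F \<subseteq> KK \<Longrightarrow>
      upper_const CW CP * (\<Sum>k\<in>F. local_term h k) \<le> M"
  shows "num_q h \<le> M"
proof -
  have trunc: "num_q (\<lambda>x. h x * indicator (einterval 0 (t k)) x) \<le> M" if k: "k \<in> KK" for k
  proof -
    define hk where "hk = (\<lambda>x. h x * indicator (einterval 0 (t k)) x)"
    have hk: "hk \<in> Mplus" unfolding hk_def by (intro Mplus_intros h)
    have tk: "0 \<le> t k" using t_pos'[OF k] by simp
    have H0: "ivl_int s \<infinity> hk = 0" if "t k \<le> s" for s
      unfolding hk_def using that tk by (subst ivl_int_truncate_right) (auto intro: ivl_int_empty)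
    let ?f = "\<lambda>x. inner_int hk (ereal x) epowr \<alpha> * w x"
    have "ivl_int (t k) \<infinity> ?f = ivl_int (t k) \<infinity> (\<lambda>_. 0)"
    proof (rule ivl_int_cong)
      fix x assume x: "t k < ereal x"
      have "inner_int hk (ereal x) = ivl_int (ereal x) \<infinity> (\<lambda>_. 0)"
        unfolding inner_int_def
      proof (rule ivl_int_cong)
        fix s assume "ereal x < ereal s"
        then have "t k \<le> ereal s" using x by (meson less_imp_le order_trans)
        then show "ivl_int (ereal s) \<infinity> hk epowr m * u s = 0" using H0 m by simp
      qed
      then show "?f x = 0" using \<alpha> by simp
    qed
    then have "num_q hk = ivl_int 0 (t k) ?f"
      unfolding num_q_def using ivl_int_split[OF Mplus_Yw order_refl tk, of \<infinity> hk] by simp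
    also have "\<dots> = ivl_int (INF n. t (k - int n)) (t k) ?f" using t_INF[OF k] by simp
    also have "\<dots> = (SUP n. ivl_int (t (k - int n)) (t k) ?f)"
    proof (rule ivl_int_INF_left[OF Mplus_Yw])
      show "0 \<le> t (k - int n)" for n using t_pos'[OF KK_down[OF k]] by (simp add: less_imp_le)
      show "decseq (\<lambda>n. t (k - int n))"
        unfolding decseq_def using KK_down[OF k] by (intro allI impI t_mono) auto
    qed
    also have "\<dots> \<le> M"
    proof (rule SUP_least)
      fix n
      have "ivl_int (t (k - int n)) (t (k - int n + int n)) ?f \<le> upper_const CW CP * (\<Sum>j<n. local_term hk (k - int n + int (Suc j)))"
        using k hk H0[of "t k"] by (intro window_upper CW CP) auto
      also have "(\<Sum>j<n. local_term hk (k - int n + int (Suc j))) \<le> (\<Sum>j<n. local_term h (k - int n + int (Suc j)))"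
        by (intro sum_mono local_term_mono) (auto simp: hk_def split: split_indicator)
      also have "(\<Sum>j<n. local_term h (k - int n + int (Suc j))) = (\<Sum>k\<in>(\<lambda>j. k - int n + int (Suc j)) ` {..<n}. local_term h k)"
        by (subst sum.reindex) (auto simp: inj_on_def)
      also have "upper_const CW CP * \<dots> \<le> M"
        using KK_down[OF k] by (intro M) auto
      finally show "ivl_int (t (k - int n)) (t k) ?f \<le> M" by (simp add: mult_left_mono)
    qed
    finally show ?thesis unfolding hk_def .
  qed
  \<comment> \<open>If K = 0, the constant index 0 serves, because \<open>t 0\<close> is already
    infinite.\<close>
  obtain \<kappa> :: "nat \<Rightarrow> int" where \<kappa>: "\<And>i. \<kappa> i \<in> KK" "incseq (\<lambda>i. t (\<kappa> i))" "(SUP i. t (\<kappa> i)) = \<infinity>"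
  proof (cases "KK = UNIV")
    case True
    then show ?thesis using t_SUP by (intro that[of int]) (auto simp: incseq_def intro: t_mono)
  next
    case False
    then show ?thesis using KK_cases by (intro that[of "\<lambda>_. 0"]) (auto simp: incseq_def)
  qed
  show ?thesis
    unfolding num_q_SUP[OF h \<kappa>(2,3)] using trunc[OF \<kappa>(1)] by (rule SUP_least)
qed

section \<open>The local terms as Hardy forms on one interval\<close>

definition local_weight :: "int \<Rightarrow> real \<Rightarrow> ennreal"
  where "local_weight k = (\<lambda>s. W (t (k - 1)) epowr (1 / \<alpha>) * u s)"

definition local_primitive :: "int \<Rightarrow> ereal \<Rightarrow> ennreal"
  where "local_primitive k x = \<phi> (t (k - 1)) epowr m + ivl_int (t (k - 1)) x (local_weight k)"

definition local_form :: "int \<Rightarrow> (real \<Rightarrow> ennreal) \<Rightarrow> ennreal"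
  where "local_form k h = Hardy_form (t (k - 1)) (t k) (\<phi> (t (k - 1)) epowr m) (local_weight k) m h"

definition primitive_const :: ennreal
  where "primitive_const = (2 epowr \<alpha> * 2) epowr (1 / \<alpha>)"

definition phi_const :: ennreal
  where "phi_const = (ennreal c * 2) epowr (1 / \<alpha>)"

lemma primitive_const: "primitive_const < top" and phi_const: "0 < phi_const" "phi_const < top"
  using m q c by (simp_all add: primitive_const_def phi_const_def ennreal_mult_less_top ennreal_zero_less_mult_iff)

lemma Mplus_local_weight: "local_weight k \<in> Mplus"
  unfolding local_weight_def by (intro Mplus_mult Mplus_const u)

lemma local_form_eq:
  assumes "k \<in> KK"
  shows "local_form k h = \<phi> (t (k - 1)) epowr m * ivl_int (t (k - 1)) (t k) h epowr m
    + W (t (k - 1)) epowr (1 / \<alpha>) * ivl_int (t (k - 1)) (t k) (\<lambda>s. ivl_int (ereal s) (t k) h epowr m * u s)"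
proof -
  have "ivl_int (t (k - 1)) (t k) (\<lambda>s. ivl_int (ereal s) (t k) h epowr m * local_weight k s)
      = ivl_int (t (k - 1)) (t k) (\<lambda>s. W (t (k - 1)) epowr (1 / \<alpha>) * (ivl_int (ereal s) (t k) h epowr m * u s))"
    unfolding local_weight_def by (intro ivl_int_cong mult.left_commute)
  also have "\<dots> = W (t (k - 1)) epowr (1 / \<alpha>) * ivl_int (t (k - 1)) (t k) (\<lambda>s. ivl_int (ereal s) (t k) h epowr m * u s)"
    using t_pos[OF assms] by (intro ivl_int_cmult Mplus_Hu) auto
  finally show ?thesis unfolding local_form_def Hardy_form_def by simp
qed

text \<open>The exponent 1/\<alpha> of W in \<open>local_weight\<close> and the exponent m of
  \<open>\<phi>\<close> are chosen such that the two summands of \<open>local_term\<close> are the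
  \<alpha>-th powers of those of one Hardy form.\<close>

lemma local_form_powers:
  "(\<phi> (t (k - 1)) epowr m * X epowr m) epowr \<alpha> = \<phi> (t (k - 1)) epowr q * X epowr q"
  "(W (t (k - 1)) epowr (1 / \<alpha>) * Y) epowr \<alpha> = W (t (k - 1)) * Y epowr \<alpha>"
  using \<alpha> m\<alpha> m q by (simp_all add: epowr_mult epowr_epowr)

lemma local_term_le_form:
  assumes k: "k \<in> KK"
  shows "local_term h k \<le> 2 * local_form k h epowr \<alpha>"
  unfolding local_term_def local_form_powers[symmetric] mult_2
  using \<alpha> by (intro add_mono epowr_mono) (auto simp: local_form_eq[OF k])

lemma local_form_le_term:
  assumes k: "k \<in> KK"
  shows "local_form k h epowr \<alpha> \<le> 2 epowr \<alpha> * local_term h k"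
  unfolding local_term_def local_form_powers[symmetric] local_form_eq[OF k]
  by (rule add_epowr_le[OF \<alpha>])

lemma local_term_le_formI: "k \<in> KK \<Longrightarrow> local_form k h \<le> X \<Longrightarrow> local_term h k \<le> 2 * X epowr \<alpha>"
  using \<alpha> by (intro order_trans[OF local_term_le_form] mult_left_mono epowr_mono) auto

lemma local_primitive_weight:
  assumes k: "k \<in> KK"
  shows "ivl_int (t (k - 1)) x (local_weight k) epowr \<alpha> = W (t (k - 1)) * ivl_int (t (k - 1)) x u epowr \<alpha>"
proof -
  have "ivl_int (t (k - 1)) x (local_weight k) = W (t (k - 1)) epowr (1 / \<alpha>) * ivl_int (t (k - 1)) x u"
    unfolding local_weight_def using t_pos[OF k] by (intro ivl_int_cmult u) auto
  then show ?thesis by (simp only: local_form_powers)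
qed

text \<open>Both summands are controlled by \<open>\<phi>\<close> at x, through monotonicity and
  \<open>W_U_le_phi\<close>. The opposite bound in the next lemma rests on the last condition and is
  therefore confined to x up to \<open>t k\<close>.\<close>

lemma local_primitive_le:
  assumes k: "k \<in> KK" and x: "t (k - 1) \<le> x"
  shows "local_primitive k x \<le> primitive_const * \<phi> x epowr m"
proof -
  have "local_primitive k x epowr \<alpha> \<le> 2 epowr \<alpha> *
      ((\<phi> (t (k - 1)) epowr m) epowr \<alpha> + ivl_int (t (k - 1)) x (local_weight k) epowr \<alpha>)"
    unfolding local_primitive_def by (rule add_epowr_le[OF \<alpha>])
  also have "\<dots> \<le> 2 epowr \<alpha> * (\<phi> x epowr q + \<phi> x epowr q)"
    unfolding local_primitive_weight[OF k] epowr_epowr m\<alpha>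
    using x t_pos[OF k] q by (intro mult_left_mono add_mono epowr_mono phi_mono W_U_le_phi) auto
  also have "\<dots> = (2 epowr \<alpha> * 2) * \<phi> x epowr q" by (simp only: mult_2[symmetric] mult.assoc)
  finally have "local_primitive k x \<le> ((2 epowr \<alpha> * 2) * \<phi> x epowr q) epowr (1 / \<alpha>)"
    using epowr_le_swap[OF \<alpha>] by simp
  also have "\<dots> = (2 epowr \<alpha> * 2) epowr (1 / \<alpha>) * (\<phi> x epowr q) epowr (1 / \<alpha>)"
    using m q by (intro epowr_mult) auto
  also have "(\<phi> x epowr q) epowr (1 / \<alpha>) = \<phi> x epowr m" by (simp only: epowr_epowr \<alpha>_inv)
  finally show ?thesis unfolding primitive_const_def .
qed

lemma phi_le_local_primitive:
  assumes k: "k \<in> KK" and x: "t (k - 1) \<le> x" "x \<le> t k"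
  shows "\<phi> x epowr m \<le> phi_const * local_primitive k x"
proof -
  have "\<phi> x epowr q \<le> ennreal c * ((\<phi> (t (k - 1)) epowr m) epowr \<alpha> + ivl_int (t (k - 1)) x (local_weight k) epowr \<alpha>)"
    unfolding local_primitive_weight[OF k] epowr_epowr m\<alpha> by (rule phi_le_local[OF k x])
  also have "\<dots> \<le> ennreal c * (local_primitive k x epowr \<alpha> + local_primitive k x epowr \<alpha>)"
    unfolding local_primitive_def using \<alpha> by (intro mult_left_mono add_mono epowr_mono) auto
  also have "\<dots> = (ennreal c * 2) * local_primitive k x epowr \<alpha>" by (simp only: mult_2[symmetric] mult.assoc)
  finally have "(\<phi> x epowr q) epowr (1 / \<alpha>) \<le> ((ennreal c * 2) * local_primitive k x epowr \<alpha>) epowr (1 / \<alpha>)"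
    using m q by (intro epowr_mono) auto
  also have "\<dots> = (ennreal c * 2) epowr (1 / \<alpha>) * (local_primitive k x epowr \<alpha>) epowr (1 / \<alpha>)"
    using m q by (intro epowr_mult) auto
  also have "(local_primitive k x epowr \<alpha>) epowr (1 / \<alpha>) = local_primitive k x" using \<alpha> by (intro epowr_inverse) auto
  also have "(\<phi> x epowr q) epowr (1 / \<alpha>) = \<phi> x epowr m" by (simp only: epowr_epowr \<alpha>_inv)
  finally show ?thesis unfolding phi_const_def .
qed

lemma local_weight_fin: "k \<in> KK \<Longrightarrow> ivl_int (t (k - 1)) (t k) (local_weight k) < top"
  using W_U_fin[of k] epowr_less_top_iff[OF \<alpha>] by (metis local_primitive_weight)

lemma local_const: "k \<in> KK \<Longrightarrow> 0 < \<phi> (t (k - 1)) epowr m" "k \<in> KK \<Longrightarrow> \<phi> (t (k - 1)) epowr m < top"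
  using phi_pos[OF t_pos] phi_fin_t[OF KK_down, of k "k - 1"] m by auto

end

section \<open>From single intervals to the best constant\<close>

lemma quotient_le: "a \<le> C * b \<Longrightarrow> b \<noteq> top \<Longrightarrow> a / b \<le> (C :: ennreal)"
proof (cases "b = 0")
  case False
  assume "a \<le> C * b" "b \<noteq> top"
  then have "a / b \<le> C * b / b" by (intro divide_right_mono_ennreal)
  also have "\<dots> = C" using False \<open>b \<noteq> top\<close> by (intro mult_divide_eq_ennreal) auto
  finally show ?thesis .
qed simp

lemma le_quotient: "b \<le> 1 \<Longrightarrow> a \<le> a / (b :: ennreal)"
proof -
  assume "b \<le> 1"
  then have "1 \<le> inverse b"
    by (cases b rule: ennreal_cases3) (auto simp: inverse_ennreal one_le_inverse_iff top_unique)
  from mult_left_mono[OF this, of a] show ?thesis by (simp add: divide_ennreal_def)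
qed

locale weighted_discretization = discretization +
  fixes p :: real and v :: "real \<Rightarrow> ennreal"
  assumes p: "1 < p" and v: "v \<in> Mplus"
begin

abbreviation "local_energy k h \<equiv> energy p v h (t (k - 1)) (t k)"
abbreviation "opt \<equiv> best_const p q m u w v"

text \<open>The size of T as a multiplier from l^p to l^q: the supremum for p <= q, the l^r norm
  with 1/r = 1/q - 1/p for q < p. It lets (a) and (b), and likewise (c) and (d), be proved
  together.\<close>

definition outer_norm :: "(int \<Rightarrow> ennreal) \<Rightarrow> ennreal"
  where "outer_norm T = (if p \<le> q then SUP k\<in>KK. T k
    else (\<Sum>\<^sub>\<infinity>k\<in>KK. T k epowr (p * q / (p - q))) epowr ((p - q) / (p * q)))"

lemma sum_le_outer_norm:
  assumes "q < p" "finite F" "F \<subseteq> KK"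
  shows "(\<Sum>k\<in>F. T k epowr (p * q / (p - q))) epowr ((p - q) / (p * q)) \<le> outer_norm T"
  unfolding outer_norm_def nonneg_infsum_complete[OF zero_le]
  using p q assms by (auto intro!: epowr_mono SUP_upper)

lemma term_le_outer_norm: "k \<in> KK \<Longrightarrow> T k \<le> outer_norm T"
  using sum_le_outer_norm[of "{k}" T] p q
  by (cases "p \<le> q") (auto simp: epowr_epowr outer_norm_def intro: SUP_upper)

text \<open>The multiplier T acting from l^p to l^q, where the e k are p-th powers. For q < p this
  is Hoelder's inequality with the exponents (p - q)/p and q/p, at the price of the factor
  2.\<close>

lemma sum_mixed_le:
  assumes F: "finite F" "F \<subseteq> KK"
  shows "(\<Sum>k\<in>F. T k epowr q * e k epowr (q / p)) \<le> 2 * (outer_norm T epowr q * (\<Sum>k\<in>F. e k) epowr (q / p))"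
proof (cases "p \<le> q")
  case True
  have "(\<Sum>k\<in>F. T k epowr q * e k epowr (q / p)) \<le> (\<Sum>k\<in>F. outer_norm T epowr q * e k epowr (q / p))"
    using F q by (intro sum_mono mult_right_mono epowr_mono term_le_outer_norm) auto
  also have "\<dots> \<le> outer_norm T epowr q * (\<Sum>k\<in>F. e k) epowr (q / p)"
    unfolding sum_distrib_left[symmetric] using p True F by (intro mult_left_mono sum_epowr_le) auto
  also have "\<dots> \<le> 2 * (outer_norm T epowr q * (\<Sum>k\<in>F. e k) epowr (q / p))"
    by (simp add: mult_2)
  finally show ?thesis .
next
  case False
  let ?r = "p * q / (p - q)"
  have Tq: "X epowr q = (X epowr ?r) epowr ((p - q) / p)" for X
    using p q False by (simp add: epowr_epowr)
  have "(\<Sum>k\<in>F. T k epowr q * e k epowr (q / p))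
      \<le> 2 * ((\<Sum>k\<in>F. T k epowr ?r) epowr ((p - q) / p) * (\<Sum>k\<in>F. e k) epowr (q / p))"
    unfolding Tq[of "T _"] using p q False F by (intro sum_Hoelder) (auto simp: field_simps)
  also have "(\<Sum>k\<in>F. T k epowr ?r) epowr ((p - q) / p) = ((\<Sum>k\<in>F. T k epowr ?r) epowr ((p - q) / (p * q))) epowr q"
    using p q by (simp add: epowr_epowr)
  also have "2 * (\<dots> * (\<Sum>k\<in>F. e k) epowr (q / p)) \<le> 2 * (outer_norm T epowr q * (\<Sum>k\<in>F. e k) epowr (q / p))"
    using q False by (intro mult_left_mono mult_right_mono epowr_mono sum_le_outer_norm F) auto
  finally show ?thesis .
qed

lemma Mplus_energy: "h \<in> Mplus \<Longrightarrow> (\<lambda>x. h x epowr p * v x) \<in> Mplus"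
  by (intro Mplus_mult Mplus_epowr v)

lemma num_q_le_opt:
  assumes h: "h \<in> Mplus" and E: "energy p v h 0 \<infinity> \<le> 1"
  shows "num_q h \<le> opt epowr q"
proof -
  have "denominator p v h \<le> 1"
    using epowr_mono[OF _ E, of "1 / p"] p by (simp add: denominator_def)
  then have "numerator m q u w h \<le> numerator m q u w h / denominator p v h" by (rule le_quotient)
  also have "\<dots> \<le> opt" unfolding best_const_def by (rule SUP_upper[OF h])
  finally show ?thesis unfolding numerator_eq using epowr_le_swap[of "1 / q"] q by simp
qed

lemma opt_le:
  assumes "\<And>h. h \<in> Mplus \<Longrightarrow> energy p v h 0 \<infinity> < top
    \<Longrightarrow> num_q h \<le> M epowr q * energy p v h 0 \<infinity> epowr (q / p)"
  shows "opt \<le> M"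
  unfolding best_const_def
proof (rule SUP_least)
  fix h assume h: "h \<in> Mplus"
  let ?E = "energy p v h 0 \<infinity>"
  show "numerator m q u w h / denominator p v h \<le> M"
  proof (cases "?E < top")
    case True
    have "num_q h epowr (1 / q) \<le> (M epowr q * ?E epowr (q / p)) epowr (1 / q)"
      using q by (intro epowr_mono assms h True) auto
    also have "\<dots> = M * ?E epowr (1 / p)" using q by (simp add: epowr_mult epowr_epowr)
    finally show ?thesis
      unfolding numerator_eq denominator_def using True p
      by (intro quotient_le) (auto simp: less_top[symmetric])
  next
    case False
    \<comment> \<open>An infinite denominator makes the quotient 0.\<close>
    then show ?thesis using p by (simp add: denominator_def less_top[symmetric])
  qed
qed

lemma energy_support:
  assumes k: "k \<in> KK" and supp: "\<And>x. x \<notin> einterval (t (k - 1)) (t k) \<Longrightarrow> h x = 0"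
  shows "energy p v h 0 \<infinity> = local_energy k h"
proof -
  have "(\<lambda>x. h x epowr p * v x) = (\<lambda>x. (h x epowr p * v x) * indicator (einterval (t (k - 1)) (t k)) x)"
    using supp p by (auto simp: fun_eq_iff split: split_indicator)
  then have "energy p v h 0 \<infinity>
      = ivl_int 0 \<infinity> (\<lambda>x. (h x epowr p * v x) * indicator (einterval (t (k - 1)) (t k)) x)" by simp
  also have "\<dots> = local_energy k h"
    using t_pos[OF k] by (intro ivl_int_indicator) auto
  finally show ?thesis .
qed

lemma local_term_le_opt:
  assumes k: "k \<in> KK" and h: "h \<in> Mplus" "\<And>x. x \<notin> einterval (t (k - 1)) (t k) \<Longrightarrow> h x = 0"
    and E: "local_energy k h \<le> 1"
  shows "local_term h k \<le> lower_const * opt epowr q"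
proof -
  have "local_term h k \<le> lower_const * num_q h"
    using sum_local_term_le[of "{k}" h] k by simp
  also have "\<dots> \<le> lower_const * opt epowr q"
    using energy_support[OF k h(2)] E by (intro mult_left_mono num_q_le_opt h) auto
  finally show ?thesis .
qed

text \<open>Up to K, the best constant on one interval is at least B k, witnessed by test functions
  living there. Only values strictly below B k are asked for, because B k may be infinite and the
  test functions may come from a truncation.\<close>

definition attained :: "ennreal \<Rightarrow> (int \<Rightarrow> ennreal) \<Rightarrow> bool"
  where "attained K B \<longleftrightarrow> (\<forall>k\<in>KK. \<forall>\<beta><B k. \<exists>h\<in>Mplus.
    (\<forall>x. x \<notin> einterval (t (k - 1)) (t k) \<longrightarrow> h x = 0) \<and> local_energy k h \<le> 1 \<and> \<beta> epowr q \<le> K * local_term h k)"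

lemma attained_le_opt:
  assumes B: "attained K B" and k: "k \<in> KK"
  shows "B k \<le> (K * lower_const) epowr (1 / q) * opt"
proof (rule dense_le)
  fix \<beta> assume "\<beta> < B k"
  then obtain h where h: "h \<in> Mplus" "\<And>x. x \<notin> einterval (t (k - 1)) (t k) \<Longrightarrow> h x = 0"
    "local_energy k h \<le> 1" "\<beta> epowr q \<le> K * local_term h k"
    using B k unfolding attained_def by blast
  note h(4)
  also have "K * local_term h k \<le> K * (lower_const * opt epowr q)"
    by (intro mult_left_mono local_term_le_opt k h) auto
  finally have "\<beta> \<le> ((K * lower_const) * opt epowr q) epowr (1 / q)"
    using q by (simp add: epowr_le_swap mult.assoc)
  also have "\<dots> = (K * lower_const) epowr (1 / q) * opt"
    using q by (simp add: epowr_mult epowr_epowr)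
  finally show "\<beta> \<le> (K * lower_const) epowr (1 / q) * opt" .
qed

lemma local_term_cmult:
  assumes k: "k \<in> KK" and h: "h \<in> Mplus"
  shows "local_term (\<lambda>x. d * h x) k = d epowr q * local_term h k"
proof -
  have t0: "0 \<le> t (k - 1)" using t_pos[OF k] by simp
  have "ivl_int (t (k - 1)) (t k) (\<lambda>s. ivl_int (ereal s) (t k) (\<lambda>x. d * h x) epowr m * u s)
      = ivl_int (t (k - 1)) (t k) (\<lambda>s. d epowr m * (ivl_int (ereal s) (t k) h epowr m * u s))"
  proof (rule ivl_int_cong)
    fix s assume "t (k - 1) < ereal s"
    then have "0 < s" by (rule ereal_less_real_pos[OF t0])
    then show "ivl_int (ereal s) (t k) (\<lambda>x. d * h x) epowr m * u s = d epowr m * (ivl_int (ereal s) (t k) h epowr m * u s)"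
      using m by (simp add: ivl_int_cmult[OF h] epowr_mult mult.assoc)
  qed
  also have "\<dots> = d epowr m * ivl_int (t (k - 1)) (t k) (\<lambda>s. ivl_int (ereal s) (t k) h epowr m * u s)"
    by (rule ivl_int_cmult[OF Mplus_Hu t0])
  finally show ?thesis
    using \<alpha> m q m\<alpha> unfolding local_term_def ivl_int_cmult[OF h t0]
    by (simp add: epowr_mult epowr_epowr distrib_left mult_ac)
qed

lemma Delta_disjoint:
  assumes "k \<in> KK" "j \<in> KK" "x \<in> einterval (t (k - 1)) (t k)" "j \<noteq> k"
  shows "x \<notin> einterval (t (j - 1)) (t j)"
proof (cases "j < k")
  case True
  then have "t j \<le> t (k - 1)" using KK_down[OF assms(1)] by (intro t_mono) auto
  then show ?thesis using assms(3) by (auto simp: einterval_iff)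
next
  case False
  then have "t k \<le> t (j - 1)" using KK_down[OF assms(2)] assms(4) by (intro t_mono) auto
  then show ?thesis using assms(3) by (auto simp: einterval_iff)
qed

text \<open>Extremal functions of the individual intervals are combined with the coefficients that
  are extremal in Hoelder's inequality.\<close>

lemma combine_extremals:
  assumes qp: "q < p" and F: "finite F" "F \<subseteq> KK"
    and h: "\<And>k. k \<in> F \<Longrightarrow> h k \<in> Mplus"
      "\<And>k x. k \<in> F \<Longrightarrow> x \<notin> einterval (t (k - 1)) (t k) \<Longrightarrow> h k x = 0"
      "\<And>k. k \<in> F \<Longrightarrow> local_energy k (h k) \<le> 1"
    and b: "\<And>k. k \<in> F \<Longrightarrow> b k epowr q \<le> K * local_term (h k) k" "\<And>k. k \<in> F \<Longrightarrow> b k < top"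
  shows "(\<Sum>k\<in>F. b k epowr (p * q / (p - q))) epowr ((p - q) / (p * q)) \<le> (K * lower_const) epowr (1 / q) * opt"
proof -
  define r where "r = p * q / (p - q)"
  have r: "0 < r" using p q qp by (simp add: r_def)
  define S where "S = (\<Sum>k\<in>F. b k epowr r)"
  have Sfin: "S < top" using b(2) r F by (simp add: S_def)
  show ?thesis
  proof (cases "S = 0")
    case True
    then show ?thesis using p q qp by (simp add: S_def r_def)
  next
    case False
    then have S0: "0 < S" by (simp add: zero_less_iff_neq_zero)
    \<comment> \<open>The energies then sum to at most the sum of the d k^p = b k^r / S, which is 1,
      and q^2 / (p - q) + q = r makes d k^q b k^q a multiple of b k^r as well.\<close>
    define d where "d k = b k epowr (q / (p - q)) * S epowr (- (1 / p))" for k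
    have dp: "d k epowr p = b k epowr r * S epowr (- 1)" for k
      using p by (simp add: d_def epowr_mult epowr_epowr r_def mult.commute)
    have SS: "S * S epowr (- 1) = 1" using epowr_add_finite[OF S0 Sfin, of 1 "-1"] by simp
    have dq: "d k epowr q * b k epowr q = b k epowr r * S epowr (- (q / p))" for k
    proof -
      have "b k epowr (q / (p - q) * q) * b k epowr q = b k epowr r"
        using epowr_add[of "q / (p - q) * q" q "b k"] q qp by (simp add: r_def field_simps)
      moreover have "d k epowr q * b k epowr q = (b k epowr (q / (p - q) * q) * b k epowr q) * S epowr (- (q / p))"
        using q by (simp add: d_def epowr_mult epowr_epowr mult_ac)
      ultimately show ?thesis by (simp only:)
    qed
    define f where "f x = (\<Sum>k\<in>F. d k * h k x)" for x
    have f: "f \<in> Mplus" unfolding f_def by (intro Mplus_sum Mplus_mult Mplus_const h)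
    have fp: "f x epowr p * v x = (\<Sum>k\<in>F. d k epowr p * (h k x epowr p * v x))" for x
    proof (cases "\<exists>k\<in>F. x \<in> einterval (t (k - 1)) (t k)")
      case True
      then obtain k where k: "k \<in> F" "x \<in> einterval (t (k - 1)) (t k)" by blast
      have zero: "h j x = 0" if "j \<in> F" "j \<noteq> k" for j
        using h(2) Delta_disjoint[of k j x] that k F(2) by blast
      have "f x = (\<Sum>j\<in>F. if j = k then d k * h k x else 0)"
        unfolding f_def using zero by (intro sum.cong) auto
      moreover have "(\<Sum>j\<in>F. d j epowr p * (h j x epowr p * v x)) = (\<Sum>j\<in>F. if j = k then d k epowr p * (h k x epowr p * v x) else 0)"
        using zero p by (intro sum.cong) auto
      ultimately show ?thesis using k F(1) p by (simp add: sum.delta epowr_mult mult.assoc)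
    next
      case False
      then have "\<And>k. k \<in> F \<Longrightarrow> h k x = 0" using h(2) by blast
      then show ?thesis using p by (simp add: f_def)
    qed
    have "ivl_int 0 \<infinity> (\<lambda>x. f x epowr p * v x) = (\<Sum>k\<in>F. ivl_int 0 \<infinity> (\<lambda>x. d k epowr p * (h k x epowr p * v x)))"
      unfolding fp using F(1) by (intro ivl_int_sum Mplus_mult Mplus_const Mplus_energy h) auto
    also have "\<dots> = (\<Sum>k\<in>F. d k epowr p * local_energy k (h k))"
    proof (rule sum.cong)
      fix k assume k: "k \<in> F"
      show "ivl_int 0 \<infinity> (\<lambda>x. d k epowr p * (h k x epowr p * v x)) = d k epowr p * local_energy k (h k)"
        using energy_support[of k "h k"] h(2)[OF k] k F(2) by (subst ivl_int_cmult[OF Mplus_energy[OF h(1)[OF k]]]) auto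
    qed simp
    also have "\<dots> \<le> (\<Sum>k\<in>F. d k epowr p * 1)"
      by (intro sum_mono mult_left_mono h) auto
    also have "\<dots> = 1"
      unfolding mult_1_right dp sum_distrib_right[symmetric] S_def[symmetric] by (rule SS)
    finally have E: "ivl_int 0 \<infinity> (\<lambda>x. f x epowr p * v x) \<le> 1" .
    have "S * S epowr (- (q / p)) = (\<Sum>k\<in>F. d k epowr q * b k epowr q)"
      unfolding dq S_def by (rule sum_distrib_right)
    also have "\<dots> \<le> (\<Sum>k\<in>F. K * local_term f k)"
    proof (rule sum_mono)
      fix k assume k: "k \<in> F"
      have "d k epowr q * b k epowr q \<le> d k epowr q * (K * local_term (h k) k)"
        by (intro mult_left_mono b k) auto
      also have "\<dots> = K * local_term (\<lambda>x. d k * h k x) k"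
        using local_term_cmult[of k "h k" "d k"] k F(2) h(1) by (simp add: subsetD mult.left_commute)
      also have "\<dots> \<le> K * local_term f k"
        unfolding f_def using member_le_sum[of k F "\<lambda>k. d k * h k x" for x] k F(1)
        by (intro mult_left_mono local_term_mono) auto
      finally show "d k epowr q * b k epowr q \<le> K * local_term f k" .
    qed
    also have "\<dots> \<le> K * (lower_const * num_q f)"
      unfolding sum_distrib_left[symmetric]
      using sum_local_term_le[OF F] by (intro mult_left_mono) auto
    also have "\<dots> \<le> K * (lower_const * opt epowr q)"
      by (intro mult_left_mono num_q_le_opt f E) auto
    finally have "S * S epowr (- (q / p)) \<le> (K * lower_const) * opt epowr q" by (simp add: mult.assoc)
    moreover have "S * S epowr (- (q / p)) = S epowr (1 - q / p)"
      using epowr_add_finite[OF S0 Sfin, of 1 "- (q / p)"] by simp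
    ultimately have "(S epowr (1 - q / p)) epowr (1 / q) \<le> ((K * lower_const) * opt epowr q) epowr (1 / q)"
      using q by (intro epowr_mono) auto
    also have "\<dots> = (K * lower_const) epowr (1 / q) * opt"
      using q by (simp add: epowr_mult epowr_epowr)
    also have "(S epowr (1 - q / p)) epowr (1 / q) = S epowr ((p - q) / (p * q))"
      using p q by (simp add: epowr_epowr field_simps)
    finally show ?thesis by (simp add: S_def r_def)
  qed
qed

text \<open>\<open>combine_extremals\<close> needs finite values with witnesses. Half of a positive
  B k is such a value if B k is finite, which \<open>attained_le_opt\<close> yields when the best
  constant is finite; if it is infinite, so is the right side, because K > 0.\<close>

lemma attained_sum_le_opt:
  assumes qp: "q < p" and B: "attained K B" and K: "0 < K" "K < top" and F: "finite F" "F \<subseteq> KK"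
  shows "(\<Sum>k\<in>F. B k epowr (p * q / (p - q))) epowr ((p - q) / (p * q)) \<le> 2 * (K * lower_const) epowr (1 / q) * opt"
proof (cases "opt < top")
  case False
  have "0 < (K * lower_const) epowr (1 / q)"
    using K lower_const q by (simp add: ennreal_zero_less_mult_iff)
  then have "2 * (K * lower_const) epowr (1 / q) * opt = top"
    using False by (auto simp: less_top[symmetric] ennreal_mult_top)
  then show ?thesis by simp
next
  case True
  define P where "P k b h \<longleftrightarrow> B k \<le> 2 * b \<and> b < top \<and> h \<in> Mplus \<and> (\<forall>x. x \<notin> einterval (t (k - 1)) (t k) \<longrightarrow> h x = 0)
    \<and> local_energy k h \<le> 1 \<and> b epowr q \<le> K * local_term h k" for k b h
  have ex: "\<exists>b h. P k b h" if k: "k \<in> F" for k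
  proof -
    have "k \<in> KK" using k F by auto
    have "(K * lower_const) epowr (1 / q) * opt < top"
      using K lower_const q True by (simp add: ennreal_mult_less_top)
    then have "B k < top" using attained_le_opt[OF B \<open>k \<in> KK\<close>] by (rule le_less_trans[rotated])
    then consider "B k = 0" | s where "0 < s" "B k = ennreal s" by (cases "B k" rule: ennreal_cases3) auto
    then show ?thesis
    proof cases
      case 1
      then show ?thesis
        using p q Mplus_const by (intro exI[of _ 0] exI[of _ "\<lambda>_. 0"]) (auto simp: P_def)
    next
      case 2
      then have "ennreal (s / 2) < B k" by (simp add: ennreal_less_iff)
      then obtain h where "h \<in> Mplus" "\<forall>x. x \<notin> einterval (t (k - 1)) (t k) \<longrightarrow> h x = 0"
        "local_energy k h \<le> 1" "ennreal (s / 2) epowr q \<le> K * local_term h k"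
        using B \<open>k \<in> KK\<close> unfolding attained_def by blast
      moreover have "B k \<le> 2 * ennreal (s / 2)"
      proof -
        have "2 * ennreal (s / 2) = ennreal 2 * ennreal (s / 2)" by simp
        also have "\<dots> = ennreal (2 * (s / 2))" using 2 by (intro ennreal_mult[symmetric]) auto
        finally show ?thesis using 2 by simp
      qed
      ultimately show ?thesis by (intro exI[of _ "ennreal (s / 2)"] exI[of _ h]) (auto simp: P_def)
    qed
  qed
  from ex have "\<forall>k\<in>F. \<exists>b. \<exists>h. P k b h" by blast
  from bchoice[OF this] obtain b where "\<forall>k\<in>F. \<exists>h. P k (b k) h" ..
  from bchoice[OF this] obtain h where bh: "\<forall>k\<in>F. P k (b k) (h k)" ..
  let ?r = "p * q / (p - q)"
  have r: "0 < ?r" "0 < (p - q) / (p * q)" "?r * ((p - q) / (p * q)) = 1" using p q qp by auto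
  have "(\<Sum>k\<in>F. B k epowr ?r) \<le> (\<Sum>k\<in>F. (2 * b k) epowr ?r)"
    using bh r by (intro sum_mono epowr_mono) (auto simp: P_def)
  also have "\<dots> = 2 epowr ?r * (\<Sum>k\<in>F. b k epowr ?r)"
    using r by (simp add: epowr_mult sum_distrib_left)
  finally have "(\<Sum>k\<in>F. B k epowr ?r) epowr ((p - q) / (p * q)) \<le> (2 epowr ?r * (\<Sum>k\<in>F. b k epowr ?r)) epowr ((p - q) / (p * q))"
    using r by (intro epowr_mono) auto
  also have "\<dots> = 2 * (\<Sum>k\<in>F. b k epowr ?r) epowr ((p - q) / (p * q))"
    using r by (simp only: epowr_mult less_imp_le epowr_epowr epowr_1_right)
  also have "\<dots> \<le> 2 * ((K * lower_const) epowr (1 / q) * opt)"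
    using bh by (intro mult_left_mono combine_extremals[OF qp F, of h]) (auto simp: P_def)
  finally show ?thesis by (simp add: mult.assoc)
qed

lemma outer_norm_le_opt:
  assumes T: "attained K T" and K: "0 < K" "K < top"
  shows "outer_norm T \<le> 2 * (K * lower_const) epowr (1 / q) * opt"
proof (cases "p \<le> q")
  case True
  have "(SUP k\<in>KK. T k) \<le> (K * lower_const) epowr (1 / q) * opt"
    by (intro SUP_least attained_le_opt T)
  also have "\<dots> \<le> 2 * (K * lower_const) epowr (1 / q) * opt"
    by (intro mult_right_mono) (auto simp: mult_2)
  finally show ?thesis using True by (simp add: outer_norm_def)
next
  case False
  then have a: "0 < (p - q) / (p * q)" "q < p" using p q by auto
  show ?thesis
    using False attained_sum_le_opt[OF a(2) T K]
    by (auto simp: outer_norm_def nonneg_infsum_complete[OF zero_le] epowr_SUP[OF a(1)] intro!: SUP_least)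
qed

lemma energy_sum_le:
  assumes h: "h \<in> Mplus" and F: "finite F" "F \<subseteq> KK"
  shows "(\<Sum>k\<in>F. local_energy k h) \<le> energy p v h 0 \<infinity>"
  using F by (intro sum_disjoint_le Mplus_energy h) auto

lemma energy_le:
  assumes "k \<in> KK" shows "local_energy k h \<le> energy p v h 0 \<infinity>"
  using t_pos[OF assms] by (intro ivl_int_subset) auto

text \<open>The energies over the disjoint intervals add up to at most the full energy, so
  \<open>sum_mixed_le\<close> turns the local bounds into a global one.\<close>

lemma opt_le_outer_norm:
  assumes CW: "Hardy_constant \<theta> \<alpha> CW" and CP: "Hardy_constant \<theta> q CP"
    and T: "\<And>k h. k \<in> KK \<Longrightarrow> h \<in> Mplus \<Longrightarrow> local_energy k h < top
      \<Longrightarrow> local_term h k \<le> K * (T k epowr q * local_energy k h epowr (q / p))"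
  shows "opt \<le> (upper_const CW CP * (2 * K)) epowr (1 / q) * outer_norm T"
proof (rule opt_le)
  fix h assume h: "h \<in> Mplus" and E: "energy p v h 0 \<infinity> < top" (is "?E < top")
  have "num_q h \<le> upper_const CW CP * ((2 * K) * (outer_norm T epowr q * ?E epowr (q / p)))"
  proof (rule num_q_le[OF CW CP h], rule mult_left_mono)
    fix F assume F: "finite F" "F \<subseteq> KK"
    have "(\<Sum>k\<in>F. local_term h k) \<le> (\<Sum>k\<in>F. K * (T k epowr q * local_energy k h epowr (q / p)))"
      using F by (intro sum_mono T h le_less_trans[OF energy_le E]) auto
    also have "\<dots> \<le> K * (2 * (outer_norm T epowr q * (\<Sum>k\<in>F. local_energy k h) epowr (q / p)))"
      unfolding sum_distrib_left[symmetric] by (intro mult_left_mono sum_mixed_le F) auto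
    also have "\<dots> \<le> K * (2 * (outer_norm T epowr q * ?E epowr (q / p)))"
      using p q by (intro mult_left_mono epowr_mono energy_sum_le h F) auto
    finally show "(\<Sum>k\<in>F. local_term h k) \<le> (2 * K) * (outer_norm T epowr q * ?E epowr (q / p))"
      by (simp add: mult_ac)
  qed simp
  also have "\<dots> = ((upper_const CW CP * (2 * K)) epowr (1 / q) * outer_norm T) epowr q * ?E epowr (q / p)"
    using q by (simp add: epowr_mult epowr_epowr mult_ac)
  finally show "num_q h \<le> ((upper_const CW CP * (2 * K)) epowr (1 / q) * outer_norm T) epowr q * ?E epowr (q / p)" .
qed

section \<open>The best constants of the local inequalities\<close>

definition sup_term :: "int \<Rightarrow> ennreal"
  where "sup_term k = (SUP x\<in>Delta t (k - 1). \<phi> x * dual_int p v x (t k) epowr (1 / conj_exp p))"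

text \<open>This is \<open>Hardy_integral\<close> with \<open>\<phi>\<close>^m in place of Psi;
  \<open>sup_term\<close> is in the same sense the Muckenhoupt constant of the local
  inequality.\<close>

definition int_local :: "int \<Rightarrow> ennreal"
  where "int_local k = ivl_int (t (k - 1)) (t k) (\<lambda>x. \<phi> (ereal x) epowr (m * p / (p - m))
    * dual_int p v (ereal x) (t k) epowr (p * (m - 1) / (p - m)) * dual_weight p v x)"

definition int_term :: "int \<Rightarrow> ennreal"
  where "int_term k = int_local k epowr ((p - m) / (m * p))"

abbreviation "finite_dual \<equiv> \<forall>k\<in>KK. dual_int p v (t (k - 1)) (t k) < top"

lemma D1_eq: "D1 p q m u w v t = (SUP k\<in>KK. sup_term k)"
  by (simp add: D1_def sup_term_def)

lemma outer_norm_sup_term: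
  "outer_norm sup_term = (if p \<le> q then D1 p q m u w v t else D2 p q m u w v t)"
proof (cases "p \<le> q")
  case False
  then have r: "0 < p * q / (p - q)" using p q by simp
  show ?thesis
    unfolding D2_def Let_def sup_term_def outer_norm_def epowr_SUP[OF r]
    using r False by (simp add: epowr_mult epowr_epowr mult.commute[of "conj_exp p"])
qed (simp add: outer_norm_def D1_eq)

lemma outer_norm_int_term:
  assumes "m < p"
  shows "outer_norm int_term = (if p \<le> q then D3 p q m u w v t else D4 p q m u w v t)"
proof (cases "p \<le> q")
  case False
  then have "(p - m) / (m * p) * (p * q / (p - q)) = q * (p - m) / (m * (p - q))"
    using assms p m by (simp add: field_simps)
  then show ?thesis
    unfolding D4_def Let_def int_term_def int_local_def outer_norm_def epowr_epowr Delta_int_def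
    using False by simp
qed (simp add: outer_norm_def D3_def int_term_def int_local_def Delta_int_def)

lemma phi_le_sup_term:
  assumes "k \<in> KK" "t (k - 1) \<le> x" "x \<le> t k"
  shows "\<phi> x * dual_int p v x (t k) epowr (1 / conj_exp p) \<le> sup_term k"
  unfolding sup_term_def using assms by (intro SUP_upper) (auto simp: Delta_def)

text \<open>At the left end \<open>\<phi>\<close> is positive, so a divergent integral of sigma is
  not lost in a product 0 * top.\<close>

lemma sup_term_infinite:
  assumes k: "k \<in> KK" and V: "\<not> dual_int p v (t (k - 1)) (t k) < top"
  shows "sup_term k = top"
proof -
  have "\<phi> (t (k - 1)) * dual_int p v (t (k - 1)) (t k) epowr (1 / conj_exp p) = top"
    using V phi_pos[OF t_pos[OF k]] conj_exp_props(1)[OF p]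
    by (auto simp: less_top[symmetric] ennreal_mult_eq_top_iff)
  then show ?thesis
    using phi_le_sup_term[OF k order_refl t_mono1[OF k]] by (simp add: top_unique)
qed

text \<open>A function nearly extremal for Hoelder's inequality on [x, \<open>t k\<close>] has a
  large integral there, and \<open>Hardy_form_at\<close> turns this into a lower bound for the local
  form. The argument is the same for every order of p, m and q, so it yields the bound by D1 in all
  four cases.\<close>

lemma attained_sup_term: "attained (phi_const epowr \<alpha> * 2 epowr \<alpha>) sup_term"
  unfolding attained_def
proof (intro ballI allI impI)
  fix k \<beta> assume k: "k \<in> KK" and "\<beta> < sup_term k"
  then obtain x where x: "t (k - 1) \<le> x" "x \<le> t k"
    and \<beta>: "\<beta> < \<phi> x * dual_int p v x (t k) epowr (1 / conj_exp p)"
    unfolding sup_term_def less_SUP_iff by (auto simp: Delta_def)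
  have x0: "0 < x" using t_pos[OF k] x(1) by simp
  obtain f where f: "0 < f" "\<phi> x = ennreal f"
    using phi_pos[OF x0] phi_fin_le[OF k x(2)] by (cases "\<phi> x" rule: ennreal_cases3) auto
  define \<beta>' where "\<beta>' = inverse (\<phi> x) * \<beta>"
  have cancel: "\<phi> x * \<beta>' = \<beta>" "inverse (\<phi> x) * (\<phi> x * z) = z" for z
    using f by (simp_all add: \<beta>'_def mult.assoc[symmetric] inverse_ennreal ennreal_mult[symmetric])
  have "\<beta>' < dual_int p v x (t k) epowr (1 / conj_exp p)"
  proof (rule ccontr)
    assume "\<not> ?thesis"
    then have "\<phi> x * dual_int p v x (t k) epowr (1 / conj_exp p) \<le> \<phi> x * \<beta>'"
      by (intro mult_left_mono) auto
    then show False using \<beta> cancel(1) by simp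
  qed
  from dual_weight_extremal[OF p v less_imp_le[OF x0] this]
  obtain h where h: "h \<in> Mplus" "\<And>y. y \<notin> einterval x (t k) \<Longrightarrow> h y = 0"
    "energy p v h x (t k) \<le> 1" "\<beta>' \<le> ivl_int x (t k) h" by blast
  have supp: "h y = 0" if "y \<notin> einterval (t (k - 1)) (t k)" for y
    using that x(1) by (intro h(2)) (auto simp: einterval_iff)
  have "local_energy k h = ivl_int (t (k - 1)) (t k) (\<lambda>y. (h y epowr p * v y) * indicator (einterval x (t k)) y)"
    using h(2) p by (intro ivl_int_cong) (auto split: split_indicator)
  also have "\<dots> = energy p v h x (t k)"
    using x by (intro ivl_int_indicator) auto
  finally have E: "local_energy k h \<le> 1" using h(3) by simp
  have "\<beta> epowr m = \<phi> x epowr m * \<beta>' epowr m"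
    using m by (simp add: cancel(1)[symmetric] epowr_mult)
  also have "\<dots> \<le> (phi_const * local_primitive k x) * ivl_int x (t k) h epowr m"
    using m by (intro mult_mono epowr_mono h phi_le_local_primitive k x) auto
  also have "\<dots> = phi_const * (local_primitive k x * ivl_int x (t k) h epowr m)"
    by (rule mult.assoc)
  also have "\<dots> \<le> phi_const * local_form k h"
    unfolding local_primitive_def local_form_def using t_pos[OF k]
    by (intro mult_left_mono Hardy_form_at Mplus_local_weight x m) auto
  finally have "(\<beta> epowr m) epowr \<alpha> \<le> (phi_const * local_form k h) epowr \<alpha>"
    using \<alpha> by (intro epowr_mono) auto
  also have "\<dots> = phi_const epowr \<alpha> * local_form k h epowr \<alpha>"
    using \<alpha> by (intro epowr_mult) auto
  also have "phi_const epowr \<alpha> * local_form k h epowr \<alpha> \<le> phi_const epowr \<alpha> * (2 epowr \<alpha> * local_term h k)"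
    by (intro mult_left_mono local_form_le_term k) auto
  finally have "\<beta> epowr q \<le> phi_const epowr \<alpha> * 2 epowr \<alpha> * local_term h k"
    by (simp only: epowr_epowr m\<alpha> mult.assoc)
  then show "\<exists>h\<in>Mplus. (\<forall>x. x \<notin> einterval (t (k - 1)) (t k) \<longrightarrow> h x = 0) \<and> local_energy k h \<le> 1
      \<and> \<beta> epowr q \<le> phi_const epowr \<alpha> * 2 epowr \<alpha> * local_term h k"
    using h(1) supp E by blast
qed

lemma local_upper_sup:
  assumes pm: "p \<le> m" and C1: "Hardy_constant 3 m C1" and k: "k \<in> KK" and h: "h \<in> Mplus"
    and E: "local_energy k h < top" and V: "dual_int p v (t (k - 1)) (t k) < top"
  shows "local_term h k \<le> 2 * (4 * C1 * 2 epowr m * primitive_const) epowr \<alpha>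
    * (sup_term k epowr q * local_energy k h epowr (q / p))"
proof -
  have t0: "0 \<le> t (k - 1)" using t_pos[OF k] by simp
  have B: "(\<phi> (t (k - 1)) epowr m + ivl_int (t (k - 1)) y (local_weight k)) * dual_int p v y (t k) epowr (m / conj_exp p)
      \<le> primitive_const * sup_term k epowr m" if y: "t (k - 1) \<le> y" "y \<le> t k" for y
  proof -
    let ?V = "dual_int p v y (t k)"
    have "local_primitive k y * ?V epowr (m / conj_exp p) \<le> (primitive_const * \<phi> y epowr m) * ?V epowr (m / conj_exp p)"
      by (intro mult_right_mono local_primitive_le k y) auto
    also have "\<dots> = primitive_const * (\<phi> y * ?V epowr (1 / conj_exp p)) epowr m"
      using m by (simp add: epowr_mult epowr_epowr mult.assoc)
    also have "\<dots> \<le> primitive_const * sup_term k epowr m"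
      using m by (intro mult_left_mono epowr_mono phi_le_sup_term k y) auto
    finally show ?thesis unfolding local_primitive_def .
  qed
  have "local_term h k \<le> 2 * (4 * C1 * 2 epowr m * ((primitive_const * sup_term k epowr m) * local_energy k h epowr (m / p))) epowr \<alpha>"
    unfolding local_form_def[symmetric]
    by (rule local_term_le_formI[OF k, unfolded local_form_def], rule Hardy_upper_sup[OF p pm C1 Mplus_local_weight v h t0 t_mono1[OF k]
        local_weight_fin[OF k] local_const[OF k] E V B])
  also have "\<dots> = 2 * (4 * C1 * 2 epowr m * primitive_const) epowr \<alpha> * (sup_term k epowr q * local_energy k h epowr (q / p))"
    using m q by (simp add: epowr_mult epowr_epowr mult_ac)
  finally show ?thesis .
qed

abbreviation "local_Hardy_integral k \<equiv>
  Hardy_integral (t (k - 1)) (t k) (\<phi> (t (k - 1)) epowr m) (local_weight k) p m v"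

lemma int_exponents:
  assumes "m < p"
  shows "m * (p / (p - m)) = m * p / (p - m)" "(p - m) / p * (q / m) = (p - m) / (m * p) * q"
    "m / p * (q / m) = q / p" "0 < m * p / (p - m)" "0 < (p - m) / (m * p)"
    "m * p / (p - m) * ((p - m) / (m * p)) = 1"
    "m * (p - 1) / (p - m) * ((p - m) / (m * p)) = 1 / conj_exp p"
  using assms p m q by (auto simp: conj_exp_def field_simps)

text \<open>The constants come out unchanged, because the exponents p / (p - m) inside and (p - m) /
  p outside the integral are reciprocal.\<close>

lemma local_Hardy_integral_bounds:
  assumes k: "k \<in> KK" and mp: "m < p"
  shows "local_Hardy_integral k epowr ((p - m) / p) \<le> primitive_const * int_local k epowr ((p - m) / p)"
    and "int_local k epowr ((p - m) / p) \<le> phi_const * local_Hardy_integral k epowr ((p - m) / p)"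
proof -
  note ex = Hardy_exponents[OF p m mp] int_exponents[OF mp]
  have t0: "0 \<le> t (k - 1)" using t_pos[OF k] by simp
  let ?r = "p / (p - m)"
  define G where "G = (\<lambda>s. dual_int p v (ereal s) (t k) epowr (p * (m - 1) / (p - m)) * dual_weight p v s)"
  have G: "G \<in> Mplus" unfolding G_def by (intro Mplus_mult Mplus_epowr Mplus_tail v)
  have I: "int_local k = ivl_int (t (k - 1)) (t k) (\<lambda>s. \<phi> (ereal s) epowr (m * ?r) * G s)"
    unfolding int_local_def G_def ex(8) by (simp only: mult.assoc)
  have J: "local_Hardy_integral k = ivl_int (t (k - 1)) (t k) (\<lambda>s. local_primitive k (ereal s) epowr ?r * G s)"
    unfolding Hardy_integral_def G_def local_primitive_def ..
  have IM: "(\<lambda>s. \<phi> (ereal s) epowr (m * ?r) * G s) \<in> Mplus"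
    by (intro Mplus_mult Mplus_epowr G Mplus_mono phi_mono) auto
  have JM: "(\<lambda>s. local_primitive k (ereal s) epowr ?r * G s) \<in> Mplus"
    unfolding local_primitive_def by (intro Mplus_mult Mplus_epowr Mplus_add Mplus_const G Mplus_mono ivl_int_subset) auto
  have pow: "X epowr ((p - m) / p) \<le> K * Y epowr ((p - m) / p)" if "X \<le> K epowr ?r * Y" for X Y K
  proof -
    have "X epowr ((p - m) / p) \<le> (K epowr ?r * Y) epowr ((p - m) / p)"
      using that ex(3) by (intro epowr_mono) auto
    also have "\<dots> = K * Y epowr ((p - m) / p)"
      using ex(3,6) by (simp only: epowr_mult less_imp_le epowr_epowr epowr_1_right)
    finally show ?thesis .
  qed
  show "local_Hardy_integral k epowr ((p - m) / p) \<le> primitive_const * int_local k epowr ((p - m) / p)"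
  proof (rule pow)
    show "local_Hardy_integral k \<le> primitive_const epowr ?r * int_local k"
      unfolding I J
    proof (rule ivl_int_le_const[OF t0 IM])
      fix s assume s: "t (k - 1) < ereal s"
      have "local_primitive k (ereal s) epowr ?r \<le> (primitive_const * \<phi> (ereal s) epowr m) epowr ?r"
        using s ex(1) by (intro epowr_mono local_primitive_le k) auto
      also have "\<dots> = primitive_const epowr ?r * \<phi> (ereal s) epowr (m * ?r)"
        using ex(1) by (simp only: epowr_mult epowr_epowr)
      finally show "local_primitive k (ereal s) epowr ?r * G s \<le> primitive_const epowr ?r * (\<phi> (ereal s) epowr (m * ?r) * G s)"
        unfolding mult.assoc[symmetric] by (intro mult_right_mono) auto
    qed
  qed
  show "int_local k epowr ((p - m) / p) \<le> phi_const * local_Hardy_integral k epowr ((p - m) / p)"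
  proof (rule pow)
    show "int_local k \<le> phi_const epowr ?r * local_Hardy_integral k"
      unfolding I J
    proof (rule ivl_int_le_const[OF t0 JM])
      fix s assume s: "t (k - 1) < ereal s" "ereal s < t k"
      have "(\<phi> (ereal s) epowr m) epowr ?r \<le> (phi_const * local_primitive k (ereal s)) epowr ?r"
        using s ex(1) by (intro epowr_mono phi_le_local_primitive k) auto
      also have "\<dots> = phi_const epowr ?r * local_primitive k (ereal s) epowr ?r"
        using ex(1) by (intro epowr_mult) auto
      finally show "\<phi> (ereal s) epowr (m * ?r) * G s \<le> phi_const epowr ?r * (local_primitive k (ereal s) epowr ?r * G s)"
        unfolding mult.assoc[symmetric] epowr_epowr by (intro mult_right_mono) auto
    qed
  qed
qed

lemma local_upper_int:
  assumes mp: "m < p" and C1: "Hardy_constant 3 m C1" and C2: "tail_lower_constant (m * (p - 1) / (p - m)) C2"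
    and C3: "Hardy_constant 3 1 C3" and k: "k \<in> KK" and h: "h \<in> Mplus"
    and E: "local_energy k h < top" and V: "dual_int p v (t (k - 1)) (t k) < top"
  shows "local_term h k \<le> 2 * (4 * C1 * 2 epowr m * 2 * (C2 * C3) epowr ((p - m) / p) * primitive_const) epowr \<alpha>
    * (int_term k epowr q * local_energy k h epowr (q / p))"
proof -
  note ex = int_exponents[OF mp]
  have t0: "0 \<le> t (k - 1)" using t_pos[OF k] by simp
  let ?C = "4 * C1 * 2 epowr m * 2 * (C2 * C3) epowr ((p - m) / p)"
  have "local_form k h \<le> ?C * (local_Hardy_integral k epowr ((p - m) / p) * local_energy k h epowr (m / p))"
    unfolding local_form_def
    by (rule Hardy_upper_int[OF p m mp C1 C2 C3 Mplus_local_weight v h t0 t_mono1[OF k] local_weight_fin[OF k] local_const[OF k] E V])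
  also have "\<dots> \<le> ?C * (primitive_const * int_local k epowr ((p - m) / p) * local_energy k h epowr (m / p))"
    by (intro mult_left_mono mult_right_mono local_Hardy_integral_bounds k mp) auto
  finally have "local_term h k \<le> 2 * (?C * (primitive_const * int_local k epowr ((p - m) / p) * local_energy k h epowr (m / p))) epowr \<alpha>"
    by (rule local_term_le_formI[OF k])
  also have "\<dots> = 2 * (?C * primitive_const) epowr \<alpha> * (int_term k epowr q * local_energy k h epowr (q / p))"
    unfolding int_term_def using \<alpha>
    by (simp only: epowr_mult less_imp_le epowr_epowr ex(2,3) mult.assoc)
  finally show ?thesis .
qed

text \<open>The summand 1 makes the constant positive even if \<open>C2\<close> or \<open>C3\<close>
  should be 0, as \<open>outer_norm_le_opt\<close> demands.\<close>

lemma attained_int_term: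
  assumes mp: "m < p" and C2: "tail_upper_constant (m * (p - 1) / (p - m)) C2"
    and C3: "tail_lower_constant ((p - 1) / (p - m)) C3" and fin: finite_dual
  shows "attained ((phi_const * (3 epowr (p / (p - m)) * C2 * C3 epowr m * 2)) epowr \<alpha> * 2 epowr \<alpha> + 1) int_term"
    (is "attained ((phi_const * ?C) epowr \<alpha> * 2 epowr \<alpha> + 1) int_term")
  unfolding attained_def
proof (intro ballI allI impI)
  fix k \<beta> assume k: "k \<in> KK" and \<beta>: "\<beta> < int_term k"
  have V: "dual_int p v (t (k - 1)) (t k) < top" using fin k by simp
  have t0: "0 \<le> t (k - 1)" using t_pos[OF k] by simp
  obtain h where h: "h \<in> Mplus" "\<forall>s. s \<notin> einterval (t (k - 1)) (t k) \<longrightarrow> h s = 0" "local_energy k h \<le> 1"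
    "local_Hardy_integral k epowr ((p - m) / p) \<le> ?C * local_form k h"
    using Hardy_lower_int[OF p m mp C2 C3 Mplus_local_weight v t0 t_mono1[OF k] local_weight_fin[OF k] local_const[OF k] V]
    unfolding local_form_def by blast
  have "\<beta> epowr q \<le> int_term k epowr q" using \<beta> q by (intro epowr_mono) auto
  also have "\<dots> = (int_local k epowr ((p - m) / p)) epowr \<alpha>"
    unfolding int_term_def by (simp only: epowr_epowr int_exponents[OF mp])
  also have "\<dots> \<le> (phi_const * (?C * local_form k h)) epowr \<alpha>"
    using \<alpha> by (intro epowr_mono order_trans[OF local_Hardy_integral_bounds(2)[OF k mp]] mult_left_mono h) auto
  also have "\<dots> = (phi_const * ?C) epowr \<alpha> * local_form k h epowr \<alpha>"
    using \<alpha> by (simp only: epowr_mult less_imp_le mult.assoc)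
  also have "\<dots> \<le> (phi_const * ?C) epowr \<alpha> * (2 epowr \<alpha> * local_term h k)"
    by (intro mult_left_mono local_form_le_term k) auto
  also have "\<dots> \<le> ((phi_const * ?C) epowr \<alpha> * 2 epowr \<alpha> + 1) * local_term h k"
    unfolding mult.assoc[symmetric] by (intro mult_right_mono) auto
  finally show "\<exists>h\<in>Mplus. (\<forall>x. x \<notin> einterval (t (k - 1)) (t k) \<longrightarrow> h x = 0) \<and> local_energy k h \<le> 1
      \<and> \<beta> epowr q \<le> ((phi_const * ?C) epowr \<alpha> * 2 epowr \<alpha> + 1) * local_term h k"
    using h by blast
qed

lemma sup_term_le_int_term:
  assumes mp: "m < p" and C: "tail_lower_constant (m * (p - 1) / (p - m)) C" and k: "k \<in> KK"
    and V: "1 \<le> m \<or> dual_int p v (t (k - 1)) (t k) < top"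
  shows "sup_term k \<le> C epowr ((p - m) / (m * p)) * int_term k"
proof -
  define \<gamma> where "\<gamma> = m * (p - 1) / (p - m)"
  note ex = Hardy_exponents[OF p m mp] int_exponents[OF mp]
  note ex' = ex[folded \<gamma>_def] and C = C[folded \<gamma>_def]
  have \<gamma>1: "1 \<le> \<gamma>" if "1 \<le> m"
  proof -
    have "p - m \<le> m * (p - 1)" using that p mult_right_mono[of 1 m p] by (simp add: algebra_simps)
    then show ?thesis using mp by (simp add: \<gamma>_def)
  qed
  show ?thesis
    unfolding sup_term_def
  proof (rule SUP_least)
    fix x assume "x \<in> Delta t (k - 1)"
    then have x: "t (k - 1) \<le> x" "x \<le> t k" by (auto simp: Delta_def)
    have x0: "0 \<le> x" using t_pos[OF k] x(1) by simp
    have \<sigma>: "dual_weight p v \<in> Mplus" by (intro Mplus_epowr v)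
    let ?V = "dual_int p v x (t k)"
    have fin: "1 \<le> \<gamma> \<or> ?V < top"
      using V \<gamma>1 le_less_trans[OF ivl_int_subset[OF x(1) order_refl]] by blast
    define G where "G = (\<lambda>s. dual_int p v (ereal s) (t k) epowr (p * (m - 1) / (p - m)) * dual_weight p v s)"
    have G: "G \<in> Mplus" unfolding G_def by (intro Mplus_mult Mplus_tail \<sigma> Mplus_epowr v)
    have "\<phi> x epowr (m * p / (p - m)) * ?V epowr \<gamma> \<le> \<phi> x epowr (m * p / (p - m)) * (C * ivl_int x (t k) G)"
      unfolding G_def ex'(4)[symmetric] using C \<sigma> x0 x fin
      by (intro mult_left_mono) (auto simp: tail_lower_constant_def)
    also have "\<dots> = C * (\<phi> x epowr (m * p / (p - m)) * ivl_int x (t k) G)" by (rule mult.left_commute)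
    also have "\<dots> \<le> C * ivl_int x (t k) (\<lambda>s. \<phi> (ereal s) epowr (m * p / (p - m)) * G s)"
      using x0 ex(11) by (intro mult_left_mono ivl_int_ge_const G mult_right_mono epowr_mono phi_mono) auto
    also have "\<dots> \<le> C * int_local k"
      unfolding int_local_def G_def mult.assoc using x by (intro mult_left_mono ivl_int_subset) auto
    finally have "(\<phi> x epowr (m * p / (p - m)) * ?V epowr \<gamma>) epowr ((p - m) / (m * p)) \<le> (C * int_local k) epowr ((p - m) / (m * p))"
      using ex(12) by (intro epowr_mono) auto
    then show "\<phi> x * ?V epowr (1 / conj_exp p) \<le> C epowr ((p - m) / (m * p)) * int_term k"
      unfolding int_term_def
      using ex(12) by (simp only: epowr_mult less_imp_le epowr_epowr ex'(13,14) epowr_1_right)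
  qed
qed

lemma not_finite_dual:
  assumes "\<not> finite_dual" shows "(SUP k\<in>KK. sup_term k) = top"
proof -
  obtain k where "k \<in> KK" "\<not> dual_int p v (t (k - 1)) (t k) < top"
    using assms by auto
  then have "sup_term k \<le> (SUP k\<in>KK. sup_term k)" "sup_term k = top"
    by (auto intro: SUP_upper sup_term_infinite)
  then show ?thesis by (simp add: top_unique)
qed

lemma finite_dual_if:
  assumes "\<forall>x::real. 0 < x \<longrightarrow> dual_int p v (ereal x) \<infinity> < \<infinity>"
  shows "finite_dual"
proof
  fix k assume k: "k \<in> KK"
  obtain x where x: "t (k - 1) = ereal x" "0 < x"
    using t_pos[OF k] t_fin[OF k] by (cases "t (k - 1)") auto
  have "dual_int p v (t (k - 1)) (t k) \<le> dual_int p v (ereal x) \<infinity>"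
    using x by (intro ivl_int_subset) auto
  also have "\<dots> < top" using assms x(2) by simp
  finally show "dual_int p v (t (k - 1)) (t k) < top" .
qed

end

section \<open>One constant for the whole class of data\<close>

lemma setting_discretization:
  assumes "1 < p" "0 < q" "0 < m" "0 < c" "(u, w, v, t) \<in> setting c m q"
  shows "weighted_discretization c m q u w t p v"
  using assms by unfold_locales (auto simp: setting_def)

lemma lesssim_onI:
  assumes "K < top" "\<And>x. x \<in> S \<Longrightarrow> A x \<le> K * B x"
  shows "lesssim_on S A B"
  unfolding lesssim_on_def
proof (intro exI conjI ballI)
  \<comment> \<open>The summand 1 turns a finite constant, possibly 0, into a positive real.\<close>
  show "0 < enn2real K + 1" by (simp add: add_nonneg_pos)
  fix x assume "x \<in> S"
  have "K \<le> ennreal (enn2real K + 1)"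
    using assms(1) by (simp add: ennreal_plus)
  then have "K * B x \<le> ennreal (enn2real K + 1) * B x" by (rule mult_right_mono) simp
  with assms(2)[OF \<open>x \<in> S\<close>] show "A x \<le> ennreal (enn2real K + 1) * B x" by (rule order_trans)
qed

text \<open>P will say that sigma is integrable over every interval, B is D1 and D is D3 or D4. The
  comparison with D is available on P only, but off P the quantity B is infinite, and so are C and B
  + D. On \<open>S'\<close> the bound of B by D removes B from the sum, both on P and off
  it.\<close>

lemma approx_on_combine:
  fixes C B D :: "'a \<Rightarrow> ennreal"
  assumes K: "K1 < top" "K2 < top" "K3 < top" "K4 < top" and sub: "S' \<subseteq> S"
    and 1: "\<And>x. x \<in> S \<Longrightarrow> P x \<Longrightarrow> C x \<le> K1 * D x"
    and 2: "\<And>x. x \<in> S \<Longrightarrow> P x \<Longrightarrow> D x \<le> K2 * C x"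
    and 3: "\<And>x. x \<in> S \<Longrightarrow> B x \<le> K3 * C x"
    and 4: "\<And>x. x \<in> S' \<Longrightarrow> B x \<le> K4 * D x"
    and 5: "\<And>x. x \<in> S \<Longrightarrow> \<not> P x \<Longrightarrow> B x = top"
  shows "approx_on S C (\<lambda>x. B x + D x) \<and> lesssim_on S' B D \<and> approx_on S' C D"
proof -
  have up: "C x \<le> (K1 + 1) * (B x + D x)" if "x \<in> S" for x
  proof (cases "P x")
    case True
    have "C x \<le> K1 * D x" by (rule 1[OF that True])
    also have "\<dots> \<le> (K1 + 1) * (B x + D x)" by (intro mult_mono) auto
    finally show ?thesis .
  next
    case False
    then show ?thesis using 5[OF that] by (simp add: ennreal_mult_top)
  qed
  have low: "B x + D x \<le> (K3 + K2) * C x" if "x \<in> S" for x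
  proof (cases "P x")
    case True
    show ?thesis unfolding distrib_right by (intro add_mono 3 2 that True)
  next
    case False
    then have "K3 * C x = top" using 5[OF that] 3[OF that] by (simp add: top_unique)
    then show ?thesis by (simp add: distrib_right)
  qed
  have up': "C x \<le> ((K1 + 1) * (K4 + 1)) * D x" if "x \<in> S'" for x
  proof -
    have "C x \<le> (K1 + 1) * (B x + D x)" using up that sub by auto
    also have "\<dots> \<le> (K1 + 1) * (K4 * D x + D x)" by (intro mult_left_mono add_mono 4 that) auto
    finally show ?thesis by (simp add: distrib_right mult.assoc)
  qed
  have low': "D x \<le> (K3 + K2) * C x" if "x \<in> S'" for x
  proof -
    have "D x \<le> B x + D x" by simp
    also have "\<dots> \<le> (K3 + K2) * C x" using low that sub by auto
    finally show ?thesis .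
  qed
  show ?thesis
    unfolding approx_on_def
    using K by (intro conjI lesssim_onI[OF _ up] lesssim_onI[OF _ low] lesssim_onI[OF _ up'] lesssim_onI[OF _ low']
        lesssim_onI[OF _ 4]) (auto simp: ennreal_mult_less_top)
qed

theorem corollary1p4:
  fixes p q m c :: real
  assumes "1 < p" and "0 < q" and "0 < m" and "0 < c"
  shows
    "let S = setting c m q;
         S' = {(u, w, v, t) \<in> S.
                1 \<le> m \<or> (\<forall>x::real. 0 < x \<longrightarrow>
                          ivl_int (ereal x) \<infinity> (\<lambda>s. v s epowr (1 - conj_exp p)) < \<infinity>)};
         C = (\<lambda>(u, w, v, t). best_const p q m u w v);
         D\<^sub>1 = (\<lambda>(u, w, v, t). D1 p q m u w v t);
         D\<^sub>2 = (\<lambda>(u, w, v, t). D2 p q m u w v t);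
         D\<^sub>3 = (\<lambda>(u, w, v, t). D3 p q m u w v t);
         D\<^sub>4 = (\<lambda>(u, w, v, t). D4 p q m u w v t)
     in (p \<le> m \<and> p \<le> q \<longrightarrow> approx_on S C D\<^sub>1)
      \<and> (p \<le> m \<and> q < p \<longrightarrow> approx_on S C D\<^sub>2)
      \<and> (m < p \<and> p \<le> q \<longrightarrow>
           approx_on S C (\<lambda>x. D\<^sub>1 x + D\<^sub>3 x) \<and> lesssim_on S' D\<^sub>1 D\<^sub>3 \<and> approx_on S' C D\<^sub>3)
      \<and> (m < p \<and> q < p \<longrightarrow>
           approx_on S C (\<lambda>x. D\<^sub>1 x + D\<^sub>4 x) \<and> lesssim_on S' D\<^sub>1 D\<^sub>4 \<and> approx_on S' C D\<^sub>4)"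
proof -
  define S where "S = setting c m q"
  define S' where "S' = {(u, w, v, t) \<in> S.
    1 \<le> m \<or> (\<forall>x::real. 0 < x \<longrightarrow> ivl_int (ereal x) \<infinity> (\<lambda>s. v s epowr (1 - conj_exp p)) < \<infinity>)}"
  define C where "C = (\<lambda>(u, w, v :: real \<Rightarrow> ennreal, t :: int \<Rightarrow> ereal). best_const p q m u w v)"
  define B1 where "B1 = (\<lambda>(u, w, v, t). D1 p q m u w v t)"
  \<comment> \<open>N1 and N2 are the outer norms of \<open>sup_term\<close> and
    \<open>int_term\<close>; the cases p <= q and q < p are told apart again only at the very
    end.\<close>
  define N1 where "N1 = (\<lambda>(u, w, v, t). if p \<le> q then D1 p q m u w v t else D2 p q m u w v t)"
  define N2 where "N2 = (\<lambda>(u, w, v, t). if p \<le> q then D3 p q m u w v t else D4 p q m u w v t)"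
  define P where "P = (\<lambda>(u, w, v, t). \<forall>k\<in>index_set m q u w. dual_int p v (t (k - 1)) (t k) < top)"
  note defs = C_def B1_def N1_def N2_def P_def prod.case
  have WD: "weighted_discretization c m q u w t p v" if "(u, w, v, t) \<in> S" for u w v t
    using setting_discretization[OF assms] that by (simp add: S_def)
  have \<theta>: "2 < 2 powr (q / m + 1)"
    using powr_less_mono[of 1 "q / m + 1" 2] assms by simp
  obtain CW where CW: "Hardy_constant (2 powr (q / m + 1)) (q / m) CW"
    using discrete_Hardy[OF \<theta>, of "q / m"] assms by auto
  obtain CP where CP: "Hardy_constant (2 powr (q / m + 1)) q CP"
    using discrete_Hardy[OF \<theta>, of q] assms by auto
  obtain C1 where C1: "Hardy_constant 3 m C1"
    using discrete_Hardy[of 3 m] assms by auto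
  define UC where "UC = discretization.upper_const m q CW CP"
  define LC where "LC = discretization.lower_const c m q"
  define PC where "PC = discretization.primitive_const m q"
  define FC where "FC = discretization.phi_const c m q"
  \<comment> \<open>Finiteness of these constants is known inside the locale only, so an element of
    S is needed to enter it; for empty S all relations hold trivially.\<close>
  have fin: "UC < top" "LC < top" "PC < top" "0 < FC" "FC < top" "C1 < top" if ne: "S \<noteq> {}"
  proof -
    obtain x where "x \<in> S" using ne by blast
    moreover obtain u w v t where "x = (u, w, v, t)" by (cases x)
    ultimately interpret weighted_discretization c m q u w t p v using WD by simp
    show "UC < top" "LC < top" "PC < top" "0 < FC" "FC < top" "C1 < top"
      unfolding UC_def LC_def PC_def FC_def
      using C1 by (auto simp: upper_const[OF CW CP] lower_const primitive_const phi_const Hardy_constant_def)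
  qed
  define K0 where "K0 = FC epowr (q / m) * 2 epowr (q / m)"
  have K0: "0 < K0" "K0 < top" if "S \<noteq> {}"
    using fin[OF that] assms by (auto simp: K0_def ennreal_zero_less_mult_iff ennreal_mult_less_top)
  define K1 where "K1 = 2 * (4 * C1 * 2 epowr m * PC) epowr (q / m)"
  have K1: "K1 < top" if "S \<noteq> {}"
    using fin[OF that] assms by (simp add: K1_def ennreal_mult_less_top)
  have N1_low: "N1 x \<le> 2 * (K0 * LC) epowr (1 / q) * C x" "B1 x \<le> N1 x" if "x \<in> S" for x
  proof -
    obtain u w v t where x: "x = (u, w, v, t)" by (cases x)
    then interpret weighted_discretization c m q u w t p v using WD that by simp
    have "S \<noteq> {}" using that by auto
    then show "N1 x \<le> 2 * (K0 * LC) epowr (1 / q) * C x"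
      unfolding x defs outer_norm_sup_term[symmetric] LC_def
      by (intro outer_norm_le_opt K0 attained_sup_term[folded FC_def, folded K0_def])
    show "B1 x \<le> N1 x"
      unfolding x defs outer_norm_sup_term[symmetric] unfolding D1_eq by (intro SUP_least term_le_outer_norm)
  qed
  have not_P: "B1 x = top" if "x \<in> S" "\<not> P x" for x
  proof (cases x)
    case (fields u w v t)
    then interpret weighted_discretization c m q u w t p v using WD that by simp
    show ?thesis using that(2) unfolding fields defs D1_eq by (rule not_finite_dual)
  qed
  have a: "approx_on S C N1" if pm: "p \<le> m"
  proof (cases "S = {}")
    case False
    \<comment> \<open>The summand 1 keeps the factor positive, so that off P, where N1 is infinite,
      the right side is infinite.\<close>
    have up: "C x \<le> ((UC * (2 * K1)) epowr (1 / q) + 1) * N1 x" if x: "x \<in> S" for x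
    proof (cases "P x")
      case True
      obtain u w v t where xx: "x = (u, w, v, t)" by (cases x)
      then interpret weighted_discretization c m q u w t p v using WD x by simp
      have "opt \<le> (UC * (2 * K1)) epowr (1 / q) * outer_norm sup_term"
        unfolding UC_def K1_def PC_def using True[unfolded xx P_def prod.case]
        by (intro opt_le_outer_norm[OF CW CP] local_upper_sup pm C1) auto
      also have "\<dots> \<le> ((UC * (2 * K1)) epowr (1 / q) + 1) * outer_norm sup_term"
        by (intro mult_right_mono) auto
      finally show ?thesis unfolding xx defs outer_norm_sup_term .
    next
      case False
      then have "N1 x = top" using not_P[OF x] N1_low(2)[OF x] by (simp add: top_unique)
      then show ?thesis by (simp add: ennreal_mult_top)
    qed
    show ?thesis
      unfolding approx_on_def using fin[OF False] K1[OF False] K0[OF False] assms(2)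
      by (intro conjI lesssim_onI[OF _ up] lesssim_onI[OF _ N1_low(1)]) (auto simp: ennreal_mult_less_top)
  qed (auto simp: approx_on_def lesssim_on_def intro: exI[of _ 1])
  have S'_cond: "1 \<le> m \<or> P x" "x \<in> S" if "x \<in> S'" for x
  proof -
    obtain u w v t where x: "x = (u, w, v, t)" by (cases x)
    show "x \<in> S" using that by (auto simp: S'_def)
    then interpret weighted_discretization c m q u w t p v using WD x by simp
    show "1 \<le> m \<or> P x" using that finite_dual_if unfolding x S'_def P_def by auto
  qed
  then have S'_sub: "S' \<subseteq> S" by blast
  have b: "approx_on S C (\<lambda>x. B1 x + N2 x) \<and> lesssim_on S' B1 N2 \<and> approx_on S' C N2" if mp: "m < p"
  proof (cases "S = {}")
    case True
    then have "S' = {}" using S'_sub by auto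
    with True show ?thesis by (auto simp: approx_on_def lesssim_on_def intro: exI[of _ 1])
  next
    case False
    define \<gamma> where "\<gamma> = m * (p - 1) / (p - m)"
    have \<gamma>: "0 < \<gamma>" using mp assms by (simp add: \<gamma>_def)
    obtain C2 where C2: "tail_lower_constant \<gamma> C2" by (rule tail_lower_constant_exists[OF \<gamma>])
    obtain C3 where C3: "Hardy_constant 3 1 C3" using discrete_Hardy[of 3 1] by auto
    obtain C4 where C4: "tail_upper_constant \<gamma> C4" by (rule tail_upper_constant_exists[OF \<gamma>])
    have "0 < (p - 1) / (p - m)" using mp assms by simp
    then obtain C5 where C5: "tail_lower_constant ((p - 1) / (p - m)) C5" by (rule tail_lower_constant_exists)
    have Cfin: "C2 < top" "C3 < top" "C4 < top" "C5 < top"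
      using C2 C3 C4 C5 by (auto simp: tail_lower_constant_def tail_upper_constant_def Hardy_constant_def)
    have e: "0 < (p - m) / p" "0 < (p - m) / (m * p)" "0 < p / (p - m)" using mp assms by auto
    define K where "K = 2 * (4 * C1 * 2 epowr m * 2 * (C2 * C3) epowr ((p - m) / p) * PC) epowr (q / m)"
    define L where "L = (FC * (3 epowr (p / (p - m)) * C4 * C5 epowr m * 2)) epowr (q / m) * 2 epowr (q / m) + 1"
    define M where "M = C2 epowr ((p - m) / (m * p))"
    have KL: "K < top" "0 < L" "L < top" "M < top"
      using fin[OF False] Cfin e assms by (auto simp: K_def L_def M_def ennreal_mult_less_top add_nonneg_pos)
    have K: "discretization.local_term m q u w t h k
        \<le> K * (weighted_discretization.int_term m q u w t p v k epowr q * energy p v h (t (k - 1)) (t k) epowr (q / p))"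
      if "(u, w, v, t) \<in> S" "P (u, w, v, t)" "k \<in> index_set m q u w" "h \<in> Mplus" "energy p v h (t (k - 1)) (t k) < top"
      for u w v t h k
      unfolding K_def PC_def
      using that by (intro weighted_discretization.local_upper_int[OF WD mp C1 C2[unfolded \<gamma>_def] C3]) (auto simp: P_def)
    have L: "weighted_discretization.attained m q u w t p v L (weighted_discretization.int_term m q u w t p v)"
      if "(u, w, v, t) \<in> S" "P (u, w, v, t)" for u w v t
      unfolding L_def FC_def
      using that by (intro weighted_discretization.attained_int_term[OF WD mp C4[unfolded \<gamma>_def] C5]) (auto simp: P_def)
    have M: "weighted_discretization.sup_term m q u w t p v k \<le> M * weighted_discretization.int_term m q u w t p v k"
      if "(u, w, v, t) \<in> S'" "k \<in> index_set m q u w" for u w v t k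
      unfolding M_def using S'_cond[OF that(1)] that(2)
      by (intro weighted_discretization.sup_term_le_int_term[OF WD mp C2[unfolded \<gamma>_def]]) (auto simp: P_def)
    show ?thesis
    \<comment> \<open>The bound of D1 by the best constant passes through N1, which for q < p is D2
      and dominates D1.\<close>
    proof (rule approx_on_combine[of "(UC * (2 * K)) epowr (1 / q)" "2 * (L * LC) epowr (1 / q)" "2 * (K0 * LC) epowr (1 / q)" M,
          OF _ _ _ KL(4) S'_sub _ _ order_trans[OF N1_low(2,1)] _ not_P])
      fix x assume x: "x \<in> S" "P x"
      obtain u w v t where xx: "x = (u, w, v, t)" by (cases x)
      then interpret weighted_discretization c m q u w t p v using WD x by simp
      show "C x \<le> (UC * (2 * K)) epowr (1 / q) * N2 x"
        unfolding xx defs outer_norm_int_term[OF mp, symmetric] UC_def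
        using x xx by (intro opt_le_outer_norm[OF CW CP] K) auto
      show "N2 x \<le> 2 * (L * LC) epowr (1 / q) * C x"
        unfolding xx defs outer_norm_int_term[OF mp, symmetric] LC_def
        using x xx by (intro outer_norm_le_opt L KL) auto
    next
      fix x assume x: "x \<in> S'"
      obtain u w v t where xx: "x = (u, w, v, t)" by (cases x)
      then interpret weighted_discretization c m q u w t p v using WD S'_cond(2)[OF x] by simp
      show "B1 x \<le> M * N2 x"
        unfolding xx defs D1_eq outer_norm_int_term[OF mp, symmetric] using x xx
        by (intro SUP_least order_trans[OF M] mult_left_mono term_le_outer_norm) auto
    qed (use fin[OF False] KL K0[OF False] assms(2) in \<open>auto simp: ennreal_mult_less_top\<close>)
  qed
  from a b show ?thesis
    unfolding S_def S'_def C_def B1_def N1_def N2_def Let_def by (cases "p \<le> q") auto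
qed

end
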